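(* Let $d\ge 2$ and $q\ge2$ be integers. For each $\beta\ge 0$, the free state $\mu_\beta^{\varnothing}$ of the $q$-state Potts model on $\mathbb{T}^d$ satisfies $$\mu_{\beta}^{\varnothing}\otimes\mu_{\beta}^{\varnothing}\left(\{(\eta^{(1)},\eta^{(2)}):\mu^{\eta^{(1)}}=\mu^{\eta^{(2)}}\}\right)\in\{0,1\},$$ where $\mu_{\beta}^{\varnothing}\otimes\mu_{\beta}^{\varnothing}$ is the product measure and $\mu^{\eta}=\lim_{n\to\infty}\mu^{\eta}_{V_n,\beta}$ (which is well defined for $\mu_\beta^{\varnothing}$-almost all $\eta$).
   Context: $\mathbb{T}^d$ is the Cayley tree with branching factor $d$, i.e. the infinite tree in which every vertex has degree $d+1$; $V(\mathbb{T}^d)$ is its vertex set, $u\sim v$ means that $uv$ is an edge, and $\Lambda\Subset V(\mathbb{T}^d)$ means that $\Lambda$ is a finite subset. Fix a root $o\in V(\mathbb{T}^d)$ and let $V_n$ be the set of vertices at graph distance at most $n$ from $o$. Put $\Omega=\{1,\dots,q\}^{V(\mathbb{T}^d)}$ with the product $\sigma$-algebra. For $\Lambda\Subset V(\mathbb{T}^d)$ and $\eta\in\{1,\dots,q\}^{\Lambda^c}$ (or $\eta\in\Omega$, using only its restriction to $\Lambda^c$), the $q$-state Potts model on $\Lambda$ with boundary condition $\eta$ is the probability measure on $\{1,\dots,q\}^\Lambda$ $$\mu^{\eta}_{\Lambda,\beta}(\sigma)=\frac{1}{Z^{\eta}_{\Lambda,\beta}}\exp\Big[\beta\sum_{u,v\in\Lambda:\,u\sim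 v}\delta_{\sigma_u,\sigma_v}+\beta\sum_{u\in\Lambda,\,v\in\Lambda^c:\,u\sim v}\delta_{\sigma_u,\eta_v}\Big],$$ where $\delta$ is the Kronecker delta, each edge is counted once, and $Z^{\eta}_{\Lambda,\beta}$ is the normalizing constant. The measure $\mu_{\Lambda,\beta}^{\varnothing}$ with free boundary conditions is obtained by removing the second sum. The free state $\mu_\beta^{\varnothing}$ is the unique probability measure on $\Omega$ such that for each $\Lambda\Subset V(\mathbb{T}^d)$ inducing a connected subgraph and each $s\in\{1,\dots,q\}^\Lambda$, $\mu_\beta^{\varnothing}(\sigma_u=s_u\ \forall u\in\Lambda)=\mu^{\varnothing}_{\Lambda,\beta}(\sigma_u=s_u\ \forall u\in\Lambda)$. For $\eta\in\Omega$, $\mu^\eta$ denotes the probability measure on $\Omega$ with $\mu^\eta(A)=\lim_{n\to\infty}\mu^{\eta}_{V_n,\beta}(A)$ for every local event $A$ (an event depending on finitely many spins; the right side makes sense for $n$ large), when these limits exist. By backward martingale convergence they exist for $\mu_\beta^{\varnothing}$-almost all $\eta$, so the event in the claim is defined up to a null set. *)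

theory Defs
  imports "HOL-Probability.Probability"
begin

text \<open>A simple graph on the vertex type \<open>'v\<close> is given by its adjacency relation.\<close>

definition connected_in :: "('v \<Rightarrow> 'v \<Rightarrow> bool) \<Rightarrow> 'v set \<Rightarrow> bool" where
  "connected_in adj \<Lambda> \<longleftrightarrow>
     (\<forall>u\<in>\<Lambda>. \<forall>v\<in>\<Lambda>. (\<lambda>x y. x \<in> \<Lambda> \<and> y \<in> \<Lambda> \<and> adj x y)\<^sup>*\<^sup>* u v)"

definition is_cycle :: "('v \<Rightarrow> 'v \<Rightarrow> bool) \<Rightarrow> 'v list \<Rightarrow> bool" where
  "is_cycle adj xs \<longleftrightarrow>
     length xs \<ge> 3 \<and> distinct xs \<and> successively adj xs \<and> adj (last xs) (hd xs)"

text \<open>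
  The \<open>(d+1)\<close>-regular tree is unique up to isomorphism; it is automatically infinite
  for \<open>d \<ge> 1\<close>. Since \<open>card\<close> of an infinite set is \<open>0\<close>, the degree condition implies
  that neighbourhoods are finite.
\<close>

locale cayley_tree =
  fixes adj :: "'v \<Rightarrow> 'v \<Rightarrow> bool" and d :: nat
  assumes adj_sym: "adj u v \<Longrightarrow> adj v u"
    and adj_irrefl: "\<not> adj u u"
    and connected: "connected_in adj UNIV"
    and acyclic: "\<not> is_cycle adj xs"
    and degree: "card {v. adj u v} = d + 1"

definition graph_dist :: "('v \<Rightarrow> 'v \<Rightarrow> bool) \<Rightarrow> 'v \<Rightarrow> 'v \<Rightarrow> nat" where
  "graph_dist adj u v = (LEAST n. (adj ^^ n) u v)"

definition graph_ball :: "('v \<Rightarrow> 'v \<Rightarrow> bool) \<Rightarrow> 'v \<Rightarrow> nat \<Rightarrow> 'v set" where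
  "graph_ball adj x n = {v. graph_dist adj x v \<le> n}"

abbreviation configs :: "nat \<Rightarrow> 'v set \<Rightarrow> ('v \<Rightarrow> nat) set" where
  "configs q \<Lambda> \<equiv> \<Lambda> \<rightarrow>\<^sub>E {1..q}"

definition inner_edges :: "('v \<Rightarrow> 'v \<Rightarrow> bool) \<Rightarrow> 'v set \<Rightarrow> 'v set set" where
  "inner_edges adj \<Lambda> = {{u, v} | u v. u \<in> \<Lambda> \<and> v \<in> \<Lambda> \<and> adj u v}"

definition boundary_edges :: "('v \<Rightarrow> 'v \<Rightarrow> bool) \<Rightarrow> 'v set \<Rightarrow> ('v \<times> 'v) set" where
  "boundary_edges adj \<Lambda> = {(u, v). u \<in> \<Lambda> \<and> v \<notin> \<Lambda> \<and> adj u v}"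

text \<open>
  Edges inside \<open>\<Lambda>\<close> are unordered, so each is counted once; for an edge \<open>e = {u, v}\<close> the
  summand is the Kronecker delta of the spins at its two endpoints.
\<close>

definition inner_sum :: "('v \<Rightarrow> 'v \<Rightarrow> bool) \<Rightarrow> 'v set \<Rightarrow> ('v \<Rightarrow> nat) \<Rightarrow> real" where
  "inner_sum adj \<Lambda> \<sigma> = (\<Sum>e\<in>inner_edges adj \<Lambda>. of_bool (\<forall>u\<in>e. \<forall>v\<in>e. \<sigma> u = \<sigma> v))"

definition boundary_sum ::
    "('v \<Rightarrow> 'v \<Rightarrow> bool) \<Rightarrow> 'v set \<Rightarrow> ('v \<Rightarrow> nat) \<Rightarrow> ('v \<Rightarrow> nat) \<Rightarrow> real" where
  "boundary_sum adj \<Lambda> \<eta> \<sigma> = (\<Sum>(u, v)\<in>boundary_edges adj \<Lambda>. of_bool (\<sigma> u = \<eta> v))"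

definition normalized_measure :: "'a set \<Rightarrow> ('a \<Rightarrow> real) \<Rightarrow> 'a measure" where
  "normalized_measure S w = point_measure S (\<lambda>\<sigma>. ennreal (w \<sigma> / sum w S))"

definition potts_free ::
    "('v \<Rightarrow> 'v \<Rightarrow> bool) \<Rightarrow> nat \<Rightarrow> real \<Rightarrow> 'v set \<Rightarrow> ('v \<Rightarrow> nat) measure" where
  "potts_free adj q \<beta> \<Lambda> =
     normalized_measure (configs q \<Lambda>) (\<lambda>\<sigma>. exp (\<beta> * inner_sum adj \<Lambda> \<sigma>))"

definition potts_boundary ::
    "('v \<Rightarrow> 'v \<Rightarrow> bool) \<Rightarrow> nat \<Rightarrow> real \<Rightarrow> ('v \<Rightarrow> nat) \<Rightarrow> 'v set \<Rightarrow> ('v \<Rightarrow> nat) measure" where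
  "potts_boundary adj q \<beta> \<eta> \<Lambda> =
     normalized_measure (configs q \<Lambda>)
       (\<lambda>\<sigma>. exp (\<beta> * inner_sum adj \<Lambda> \<sigma> + \<beta> * boundary_sum adj \<Lambda> \<eta> \<sigma>))"

abbreviation config_space :: "nat \<Rightarrow> ('v \<Rightarrow> nat) measure" where
  "config_space q \<equiv> PiM UNIV (\<lambda>_. count_space {1..q})"

definition is_free_state ::
    "('v \<Rightarrow> 'v \<Rightarrow> bool) \<Rightarrow> nat \<Rightarrow> real \<Rightarrow> ('v \<Rightarrow> nat) measure \<Rightarrow> bool" where
  "is_free_state adj q \<beta> \<mu> \<longleftrightarrow>
     prob_space \<mu> \<and> sets \<mu> = sets (config_space q) \<and>
     (\<forall>\<Lambda> s. finite \<Lambda> \<longrightarrow> connected_in adj \<Lambda> \<longrightarrow> s \<in> configs q \<Lambda> \<longrightarrow>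
        measure \<mu> {\<sigma> \<in> space \<mu>. \<forall>u\<in>\<Lambda>. \<sigma> u = s u} =
        measure (potts_free adj q \<beta> \<Lambda>)
          {\<sigma> \<in> space (potts_free adj q \<beta> \<Lambda>). \<forall>u\<in>\<Lambda>. \<sigma> u = s u})"

text \<open>
  A local event is given by a finite set \<open>\<Lambda>\<close> and a set \<open>B\<close> of spin configurations on \<open>\<Lambda>\<close>.
  The finite-volume probability below is the intended one as soon as \<open>\<Lambda> \<subseteq> graph_ball adj x n\<close>,
  which holds for all large \<open>n\<close>.
\<close>

definition is_limit_state ::
    "('v \<Rightarrow> 'v \<Rightarrow> bool) \<Rightarrow> 'v \<Rightarrow> nat \<Rightarrow> real \<Rightarrow> ('v \<Rightarrow> nat) \<Rightarrow> ('v \<Rightarrow> nat) measure \<Rightarrow> bool" where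
  "is_limit_state adj x q \<beta> \<eta> \<nu> \<longleftrightarrow>
     prob_space \<nu> \<and> sets \<nu> = sets (config_space q) \<and>
     (\<forall>\<Lambda> B. finite \<Lambda> \<longrightarrow> B \<subseteq> configs q \<Lambda> \<longrightarrow>
        (\<lambda>n. measure (potts_boundary adj q \<beta> \<eta> (graph_ball adj x n))
               {\<sigma> \<in> configs q (graph_ball adj x n). restrict \<sigma> \<Lambda> \<in> B})
        \<longlonglongrightarrow> measure \<nu> {\<sigma> \<in> space \<nu>. restrict \<sigma> \<Lambda> \<in> B})"

definition limit_state_exists ::
    "('v \<Rightarrow> 'v \<Rightarrow> bool) \<Rightarrow> 'v \<Rightarrow> nat \<Rightarrow> real \<Rightarrow> ('v \<Rightarrow> nat) \<Rightarrow> bool" where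
  "limit_state_exists adj x q \<beta> \<eta> \<longleftrightarrow> (\<exists>\<nu>. is_limit_state adj x q \<beta> \<eta> \<nu>)"

definition limit_state ::
    "('v \<Rightarrow> 'v \<Rightarrow> bool) \<Rightarrow> 'v \<Rightarrow> nat \<Rightarrow> real \<Rightarrow> ('v \<Rightarrow> nat) \<Rightarrow> ('v \<Rightarrow> nat) measure" where
  "limit_state adj x q \<beta> \<eta> = (THE \<nu>. is_limit_state adj x q \<beta> \<eta> \<nu>)"

text \<open>Pairs for which one of the two limits does not exist are excluded.\<close>

definition same_limit_event ::
    "('v \<Rightarrow> 'v \<Rightarrow> bool) \<Rightarrow> 'v \<Rightarrow> nat \<Rightarrow> real \<Rightarrow> (('v \<Rightarrow> nat) \<times> ('v \<Rightarrow> nat)) set" where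
  "same_limit_event adj x q \<beta> =
     {(\<eta>1, \<eta>2) \<in> space (config_space q \<Otimes>\<^sub>M config_space q).
        limit_state_exists adj x q \<beta> \<eta>1 \<and> limit_state_exists adj x q \<beta> \<eta>2 \<and>
        limit_state adj x q \<beta> \<eta>1 = limit_state adj x q \<beta> \<eta>2}"

end

theory Submission imports Defs begin

text \<open>
  Write \<open>\<mu>\<^sup>\<eta>\<^sub>n\<close> for the finite-volume measure on the ball of radius \<open>n\<close>. Summing out the spins level by
  level expresses its marginals on smaller balls through messages sent upwards by the vertices.
  By the DLR property each marginal is a reverse martingale under the free state; a Kolmogorov
  type maximal inequality makes it converge almost surely, and Kolmogorov's extension theorem
  assembles the limits into a limit state. Since ratios of messages are bounded away from \<open>0\<close> and infinity,
  convergence of all marginals is equivalent to convergence of all (normalised) messages.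

  Hence the event \<open>A\<close> that two boundary conditions have the same limit state is, for each level \<open>m\<close>,
  the intersection over the vertices \<open>x\<close> of level \<open>m\<close> of events \<open>E x\<close> that depend only on the pair of
  configurations strictly below \<open>x\<close>. Given the spins up to level \<open>m\<close> these events are independent,
  and the conditional probability of the complement of \<open>E x\<close> changes at most by a constant factor,
  uniform in \<open>m\<close>, when the spins at \<open>x\<close> change. If \<open>A\<close> has positive probability, then by approximation
  it has conditional probability at least \<open>1 - \<epsilon>\<close> given some configuration up to some level, so the
  probabilities of the complements of the \<open>E x\<close> have a sum of order \<open>\<epsilon>\<close>. By the comparison the same
  holds for every configuration up to that level, so \<open>A\<close> has probability \<open>1 - O(\<epsilon>)\<close>.
\<close>

section \<open>Reverse martingales and approximation by an algebra\<close>

text \<open>The assumption \<open>ortho\<close> is the reverse martingale property with respect to the natural filtration.\<close>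

lemma (in prob_space) reverse_martingale_maximal_inequality:
  fixes X :: "nat \<Rightarrow> 'a \<Rightarrow> real"
  assumes meas [measurable]: "\<And>n. X n \<in> borel_measurable M"
    and bound: "\<And>n \<omega>. \<omega> \<in> space M \<Longrightarrow> \<bar>X n \<omega>\<bar> \<le> 1"
    and ortho: "\<And>k n N g C. k \<le> n \<Longrightarrow> n \<le> N \<Longrightarrow>
        (\<lambda>\<omega>. g (\<lambda>j\<in>{n..N}. X j \<omega>)) \<in> borel_measurable M \<Longrightarrow>
        (\<And>\<omega>. \<omega> \<in> space M \<Longrightarrow> \<bar>g (\<lambda>j\<in>{n..N}. X j \<omega>)\<bar> \<le> C) \<Longrightarrow>
        expectation (\<lambda>\<omega>. (X k \<omega> - X n \<omega>) * g (\<lambda>j\<in>{n..N}. X j \<omega>)) = 0"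
    and "n \<le> N" and "\<epsilon> > 0"
  shows "\<epsilon>\<^sup>2 * prob {\<omega> \<in> space M. \<exists>k\<in>{n..N}. \<bar>X k \<omega> - X N \<omega>\<bar> > \<epsilon>}
    \<le> expectation (\<lambda>\<omega>. (X n \<omega>)\<^sup>2) - expectation (\<lambda>\<omega>. (X N \<omega>)\<^sup>2)"
proof -
  have int: "integrable M f" if "f \<in> borel_measurable M" "\<And>\<omega>. \<omega> \<in> space M \<Longrightarrow> \<bar>f \<omega>\<bar> \<le> C" for f :: "'a \<Rightarrow> real" and C
    using that by (intro integrable_const_bound[where B=C]) auto
  have bd: "\<bar>X i \<omega> - X j \<omega>\<bar> \<le> 2" if "\<omega> \<in> space M" for i j \<omega>
    using bound[OF that, of i] bound[OF that, of j] by linarith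
  have bd2: "\<bar>(X i \<omega> - X j \<omega>) * (X i' \<omega> - X j' \<omega>)\<bar> \<le> 4" if "\<omega> \<in> space M" for i j i' j' \<omega>
    using mult_mono[OF bd[OF that, of i j] bd[OF that, of i' j']] by (simp add: abs_mult)
  have bd3: "\<bar>X i \<omega> * X j \<omega>\<bar> \<le> 1" if "\<omega> \<in> space M" for i j \<omega>
    using mult_mono[OF bound[OF that, of i] bound[OF that, of j]] by (simp add: abs_mult)
  note bd2 = bd2 bd2[THEN abs_le_D1] and bd3 = bd3 bd3[THEN abs_le_D1]
  define D where "D k = {\<omega> \<in> space M. \<bar>X k \<omega> - X N \<omega>\<bar> > \<epsilon> \<and> (\<forall>j\<in>{k<..N}. \<bar>X j \<omega> - X N \<omega>\<bar> \<le> \<epsilon>)}" for k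
  have Dm [measurable]: "D k \<in> sets M" for k unfolding D_def by measurable
  have disj: "disjoint_family_on D {n..N}"
    unfolding disjoint_family_on_def D_def
    by (auto simp: not_le[symmetric])
  have un: "{\<omega> \<in> space M. \<exists>k\<in>{n..N}. \<bar>X k \<omega> - X N \<omega>\<bar> > \<epsilon>} = (\<Union>k\<in>{n..N}. D k)"
  proof (intro set_eqI iffI)
    fix \<omega> assume "\<omega> \<in> {\<omega> \<in> space M. \<exists>k\<in>{n..N}. \<bar>X k \<omega> - X N \<omega>\<bar> > \<epsilon>}"
    then have w: "\<omega> \<in> space M" and ex: "\<exists>k\<in>{n..N}. \<bar>X k \<omega> - X N \<omega>\<bar> > \<epsilon>" by auto
    let ?S = "{k\<in>{n..N}. \<bar>X k \<omega> - X N \<omega>\<bar> > \<epsilon>}"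
    have f: "finite ?S" "?S \<noteq> {}" using ex by auto
    have "Max ?S \<in> ?S" by (rule Max_in[OF f])
    moreover have "\<bar>X j \<omega> - X N \<omega>\<bar> \<le> \<epsilon>" if "j \<in> {Max ?S<..N}" for j
    proof (rule ccontr)
      assume "\<not> ?thesis"
      then have "j \<in> ?S" using that \<open>Max ?S \<in> ?S\<close> by auto
      from Max_ge[OF f(1) this] that show False by (meson greaterThanAtMost_iff not_le)
    qed
    ultimately have "\<omega> \<in> D (Max ?S)" using w by (auto simp: D_def)
    then show "\<omega> \<in> (\<Union>k\<in>{n..N}. D k)" using \<open>Max ?S \<in> ?S\<close> by blast
  qed (auto simp: D_def)
  have key: "\<epsilon>\<^sup>2 * prob (D k) \<le> expectation (\<lambda>\<omega>. (X n \<omega> - X N \<omega>)\<^sup>2 * indicator (D k) \<omega>)"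
    if k: "k \<in> {n..N}" for k
  proof -
    let ?g = "\<lambda>z :: nat \<Rightarrow> real. (z k - z N) * of_bool (\<bar>z k - z N\<bar> > \<epsilon> \<and> (\<forall>j\<in>{k<..N}. \<bar>z j - z N\<bar> \<le> \<epsilon>))"
    have g: "?g (\<lambda>j\<in>{k..N}. X j \<omega>) = (X k \<omega> - X N \<omega>) * indicator (D k) \<omega>" if "\<omega> \<in> space M" for \<omega>
      using k that by (auto simp: D_def indicator_def)
    have gm: "(\<lambda>\<omega>. ?g (\<lambda>j\<in>{k..N}. X j \<omega>)) \<in> borel_measurable M"
      by (subst measurable_cong[OF g]) auto
    have "expectation (\<lambda>\<omega>. (X n \<omega> - X k \<omega>) * ?g (\<lambda>j\<in>{k..N}. X j \<omega>)) = 0"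
    proof (rule ortho[of n k N ?g 2])
      show "\<bar>?g (\<lambda>j\<in>{k..N}. X j \<omega>)\<bar> \<le> 2" if "\<omega> \<in> space M" for \<omega>
        unfolding g[OF that] using bd[OF that, of k N] by (auto simp: indicator_def)
    qed (use k gm in auto)
    moreover have "expectation (\<lambda>\<omega>. (X n \<omega> - X k \<omega>) * ((X k \<omega> - X N \<omega>) * indicator (D k) \<omega>))
        = expectation (\<lambda>\<omega>. (X n \<omega> - X k \<omega>) * ?g (\<lambda>j\<in>{k..N}. X j \<omega>))"
      by (intro Bochner_Integration.integral_cong refl) (simp only: g)
    ultimately have cross: "expectation (\<lambda>\<omega>. (X n \<omega> - X k \<omega>) * ((X k \<omega> - X N \<omega>) * indicator (D k) \<omega>)) = 0"
      by argo
    have "\<epsilon>\<^sup>2 * prob (D k) = expectation (\<lambda>\<omega>. \<epsilon>\<^sup>2 * indicator (D k) \<omega>)" by simp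
    also have "\<dots> \<le> expectation (\<lambda>\<omega>. (X k \<omega> - X N \<omega>)\<^sup>2 * indicator (D k) \<omega>)"
    proof (rule integral_mono)
      show "\<epsilon>\<^sup>2 * indicator (D k) \<omega> \<le> (X k \<omega> - X N \<omega>)\<^sup>2 * indicator (D k) \<omega>" if "\<omega> \<in> space M" for \<omega>
        using \<open>\<epsilon> > 0\<close> by (auto simp: indicator_def D_def intro: abs_le_square_iff[THEN iffD1])
    next
      show "integrable M (\<lambda>\<omega>. (X k \<omega> - X N \<omega>)\<^sup>2 * indicator (D k) \<omega>)"
        by (rule int[of _ 4]) (auto simp: indicator_def bd2 power2_eq_square)
    qed (auto intro!: int[of _ 1] simp: indicator_def)
    also have "\<dots> \<le> expectation (\<lambda>\<omega>. (X n \<omega> - X k \<omega>)\<^sup>2 * indicator (D k) \<omega>)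
        + 2 * expectation (\<lambda>\<omega>. (X n \<omega> - X k \<omega>) * ((X k \<omega> - X N \<omega>) * indicator (D k) \<omega>))
        + expectation (\<lambda>\<omega>. (X k \<omega> - X N \<omega>)\<^sup>2 * indicator (D k) \<omega>)"
      unfolding cross by (auto intro!: Bochner_Integration.integral_nonneg)
    also have "\<dots> = expectation (\<lambda>\<omega>. (X n \<omega> - X k \<omega>)\<^sup>2 * indicator (D k) \<omega>
        + 2 * ((X n \<omega> - X k \<omega>) * ((X k \<omega> - X N \<omega>) * indicator (D k) \<omega>))
        + (X k \<omega> - X N \<omega>)\<^sup>2 * indicator (D k) \<omega>)"
    proof -
      have i: "integrable M (\<lambda>\<omega>. (X n \<omega> - X k \<omega>)\<^sup>2 * indicator (D k) \<omega>)"
        "integrable M (\<lambda>\<omega>. (X n \<omega> - X k \<omega>) * ((X k \<omega> - X N \<omega>) * indicator (D k) \<omega>))"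
        "integrable M (\<lambda>\<omega>. (X k \<omega> - X N \<omega>)\<^sup>2 * indicator (D k) \<omega>)"
        by (rule int[of _ 4]; auto simp: indicator_def bd2 power2_eq_square)+
      show ?thesis using i by (simp del: mult_cancel_left)
    qed
    also have "\<dots> = expectation (\<lambda>\<omega>. (X n \<omega> - X N \<omega>)\<^sup>2 * indicator (D k) \<omega>)"
      by (intro Bochner_Integration.integral_cong refl) (auto simp: power2_eq_square algebra_simps indicator_def)
    finally show ?thesis .
  qed
  have "\<epsilon>\<^sup>2 * prob {\<omega> \<in> space M. \<exists>k\<in>{n..N}. \<bar>X k \<omega> - X N \<omega>\<bar> > \<epsilon>} = (\<Sum>k\<in>{n..N}. \<epsilon>\<^sup>2 * prob (D k))"
    unfolding un by (subst finite_measure_finite_Union[OF _ _ disj]) (auto simp: sum_distrib_left)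
  also have "\<dots> \<le> (\<Sum>k\<in>{n..N}. expectation (\<lambda>\<omega>. (X n \<omega> - X N \<omega>)\<^sup>2 * indicator (D k) \<omega>))"
    by (intro sum_mono key)
  also have "\<dots> = expectation (\<lambda>\<omega>. \<Sum>k\<in>{n..N}. (X n \<omega> - X N \<omega>)\<^sup>2 * indicator (D k) \<omega>)"
    by (subst Bochner_Integration.integral_sum)
      (auto intro!: int[of _ 4] simp: indicator_def bd2 power2_eq_square)
  also have "\<dots> = expectation (\<lambda>\<omega>. (X n \<omega> - X N \<omega>)\<^sup>2 * indicator (\<Union>k\<in>{n..N}. D k) \<omega>)"
    by (subst indicator_UN_disjoint[OF _ disj]) (auto simp: sum_distrib_left)
  also have "\<dots> \<le> expectation (\<lambda>\<omega>. (X n \<omega> - X N \<omega>)\<^sup>2)"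
    by (rule integral_mono) (auto intro!: int[of _ 4] simp: indicator_def bd2 power2_eq_square)
  also have "\<dots> = expectation (\<lambda>\<omega>. (X n \<omega>)\<^sup>2 - (X N \<omega>)\<^sup>2 - 2 * ((X n \<omega> - X N \<omega>) * X N \<omega>))"
    by (intro Bochner_Integration.integral_cong refl) (auto simp: power2_eq_square algebra_simps)
  also have "\<dots> = expectation (\<lambda>\<omega>. (X n \<omega>)\<^sup>2) - expectation (\<lambda>\<omega>. (X N \<omega>)\<^sup>2)
      - 2 * expectation (\<lambda>\<omega>. (X n \<omega> - X N \<omega>) * X N \<omega>)"
  proof -
    have i: "integrable M (\<lambda>\<omega>. (X j \<omega>)\<^sup>2)" for j
      by (rule int[of _ 1]) (auto simp: bd3 power2_eq_square)
    have "integrable M (\<lambda>\<omega>. (X n \<omega> - X N \<omega>) * X N \<omega>)"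
      using mult_mono[OF bd bound] by (intro int[of _ 2]) (auto simp: abs_mult)
    then show ?thesis using i by (simp del: mult_cancel_left)
  qed
  also have "expectation (\<lambda>\<omega>. (X n \<omega> - X N \<omega>) * X N \<omega>) = 0"
    using ortho[of n N N "\<lambda>z. z N" 1] \<open>n \<le> N\<close> bound by simp
  finally show ?thesis by simp
qed

lemma (in prob_space) reverse_martingale_AE_convergent:
  fixes X :: "nat \<Rightarrow> 'a \<Rightarrow> real"
  assumes meas [measurable]: "\<And>n. X n \<in> borel_measurable M"
    and bound: "\<And>n \<omega>. \<omega> \<in> space M \<Longrightarrow> \<bar>X n \<omega>\<bar> \<le> 1"
    and ortho: "\<And>k n N g C. k \<le> n \<Longrightarrow> n \<le> N \<Longrightarrow>
        (\<lambda>\<omega>. g (\<lambda>j\<in>{n..N}. X j \<omega>)) \<in> borel_measurable M \<Longrightarrow>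
        (\<And>\<omega>. \<omega> \<in> space M \<Longrightarrow> \<bar>g (\<lambda>j\<in>{n..N}. X j \<omega>)\<bar> \<le> C) \<Longrightarrow>
        expectation (\<lambda>\<omega>. (X k \<omega> - X n \<omega>) * g (\<lambda>j\<in>{n..N}. X j \<omega>)) = 0"
  shows "AE \<omega> in M. convergent (\<lambda>n. X n \<omega>)"
proof -
  define e where "e n = expectation (\<lambda>\<omega>. (X n \<omega>)\<^sup>2)" for n
  have max_ineq: "\<epsilon>\<^sup>2 * prob {\<omega> \<in> space M. \<exists>k\<in>{n..N}. \<bar>X k \<omega> - X N \<omega>\<bar> > \<epsilon>} \<le> e n - e N"
    if "n \<le> N" "\<epsilon> > 0" for n N \<epsilon>
    unfolding e_def by (rule reverse_martingale_maximal_inequality) (fact meas bound ortho that)+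
  have "decseq e"
  proof (rule decseq_SucI)
    fix n
    have "0 \<le> 1\<^sup>2 * prob {\<omega> \<in> space M. \<exists>k\<in>{n..Suc n}. \<bar>X k \<omega> - X (Suc n) \<omega>\<bar> > 1}" by simp
    also have "\<dots> \<le> e n - e (Suc n)" by (rule max_ineq) auto
    finally show "e (Suc n) \<le> e n" by simp
  qed
  moreover have "0 \<le> e n" for n unfolding e_def by simp
  ultimately obtain L where L: "e \<longlonglongrightarrow> L" "\<And>n. L \<le> e n"
    using decseq_convergent by blast
  have *: "AE \<omega> in M. \<exists>n. \<forall>k\<ge>n. \<bar>X k \<omega> - X n \<omega>\<bar> \<le> 2 * \<epsilon>" if "\<epsilon> > 0" for \<epsilon> :: real
  proof -
    define W where "W n N = {\<omega> \<in> space M. \<exists>k\<in>{n..N}. \<bar>X k \<omega> - X n \<omega>\<bar> > 2 * \<epsilon>}" for n N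
    have Wm [measurable]: "W n N \<in> sets M" for n N unfolding W_def by measurable
    have W: "prob (W n N) \<le> (e n - L) / \<epsilon>\<^sup>2" for n N
    proof (cases "n \<le> N")
      case True
      have "prob (W n N) \<le> prob {\<omega> \<in> space M. \<exists>k\<in>{n..N}. \<bar>X k \<omega> - X N \<omega>\<bar> > \<epsilon>}"
      proof (rule finite_measure_mono)
        show "W n N \<subseteq> {\<omega> \<in> space M. \<exists>k\<in>{n..N}. \<bar>X k \<omega> - X N \<omega>\<bar> > \<epsilon>}"
        proof
          fix \<omega> assume "\<omega> \<in> W n N"
          then obtain k where k: "\<omega> \<in> space M" "k \<in> {n..N}" "\<bar>X k \<omega> - X n \<omega>\<bar> > 2 * \<epsilon>"
            unfolding W_def by auto
          then have "\<bar>X k \<omega> - X N \<omega>\<bar> > \<epsilon> \<or> \<bar>X n \<omega> - X N \<omega>\<bar> > \<epsilon>" by linarith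
          then show "\<omega> \<in> {\<omega> \<in> space M. \<exists>k\<in>{n..N}. \<bar>X k \<omega> - X N \<omega>\<bar> > \<epsilon>}"
            using k True by auto
        qed
      qed measurable
      also have "\<dots> \<le> (e n - e N) / \<epsilon>\<^sup>2"
        using max_ineq[OF True \<open>\<epsilon> > 0\<close>] \<open>\<epsilon> > 0\<close> by (simp add: field_simps)
      also have "\<dots> \<le> (e n - L) / \<epsilon>\<^sup>2" using L(2)[of N] by (intro divide_right_mono) auto
      finally show ?thesis .
    next
      case False
      then have "W n N = {}" by (auto simp: W_def)
      then show ?thesis using L(2)[of n] by simp
    qed
    have inc: "incseq (W n)" for n
      by (rule incseq_SucI) (auto simp: W_def)
    have W2: "prob (\<Union>N. W n N) \<le> (e n - L) / \<epsilon>\<^sup>2" for n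
      using finite_Lim_measure_incseq[of "W n", OF image_subsetI inc] Wm W
      by (intro LIMSEQ_le_const2[where X = "\<lambda>N. prob (W n N)"]) auto
    have "prob (\<Inter>n. \<Union>N. W n N) \<le> (e n - L) / \<epsilon>\<^sup>2" for n
      using W2[of n] by (rule order_trans[rotated]) (auto intro!: finite_measure_mono)
    moreover have "(\<lambda>n. (e n - L) / \<epsilon>\<^sup>2) \<longlonglongrightarrow> (L - L) / \<epsilon>\<^sup>2"
      by (intro tendsto_intros L) (use \<open>\<epsilon> > 0\<close> in auto)
    ultimately have "prob (\<Inter>n. \<Union>N. W n N) \<le> 0"
      by (intro LIMSEQ_le_const) auto
    then have "prob (\<Inter>n. \<Union>N. W n N) = 0" using measure_nonneg[of M] by (metis order_antisym)
    then have "(\<Inter>n. \<Union>N. W n N) \<in> null_sets M"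
      by (auto simp: null_sets_def emeasure_eq_measure)
    then show ?thesis
      by (rule AE_I') (force simp: W_def not_le)
  qed
  have "AE \<omega> in M. \<forall>j::nat. \<exists>n. \<forall>k\<ge>n. \<bar>X k \<omega> - X n \<omega>\<bar> \<le> 2 * (1 / real (Suc j))"
    unfolding AE_all_countable by (intro allI *) auto
  then show ?thesis
  proof (rule AE_mp, intro AE_I2 impI)
    fix \<omega> assume a: "\<forall>j::nat. \<exists>n. \<forall>k\<ge>n. \<bar>X k \<omega> - X n \<omega>\<bar> \<le> 2 * (1 / real (Suc j))"
    have "Cauchy (\<lambda>n. X n \<omega>)"
    proof (rule CauchyI')
      fix r :: real assume "r > 0"
      then obtain j where j: "inverse (real (Suc j)) < r / 4"
        using reals_Archimedean[of "r/4"] by auto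
      obtain n where n: "\<And>k. k \<ge> n \<Longrightarrow> \<bar>X k \<omega> - X n \<omega>\<bar> \<le> 2 * (1 / real (Suc j))" using a by blast
      have "norm (X k \<omega> - X l \<omega>) < r" if "k \<ge> n" "l > k" for k l
        using n[of k] n[of l] that j by (simp add: inverse_eq_divide)
      then show "\<exists>M. \<forall>m\<ge>M. \<forall>n>m. dist (X m \<omega>) (X n \<omega>) < r" unfolding dist_norm by blast
    qed
    then show "convergent (\<lambda>n. X n \<omega>)" by (rule Cauchy_convergent)
  qed
qed

lemma (in finite_measure) approximation_by_algebra:
  assumes G: "algebra (space M) G" "G \<subseteq> sets M"
    and A: "A \<in> sigma_sets (space M) G" and "\<epsilon> > 0"
  shows "\<exists>B\<in>G. measure M ((A - B) \<union> (B - A)) < \<epsilon>"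
  using A \<open>\<epsilon> > 0\<close>
proof (induction arbitrary: \<epsilon>)
  case (Basic a)
  then show ?case by (intro bexI[of _ a]) auto
next
  case Empty
  interpret algebra "space M" G by fact
  show ?case using Empty by (intro bexI[of _ "{}"]) auto
next
  case (Compl a)
  interpret algebra "space M" G by fact
  from Compl obtain B where B: "B \<in> G" "measure M ((a - B) \<union> (B - a)) < \<epsilon>" by blast
  have "a \<subseteq> space M" using Compl(1) G(1) by (metis algebra.axioms(1) ring_of_sets.axioms(1)
      semiring_of_sets.axioms(1) sigma_sets_into_sp subset_class.space_closed)
  moreover have "B \<subseteq> space M" using B sets_into_space by auto
  ultimately have "((space M - a) - (space M - B)) \<union> ((space M - B) - (space M - a)) = (a - B) \<union> (B - a)"
    by auto
  then show ?case using B by (intro bexI[of _ "space M - B"]) auto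
next
  case (Union a)
  interpret algebra "space M" G by fact
  have am [measurable]: "a i \<in> sets M" for i
    using Union(1)[of i] sets.sigma_sets_subset[OF G(2)] by auto
  have "(\<lambda>n. measure M (\<Union>i<n. a i)) \<longlonglongrightarrow> measure M (\<Union>n. \<Union>i<n. a i)"
    by (intro finite_Lim_measure_incseq) (auto simp: incseq_def intro: less_le_trans)
  moreover have "(\<Union>n. \<Union>i<n. a i) = (\<Union>i. a i)" by (auto intro: lessI)
  ultimately have "(\<lambda>n. measure M (\<Union>i<n. a i)) \<longlonglongrightarrow> measure M (\<Union>i. a i)" by simp
  then have "\<forall>\<^sub>F n in sequentially. measure M (\<Union>i. a i) - \<epsilon>/2 < measure M (\<Union>i<n. a i)"
    by (rule order_tendstoD) (use Union in auto)
  then obtain n where n: "measure M (\<Union>i. a i) - \<epsilon>/2 < measure M (\<Union>i<n. a i)"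
    by (auto simp: eventually_sequentially)
  define \<delta> where "\<delta> = \<epsilon> / (2 * (real n + 1))"
  have "\<delta> > 0" using Union by (simp add: \<delta>_def)
  then have "\<forall>i. \<exists>B\<in>G. measure M ((a i - B) \<union> (B - a i)) < \<delta>" using Union(2) by blast
  then obtain B where B: "\<And>i. B i \<in> G" "\<And>i. measure M ((a i - B i) \<union> (B i - a i)) < \<delta>"
    by metis
  have Bm [measurable]: "B i \<in> sets M" for i using B(1) G(2) by auto
  have "((\<Union>i. a i) - (\<Union>i<n. B i)) \<union> ((\<Union>i<n. B i) - (\<Union>i. a i))
      \<subseteq> ((\<Union>i. a i) - (\<Union>i<n. a i)) \<union> (\<Union>i<n. (a i - B i) \<union> (B i - a i))" by auto
  then have "measure M (((\<Union>i. a i) - (\<Union>i<n. B i)) \<union> ((\<Union>i<n. B i) - (\<Union>i. a i)))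
      \<le> measure M (((\<Union>i. a i) - (\<Union>i<n. a i)) \<union> (\<Union>i<n. (a i - B i) \<union> (B i - a i)))"
    by (intro finite_measure_mono) measurable
  also have "\<dots> \<le> measure M ((\<Union>i. a i) - (\<Union>i<n. a i)) + measure M (\<Union>i<n. (a i - B i) \<union> (B i - a i))"
    by (rule measure_Un_le) measurable
  also have "measure M ((\<Union>i. a i) - (\<Union>i<n. a i)) < \<epsilon> / 2"
    using n by (subst finite_measure_Diff) auto
  also have "measure M (\<Union>i<n. (a i - B i) \<union> (B i - a i)) \<le> (\<Sum>i<n. measure M ((a i - B i) \<union> (B i - a i)))"
    by (intro measure_UNION_le) auto
  also have "\<dots> \<le> (\<Sum>i<n. \<delta>)" by (intro sum_mono less_imp_le B)
  also have "\<dots> \<le> \<epsilon> / 2" using Union(3) by (simp add: \<delta>_def field_simps)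
  finally show ?case using B by (intro bexI[of _ "\<Union>i<n. B i"]) (auto intro!: finite_UN)
qed

section \<open>Levels and subtrees of a rooted Cayley tree\<close>

lemma rtranclp_distinct_path:
  assumes "(\<lambda>x y. x \<in> S \<and> y \<in> S \<and> R x y)\<^sup>*\<^sup>* u v" and "u \<in> S"
  shows "\<exists>xs. xs \<noteq> [] \<and> hd xs = u \<and> last xs = v \<and> distinct xs \<and> successively R xs \<and> set xs \<subseteq> S"
  using assms
proof (induction rule: rtranclp_induct)
  case base
  then show ?case by (intro exI[of _ "[u]"]) auto
next
  case (step v w)
  then obtain xs where xs: "xs \<noteq> []" "hd xs = u" "last xs = v" "distinct xs" "successively R xs" "set xs \<subseteq> S"
    by blast
  show ?case
  proof (cases "w \<in> set xs")
    case True
    then obtain ys zs where "xs = (ys @ [w]) @ zs" by (auto dest: split_list)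
    then have "hd (ys @ [w]) = u" "distinct (ys @ [w])" "successively R (ys @ [w])" "set (ys @ [w]) \<subseteq> S"
      using xs successively_append_iff[of R "ys @ [w]" zs] by (auto simp: hd_append simp del: append_assoc)
    then show ?thesis by (intro exI[of _ "ys @ [w]"]) auto
  next
    case False
    then show ?thesis using xs step
      by (intro exI[of _ "xs @ [w]"]) (auto simp: successively_append_iff)
  qed
qed

locale rooted_cayley_tree = cayley_tree adj d for adj :: "'v \<Rightarrow> 'v \<Rightarrow> bool" and d +
  fixes root :: 'v
begin

abbreviation lev :: "'v \<Rightarrow> nat" where "lev \<equiv> graph_dist adj root"
abbreviation ball :: "nat \<Rightarrow> 'v set" where "ball \<equiv> graph_ball adj root"

definition sphere :: "nat \<Rightarrow> 'v set" where "sphere n = {v. lev v = n}"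

definition children :: "'v \<Rightarrow> 'v set" where "children x = {y. adj x y \<and> lev y = Suc (lev x)}"

definition parent :: "'v \<Rightarrow> 'v" where "parent y = (THE x. y \<in> children x)"

definition ancestor :: "nat \<Rightarrow> 'v \<Rightarrow> 'v" where "ancestor m y = (parent ^^ (lev y - m)) y"

definition below :: "'v \<Rightarrow> 'v set" where "below x = {y. lev x < lev y \<and> ancestor (lev x) y = x}"

lemma mem_ball [simp]: "v \<in> ball n \<longleftrightarrow> lev v \<le> n" by (simp add: graph_ball_def)

lemma mem_sphere [simp]: "v \<in> sphere n \<longleftrightarrow> lev v = n" by (simp add: sphere_def)

lemma lev_relpowp: "(adj ^^ lev v) root v"
proof -
  have "adj\<^sup>*\<^sup>* root v" using connected by (simp add: connected_in_def)
  then have "\<exists>n. (adj ^^ n) root v" by (simp add: rtranclp_power)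
  then show ?thesis unfolding graph_dist_def by (rule LeastI_ex)
qed

lemma lev_le: "(adj ^^ n) root v \<Longrightarrow> lev v \<le> n"
  unfolding graph_dist_def by (rule Least_le)

lemma lev_eq_0_iff [simp]: "lev v = 0 \<longleftrightarrow> v = root"
  using lev_relpowp[of v] lev_le[of 0 v] by auto

lemma lev_root [simp]: "lev root = 0"
  by simp

lemma lev_adj_le: "adj x y \<Longrightarrow> lev y \<le> Suc (lev x)"
  using lev_relpowp[of x] by (intro lev_le) auto

lemma lev_Suc_obtains:
  assumes "lev v = Suc n"
  obtains u where "adj u v" "lev u = n"
proof -
  from lev_relpowp[of v] obtain u where u: "(adj ^^ n) root u" "adj u v"
    unfolding assms by (rule relpowp_Suc_E)
  then show ?thesis using that lev_le[OF u(1)] lev_adj_le[OF u(2)] assms by simp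
qed

lemma connected_in_ball: "connected_in adj (ball n)"
proof -
  let ?R = "\<lambda>x y. x \<in> ball n \<and> y \<in> ball n \<and> adj x y"
  have sym: "symp ?R" using adj_sym by (auto intro: sympI)
  have to_root: "?R\<^sup>*\<^sup>* root v" if "v \<in> ball n" for v
    using that
  proof (induction "lev v" arbitrary: v)
    case 0
    then show ?case by simp
  next
    case (Suc k)
    then obtain u where u: "adj u v" "lev u = k" using lev_Suc_obtains[of v k] by metis
    with Suc have "?R\<^sup>*\<^sup>* root u" "?R u v" by auto
    then show ?case by (rule rtranclp.rtrancl_into_rtrancl)
  qed
  show ?thesis unfolding connected_in_def
  proof (intro ballI)
    fix u v assume "u \<in> ball n" "v \<in> ball n"
    then have "?R\<^sup>*\<^sup>* u root" "?R\<^sup>*\<^sup>* root v"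
      using sympD[OF symp_rtranclp[OF sym] to_root[of u]] to_root[of v] by blast+
    then show "?R\<^sup>*\<^sup>* u v" by (rule rtranclp_trans)
  qed
qed

lemma ball_distinct_path:
  assumes "u \<in> ball n" "v \<in> ball n"
  obtains xs where "xs \<noteq> []" "hd xs = u" "last xs = v" "distinct xs" "successively adj xs" "set xs \<subseteq> ball n"
proof -
  have "(\<lambda>x y. x \<in> ball n \<and> y \<in> ball n \<and> adj x y)\<^sup>*\<^sup>* u v"
    using connected_in_ball[of n] assms unfolding connected_in_def by blast
  from rtranclp_distinct_path[OF this assms(1)] show ?thesis using that by blast
qed

lemma neighbour_in_ball_unique:
  assumes "u \<in> ball n" "u' \<in> ball n" "y \<notin> ball n" "adj u y" "adj u' y"
  shows "u = u'"
proof (rule ccontr)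
  assume "u \<noteq> u'"
  obtain xs where xs: "xs \<noteq> []" "hd xs = u" "last xs = u'" "distinct xs" "successively adj xs" "set xs \<subseteq> ball n"
    using ball_distinct_path assms(1,2) by blast
  have "length xs \<ge> 2" using xs \<open>u \<noteq> u'\<close> by (cases xs; cases "tl xs") auto
  then have "is_cycle adj (xs @ [y])"
    using xs assms adj_sym by (auto simp: is_cycle_def successively_append_iff)
  then show False using acyclic by blast
qed

lemma adj_lev_neq:
  assumes "adj y y'" shows "lev y \<noteq> lev y'"
proof
  assume eq: "lev y = lev y'"
  show False
  proof (cases "lev y")
    case 0
    then show ?thesis using eq assms adj_irrefl by auto
  next
    case (Suc n)
    then obtain u u' where u: "adj u y" "lev u = n" "adj u' y'" "lev u' = n"
      using eq lev_Suc_obtains by metis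
    obtain xs where xs: "xs \<noteq> []" "hd xs = u" "last xs = u'" "distinct xs" "successively adj xs" "set xs \<subseteq> ball n"
      using ball_distinct_path[of u n u'] u by auto
    have "length xs \<ge> 1" using xs(1) by (cases xs) auto
    moreover have "y \<notin> set xs" "y' \<notin> set xs" using xs(6) Suc eq by auto
    moreover have "y \<noteq> y'" using assms adj_irrefl by auto
    ultimately have "is_cycle adj (xs @ [y', y])"
      using xs assms u adj_sym by (auto simp: is_cycle_def successively_append_iff)
    then show False using acyclic by blast
  qed
qed

lemma adj_iff_children: "adj x y \<longleftrightarrow> y \<in> children x \<or> x \<in> children y"
proof
  assume "adj x y"
  then show "y \<in> children x \<or> x \<in> children y"
    using lev_adj_le[of x y] lev_adj_le[of y x] adj_lev_neq[of x y] adj_sym[of x y]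
    by (auto simp: children_def)
qed (auto simp: children_def adj_sym)

lemma children_unique: "y \<in> children x \<Longrightarrow> y \<in> children x' \<Longrightarrow> x = x'"
  by (rule neighbour_in_ball_unique[where n = "lev x" and y = y]) (auto simp: children_def)

lemma children_parent: "y \<noteq> root \<Longrightarrow> y \<in> children (parent y)"
proof -
  assume "y \<noteq> root"
  then obtain n where "lev y = Suc n" by (metis lev_eq_0_iff not0_implies_Suc)
  then obtain x where x: "y \<in> children x" using lev_Suc_obtains[of y n] by (auto simp: children_def)
  show ?thesis unfolding parent_def
    by (rule theI[where P = "\<lambda>x. y \<in> children x" and a = x]) (use x children_unique in blast)+
qed

lemma mem_children_iff: "y \<in> children x \<longleftrightarrow> y \<noteq> root \<and> parent y = x"
proof
  assume y: "y \<in> children x"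
  then have "y \<noteq> root" by (auto simp: children_def)
  then show "y \<noteq> root \<and> parent y = x" using children_unique[OF y children_parent[of y]] by simp
next
  assume "y \<noteq> root \<and> parent y = x"
  then show "y \<in> children x" using children_parent[of y] by simp
qed

lemma lev_parent: "y \<noteq> root \<Longrightarrow> lev y = Suc (lev (parent y))"
  using children_parent[of y] by (simp add: children_def)

lemma lev_child: "y \<in> children x \<Longrightarrow> lev y = Suc (lev x)"
  by (simp add: children_def)

lemma finite_neighbours: "finite {v. adj u v}"
  using degree[of u] by (intro card_ge_0_finite) auto

lemma finite_children [simp]: "finite (children x)"
  by (rule finite_subset[OF _ finite_neighbours[of x]]) (auto simp: children_def)

lemma card_children_le: "card (children x) \<le> d + 1"
  unfolding degree[of x, symmetric]
  by (rule card_mono[OF finite_neighbours]) (auto simp: children_def)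

lemma sphere_0 [simp]: "sphere 0 = {root}" by auto

lemma sphere_Suc: "sphere (Suc n) = (\<Union>x\<in>sphere n. children x)"
proof (intro set_eqI iffI)
  fix v assume "v \<in> sphere (Suc n)"
  then obtain u where "adj u v" "lev u = n" using lev_Suc_obtains[of v n] by auto
  with \<open>v \<in> sphere (Suc n)\<close> show "v \<in> (\<Union>x\<in>sphere n. children x)"
    by (intro UN_I[of u]) (auto simp: children_def)
qed (auto simp: children_def)

lemma finite_sphere [simp]: "finite (sphere n)"
  by (induction n) (auto simp: sphere_Suc simp del: mem_sphere)

lemma ball_Suc: "ball (Suc n) = ball n \<union> sphere (Suc n)" by auto

lemma ball_0 [simp]: "ball 0 = {root}" by auto

lemma finite_ball [simp]: "finite (ball n)"
  by (induction n) (auto simp: ball_Suc)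

lemma countable_vertices: "countable (UNIV :: 'v set)"
proof -
  have "countable (\<Union>n. ball n)" by (intro countable_UN) (auto intro: countable_finite)
  moreover have "(\<Union>n. ball n) = UNIV" by auto
  ultimately show ?thesis by simp
qed

lemma finite_subset_ball:
  assumes "finite F" obtains n where "F \<subseteq> ball n"
proof (rule that)
  show "F \<subseteq> ball (Max (lev ` F))" using assms by auto
qed

lemma inner_edges_ball: "inner_edges adj (ball n) = (\<lambda>y. {parent y, y}) ` (ball n - {root})"
proof (intro set_eqI iffI)
  fix e assume "e \<in> inner_edges adj (ball n)"
  then obtain u v where "e = {u, v}" "u \<in> ball n" "v \<in> ball n" "v \<in> children u \<or> u \<in> children v"
    by (auto simp: inner_edges_def adj_iff_children)
  then have "e = {parent v, v} \<and> v \<in> ball n - {root} \<or> e = {parent u, u} \<and> u \<in> ball n - {root}"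
    by (auto simp: mem_children_iff)
  then show "e \<in> (\<lambda>y. {parent y, y}) ` (ball n - {root})" by blast
next
  fix e assume "e \<in> (\<lambda>y. {parent y, y}) ` (ball n - {root})"
  then obtain y where "e = {parent y, y}" "y \<in> ball n" "y \<noteq> root" by blast
  then show "e \<in> inner_edges adj (ball n)"
    using children_parent[of y] unfolding inner_edges_def mem_Collect_eq children_def
    by (intro exI[of _ "parent y"] exI[of _ y]) auto
qed

lemma inj_on_inner_edge: "inj_on (\<lambda>y. {parent y, y}) (UNIV - {root})"
proof (rule inj_onI)
  fix y z assume *: "y \<in> UNIV - {root}" "z \<in> UNIV - {root}" "{parent y, y} = {parent z, z}"
  then have "lev y = Suc (lev (parent y))" "lev z = Suc (lev (parent z))" using lev_parent by auto
  then show "y = z" using *(3) by (auto simp: doubleton_eq_iff)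
qed

lemma boundary_edges_ball: "boundary_edges adj (ball n) = (\<lambda>y. (parent y, y)) ` sphere (Suc n)"
proof (intro set_eqI iffI)
  fix e assume "e \<in> boundary_edges adj (ball n)"
  then obtain u v where e: "e = (u, v)" "lev u \<le> n" "n < lev v" "v \<in> children u \<or> u \<in> children v"
    by (auto simp: boundary_edges_def adj_iff_children)
  then have "v \<in> children u" using lev_child[of u v] by auto
  then have "e = (parent v, v)" "v \<in> sphere (Suc n)"
    using e lev_child[of v u] by (auto simp: mem_children_iff)
  then show "e \<in> (\<lambda>y. (parent y, y)) ` sphere (Suc n)" by blast
next
  fix e assume "e \<in> (\<lambda>y. (parent y, y)) ` sphere (Suc n)"
  then obtain y where "e = (parent y, y)" "lev y = Suc n" by auto
  then show "e \<in> boundary_edges adj (ball n)"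
    using children_parent[of y] by (cases "y = root") (auto simp: boundary_edges_def children_def)
qed

lemma ancestor_self [simp]: "ancestor (lev y) y = y" by (simp add: ancestor_def)

lemma ancestor_parent: "m < lev y \<Longrightarrow> ancestor m y = ancestor m (parent y)"
proof -
  assume m: "m < lev y"
  then have "lev y = Suc (lev (parent y))" using lev_parent[of y] by (cases "y = root") auto
  then have "lev y - m = Suc (lev (parent y) - m)" using m by simp
  then show ?thesis by (simp add: ancestor_def funpow_Suc_right del: funpow.simps)
qed

lemma lev_ancestor: "m \<le> lev y \<Longrightarrow> lev (ancestor m y) = m"
proof (induction "lev y - m" arbitrary: y)
  case 0
  then have "m = lev y" by simp
  then show ?case by simp
next
  case (Suc k)
  then have "y \<noteq> root" by auto
  then have "lev y = Suc (lev (parent y))" by (rule lev_parent)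
  then show ?case using Suc ancestor_parent[of m y] by simp
qed

lemma below_parent: "y \<in> below x \<Longrightarrow> parent y = x \<or> parent y \<in> below x"
proof -
  assume y: "y \<in> below x"
  then have l: "lev y = Suc (lev (parent y))" using lev_parent[of y] by (cases "y = root") (auto simp: below_def)
  have a: "ancestor (lev x) (parent y) = x" using y ancestor_parent[of "lev x" y] by (auto simp: below_def)
  show ?thesis
  proof (cases "lev (parent y) = lev x")
    case True
    then show ?thesis using a ancestor_self[of "parent y"] by simp
  next
    case False
    then show ?thesis using a l y by (auto simp: below_def)
  qed
qed

lemma child_below: "y \<in> children z \<Longrightarrow> z = x \<or> z \<in> below x \<Longrightarrow> y \<in> below x"
proof -
  assume y: "y \<in> children z" and z: "z = x \<or> z \<in> below x"
  have "lev x \<le> lev z" "ancestor (lev x) z = x" using z by (auto simp: below_def)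
  moreover have "lev y = Suc (lev z)" "parent y = z"
    using y lev_child by (auto simp: mem_children_iff)
  ultimately show ?thesis using ancestor_parent[of "lev x" y] by (simp add: below_def)
qed

lemma below_child_subset: "y \<in> children x \<Longrightarrow> below y \<subseteq> below x"
proof
  fix v assume y: "y \<in> children x" and "v \<in> below y"
  from \<open>v \<in> below y\<close> show "v \<in> below x"
  proof (induction "lev v" arbitrary: v)
    case 0
    then show ?case by (simp add: below_def)
  next
    case (Suc n)
    then have v: "v \<noteq> root" by auto
    from Suc below_parent[of v y] have "parent v = y \<or> parent v \<in> below y" by simp
    then have "parent v \<in> below x"
      using Suc lev_parent[OF v] child_below[OF y] by auto
    then show ?case using child_below[OF children_parent[OF v]] by simp
  qed
qed

lemma below_trans: "y \<in> below x \<Longrightarrow> below y \<subseteq> below x"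
proof (induction "lev y - lev x" arbitrary: y)
  case 0
  then show ?case by (simp add: below_def)
next
  case (Suc k)
  have y: "y \<noteq> root" using Suc by (auto simp: below_def)
  from below_parent[OF Suc(3)] show ?case
  proof
    assume "parent y = x"
    then show ?thesis using below_child_subset[OF children_parent[OF y]] by simp
  next
    assume "parent y \<in> below x"
    then have "below (parent y) \<subseteq> below x" using Suc lev_parent[OF y] by (intro Suc(1)) auto
    then show ?thesis using below_child_subset[OF children_parent[OF y]] by blast
  qed
qed

lemma lev_below: "y \<in> below x \<Longrightarrow> lev x < lev y" by (simp add: below_def)

lemma below_disjoint: "lev x = lev x' \<Longrightarrow> x \<noteq> x' \<Longrightarrow> below x \<inter> below x' = {}"
  by (auto simp: below_def)

lemma Union_below: "(\<Union>x\<in>sphere m. below x) = {y. m < lev y}"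
proof (intro set_eqI iffI)
  fix y assume "y \<in> {y. m < lev y}"
  then have "y \<in> below (ancestor m y)" "ancestor m y \<in> sphere m"
    using lev_ancestor[of m y] by (auto simp: below_def)
  then show "y \<in> (\<Union>x\<in>sphere m. below x)" by blast
qed (auto simp: below_def)

lemma ball_diff_decomp: "ball n - ball m = (\<Union>x\<in>sphere m. below x \<inter> ball n)"
  using Union_below[of m] by auto

end

section \<open>Weights and messages\<close>

lemma sum_PiE_Un_disjoint:
  assumes "A \<inter> B = {}"
  shows "(\<Sum>f\<in>PiE (A \<union> B) S. F f) = (\<Sum>s\<in>PiE A S. \<Sum>t\<in>PiE B S. F (override_on t s A))"
proof -
  have "override_on (restrict f B) (restrict f A) A = f" if "f \<in> PiE (A \<union> B) S" for f
    using that by (auto simp: override_on_def fun_eq_iff PiE_iff extensional_def)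
  moreover have "restrict (override_on t s A) A = s" "restrict (override_on t s A) B = t"
    "override_on t s A \<in> PiE (A \<union> B) S" if "s \<in> PiE A S" "t \<in> PiE B S" for s t
    using that assms by (auto simp: override_on_def fun_eq_iff PiE_iff extensional_def)
  ultimately show ?thesis
    unfolding sum.cartesian_product
    by (intro sum.reindex_bij_witness[where i = "\<lambda>(s, t). override_on t s A" and j = "\<lambda>f. (restrict f A, restrict f B)"])
      (auto simp: PiE_iff)
qed

lemma sum_PiE_UN_prod:
  fixes f :: "'i \<Rightarrow> ('a \<Rightarrow> 'b) \<Rightarrow> real"
  assumes "finite I" "disjoint_family_on F I"
  shows "(\<Sum>t\<in>PiE (\<Union>i\<in>I. F i) S. \<Prod>i\<in>I. f i (restrict t (F i))) = (\<Prod>i\<in>I. \<Sum>t\<in>PiE (F i) S. f i t)"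
  using assms
proof (induction I rule: finite_induct)
  case empty
  then show ?case by simp
next
  case (insert i I)
  have disj: "F i \<inter> (\<Union>j\<in>I. F j) = {}"
    using insert by (auto simp: disjoint_family_on_def)
  have r1: "restrict (override_on t s (F i)) (F i) = s" if "s \<in> PiE (F i) S" for s t
    using that by (auto simp: fun_eq_iff override_on_def PiE_iff extensional_def)
  have r2: "restrict (override_on t s (F i)) (F j) = restrict t (F j)" if "j \<in> I" for s t j
    using that disj by (auto simp: fun_eq_iff override_on_def)
  have "(\<Sum>t\<in>PiE (\<Union>i\<in>insert i I. F i) S. \<Prod>i\<in>insert i I. f i (restrict t (F i)))
    = (\<Sum>s\<in>PiE (F i) S. \<Sum>t\<in>PiE (\<Union>j\<in>I. F j) S. f i s * (\<Prod>j\<in>I. f j (restrict t (F j))))"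
    unfolding UN_insert sum_PiE_Un_disjoint[OF disj]
    using insert by (intro sum.cong refl) (simp add: r1 r2)
  also have "\<dots> = (\<Sum>s\<in>PiE (F i) S. f i s) * (\<Sum>t\<in>PiE (\<Union>j\<in>I. F j) S. \<Prod>j\<in>I. f j (restrict t (F j)))"
    by (simp add: sum_product)
  also have "\<dots> = (\<Sum>s\<in>PiE (F i) S. f i s) * (\<Prod>i\<in>I. \<Sum>t\<in>PiE (F i) S. f i t)"
    using insert by (subst insert.IH) (auto simp: disjoint_family_on_def)
  finally show ?case unfolding prod.insert[OF insert(1,2)] .
qed

locale tree_spin_system = rooted_cayley_tree adj d root
  for adj :: "'v \<Rightarrow> 'v \<Rightarrow> bool" and d and root +
  fixes Q :: "'s set" and K :: "'s \<Rightarrow> 's \<Rightarrow> real" and q0 :: 's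
  assumes finite_Q: "finite Q" and q0: "q0 \<in> Q"
    and K_pos: "\<And>a b. a \<in> Q \<Longrightarrow> b \<in> Q \<Longrightarrow> K a b > 0"
begin

abbreviation conf :: "'v set \<Rightarrow> ('v \<Rightarrow> 's) set" where "conf F \<equiv> F \<rightarrow>\<^sub>E Q"

definition weight :: "nat \<Rightarrow> ('v \<Rightarrow> 's) \<Rightarrow> real" where
  "weight n t = (\<Prod>y\<in>ball n - {root}. K (t (parent y)) (t y))"

text \<open>\<open>msg k x \<eta> a\<close> is the partition function of the subtree below \<open>x\<close>
  down to relative depth \<open>k\<close>, with spin \<open>a\<close> at \<open>x\<close> and boundary condition \<open>\<eta>\<close> at relative depth \<open>k + 1\<close>.\<close>

primrec msg :: "nat \<Rightarrow> 'v \<Rightarrow> ('v \<Rightarrow> 's) \<Rightarrow> 's \<Rightarrow> real" where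
  "msg 0 x \<eta> a = (\<Prod>y\<in>children x. K a (\<eta> y))"
| "msg (Suc k) x \<eta> a = (\<Prod>y\<in>children x. \<Sum>b\<in>Q. K a b * msg k y \<eta> b)"

definition ratio :: "nat \<Rightarrow> 'v \<Rightarrow> ('v \<Rightarrow> 's) \<Rightarrow> 's \<Rightarrow> real" where
  "ratio k x \<eta> a = msg k x \<eta> a / msg k x \<eta> q0"

definition partial_sum :: "nat \<Rightarrow> nat \<Rightarrow> ('v \<Rightarrow> 's) \<Rightarrow> ('v \<Rightarrow> 's) \<Rightarrow> real" where
  "partial_sum n m \<eta> s = (\<Sum>t\<in>conf (ball n - ball m).
     weight (Suc n) (override_on \<eta> (override_on t s (ball m)) (ball n)))"

definition partition_sum :: "nat \<Rightarrow> ('v \<Rightarrow> 's) \<Rightarrow> real" where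
  "partition_sum n \<eta> = (\<Sum>s\<in>conf (ball n). weight (Suc n) (override_on \<eta> s (ball n)))"

definition marginal :: "nat \<Rightarrow> nat \<Rightarrow> ('v \<Rightarrow> 's) \<Rightarrow> ('v \<Rightarrow> 's) \<Rightarrow> real" where
  "marginal n m \<eta> s = partial_sum n m \<eta> s / partition_sum n \<eta>"

lemma finite_conf [simp]: "finite F \<Longrightarrow> finite (conf F)"
  using finite_Q by (intro finite_PiE) auto

lemma lev_parent_le: "lev (parent y) \<le> n" if "y \<in> ball n - {root}"
  using that lev_parent[of y] by auto

lemma weight_cong: "(\<And>v. v \<in> ball n \<Longrightarrow> s v = t v) \<Longrightarrow> weight n s = weight n t"
  unfolding weight_def using lev_parent_le by (intro prod.cong refl) auto

lemma weight_pos: "(\<And>v. v \<in> ball n \<Longrightarrow> t v \<in> Q) \<Longrightarrow> weight n t > 0"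
  unfolding weight_def using lev_parent_le by (intro prod_pos K_pos) auto

lemma weight_Suc: "weight (Suc n) t = weight n t * (\<Prod>y\<in>sphere (Suc n). K (t (parent y)) (t y))"
proof -
  have *: "ball (Suc n) - {root} = (ball n - {root}) \<union> sphere (Suc n)" by auto
  show ?thesis unfolding weight_def by (subst *) (rule prod.union_disjoint; auto)
qed

lemma weight_diff:
  assumes "m \<le> n"
  shows "weight n t = weight m t * (\<Prod>y\<in>ball n - ball m. K (t (parent y)) (t y))"
proof -
  have *: "ball n - {root} = (ball m - {root}) \<union> (ball n - ball m)" using assms by auto
  show ?thesis unfolding weight_def by (subst *) (rule prod.union_disjoint; auto)
qed

lemma disjoint_children: "disjoint_family_on children X"
  using children_unique by (auto simp: disjoint_family_on_def)

lemma disjoint_below: "disjoint_family_on (\<lambda>x. below x \<inter> S) (sphere m)"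
  using below_disjoint by (force simp: disjoint_family_on_def)

lemma prod_sphere_Suc: "(\<Prod>y\<in>sphere (Suc n). f y) = (\<Prod>x\<in>sphere n. \<Prod>y\<in>children x. f y)"
  unfolding sphere_Suc using disjoint_children[of "sphere n"]
  by (intro prod.UNION_disjoint) (auto simp: disjoint_family_on_def)

lemma weight_below:
  assumes "m \<le> n"
  shows "weight n t = weight m t * (\<Prod>x\<in>sphere m. \<Prod>y\<in>below x \<inter> ball n. K (t (parent y)) (t y))"
  unfolding weight_diff[OF assms] ball_diff_decomp using disjoint_below[of "ball n" m]
  by (subst prod.UNION_disjoint) (auto simp: disjoint_family_on_def)

lemma msg_pos: "range \<eta> \<subseteq> Q \<Longrightarrow> a \<in> Q \<Longrightarrow> msg k x \<eta> a > 0"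
proof (induction k arbitrary: x a)
  case 0
  then show ?case by (auto intro!: prod_pos K_pos simp: image_subset_iff)
next
  case (Suc k)
  then show ?case using finite_Q q0 by (auto intro!: prod_pos sum_pos mult_pos_pos K_pos)
qed

lemma msg_cong_below:
  assumes "\<And>v. v \<in> below x \<Longrightarrow> lev v \<le> lev x + Suc k \<Longrightarrow> \<eta> v = \<eta>' v"
  shows "msg k x \<eta> a = msg k x \<eta>' a"
  using assms
proof (induction k arbitrary: x a)
  case 0
  then show ?case using child_below[of _ x x] lev_child[of _ x] by (auto intro!: prod.cong)
next
  case (Suc k)
  have "msg k y \<eta> b = msg k y \<eta>' b" if y: "y \<in> children x" for y b
  proof (rule Suc.IH)
    fix v assume v: "v \<in> below y" "lev v \<le> lev y + Suc k"
    have "v \<in> below x" using below_child_subset[OF y] v by auto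
    then show "\<eta> v = \<eta>' v" using v lev_child[OF y] by (intro Suc.prems) auto
  qed
  then show ?case by (auto intro!: prod.cong sum.cong)
qed

lemma partial_sum_eq:
  "partial_sum (k + m) m \<eta> s = weight m s * (\<Prod>x\<in>sphere m. msg k x \<eta> (s x))"
proof (induction k arbitrary: m s)
  case 0
  have "weight (Suc m) (override_on \<eta> (override_on (\<lambda>_. undefined) s (ball m)) (ball m)) =
      weight m s * (\<Prod>y\<in>sphere (Suc m). K (s (parent y)) (\<eta> y))"
  proof -
    have "K (override_on \<eta> (override_on (\<lambda>_. undefined) s (ball m)) (ball m) (parent y))
        (override_on \<eta> (override_on (\<lambda>_. undefined) s (ball m)) (ball m) y) = K (s (parent y)) (\<eta> y)"
      if "y \<in> sphere (Suc m)" for y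
      using that lev_parent[of y] by (cases "y = root") (auto simp: override_on_def)
    then show ?thesis unfolding weight_Suc
      by (intro arg_cong2[where f = "(*)"] weight_cong prod.cong) (auto simp: override_on_def)
  qed
  also have "(\<Prod>y\<in>sphere (Suc m). K (s (parent y)) (\<eta> y)) = (\<Prod>x\<in>sphere m. msg 0 x \<eta> (s x))"
    unfolding prod_sphere_Suc by (auto intro!: prod.cong simp: mem_children_iff)
  finally show ?case by (simp add: partial_sum_def)
next
  case (Suc k)
  have dec: "ball (Suc k + m) - ball m = sphere (Suc m) \<union> (ball (k + Suc m) - ball (Suc m))" by auto
  have disj: "sphere (Suc m) \<inter> (ball (k + Suc m) - ball (Suc m)) = {}" by auto
  have ov: "override_on (override_on u t (sphere (Suc m))) s (ball m)
      = override_on u (override_on t s (ball m)) (ball (Suc m))" for u t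
    by (auto simp: override_on_def fun_eq_iff)
  have "partial_sum (Suc k + m) m \<eta> s
    = (\<Sum>t\<in>conf (sphere (Suc m)). partial_sum (k + Suc m) (Suc m) \<eta> (override_on t s (ball m)))"
    unfolding partial_sum_def dec sum_PiE_Un_disjoint[OF disj] ov by simp
  also have "\<dots> = (\<Sum>t\<in>conf (sphere (Suc m)). weight m s *
      (\<Prod>y\<in>sphere (Suc m). K (s (parent y)) (t y) * msg k y \<eta> (t y)))"
  proof (rule sum.cong[OF refl])
    fix t
    have "weight m (override_on t s (ball m)) = weight m s"
      by (rule weight_cong) (auto simp: override_on_def)
    moreover have "override_on t s (ball m) (parent y) = s (parent y)" "override_on t s (ball m) y = t y"
      if "y \<in> sphere (Suc m)" for y
      using that lev_parent[of y] by (cases "y = root"; auto simp: override_on_def)+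
    ultimately show "partial_sum (k + Suc m) (Suc m) \<eta> (override_on t s (ball m)) =
        weight m s * (\<Prod>y\<in>sphere (Suc m). K (s (parent y)) (t y) * msg k y \<eta> (t y))"
      unfolding Suc.IH weight_Suc by (simp add: prod.distrib mult.assoc)
  qed
  also have "\<dots> = weight m s * (\<Prod>y\<in>sphere (Suc m). \<Sum>b\<in>Q. K (s (parent y)) b * msg k y \<eta> b)"
    using finite_Q by (subst prod_sum_PiE) (auto simp: sum_distrib_left)
  also have "(\<Prod>y\<in>sphere (Suc m). \<Sum>b\<in>Q. K (s (parent y)) b * msg k y \<eta> b) = (\<Prod>x\<in>sphere m. msg (Suc k) x \<eta> (s x))"
    unfolding prod_sphere_Suc by (auto intro!: prod.cong simp: mem_children_iff)
  finally show ?case .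
qed

lemma partition_sum_eq:
  assumes "m \<le> n"
  shows "partition_sum n \<eta> = (\<Sum>s\<in>conf (ball m). partial_sum n m \<eta> s)"
proof -
  have "ball n = ball m \<union> (ball n - ball m)" using assms by auto
  then have "partition_sum n \<eta> = (\<Sum>s\<in>conf (ball m \<union> (ball n - ball m)). weight (Suc n) (override_on \<eta> s (ball n)))"
    unfolding partition_sum_def by simp
  also have "\<dots> = (\<Sum>s\<in>conf (ball m). partial_sum n m \<eta> s)"
    unfolding partial_sum_def by (rule sum_PiE_Un_disjoint) auto
  finally show ?thesis .
qed

end

context tree_spin_system
begin

abbreviation ref_conf :: "nat \<Rightarrow> 'v \<Rightarrow> 's" where "ref_conf m \<equiv> (\<lambda>v\<in>ball m. q0)"

abbreviation flip_conf :: "nat \<Rightarrow> 'v \<Rightarrow> 's \<Rightarrow> 'v \<Rightarrow> 's" where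
  "flip_conf m x a \<equiv> (\<lambda>v\<in>ball m. if v = x then a else q0)"

lemma K_ratio_bound:
  obtains c where "c \<ge> 1" "\<And>a a' b. a \<in> Q \<Longrightarrow> a' \<in> Q \<Longrightarrow> b \<in> Q \<Longrightarrow> K a b \<le> c * K a' b"
proof
  let ?S = "\<Sum>(a, a', b)\<in>Q \<times> Q \<times> Q. K a b / K a' b"
  show "max 1 ?S \<ge> 1" by simp
  fix a a' b assume Q: "a \<in> Q" "a' \<in> Q" "b \<in> Q"
  have "K a b / K a' b \<le> ?S"
    using member_le_sum[of "(a, a', b)" "Q \<times> Q \<times> Q" "\<lambda>(a, a', b). K a b / K a' b"] Q finite_Q K_pos
    by (force simp: less_imp_le)
  then have "K a b / K a' b \<le> max 1 ?S" by simp
  then show "K a b \<le> max 1 ?S * K a' b" using K_pos[OF Q(2,3)] by (simp add: pos_divide_le_eq)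
qed

lemma msg_ratio_bound:
  obtains C where "C \<ge> 1"
    "\<And>k x \<eta> a a'. range \<eta> \<subseteq> Q \<Longrightarrow> a \<in> Q \<Longrightarrow> a' \<in> Q \<Longrightarrow> msg k x \<eta> a \<le> C * msg k x \<eta> a'"
proof -
  obtain c where c: "c \<ge> 1" "\<And>a a' b. a \<in> Q \<Longrightarrow> a' \<in> Q \<Longrightarrow> b \<in> Q \<Longrightarrow> K a b \<le> c * K a' b"
    using K_ratio_bound by blast
  show ?thesis
  proof (rule that)
    show "c ^ (d + 1) \<ge> 1" using c(1) by (rule one_le_power)
    fix k x and \<eta> :: "'v \<Rightarrow> 's" and a a' assume \<eta>: "range \<eta> \<subseteq> Q" and a: "a \<in> Q" "a' \<in> Q"
    have prod: "(\<Prod>y\<in>children x. f y) \<le> c ^ (d + 1) * (\<Prod>y\<in>children x. g y)"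
      if "\<And>y. y \<in> children x \<Longrightarrow> 0 \<le> f y \<and> 0 \<le> g y \<and> f y \<le> c * g y" for f g :: "'v \<Rightarrow> real"
    proof -
      have "(\<Prod>y\<in>children x. f y) \<le> (\<Prod>y\<in>children x. c * g y)" using that by (intro prod_mono) auto
      also have "\<dots> = c ^ card (children x) * (\<Prod>y\<in>children x. g y)" by (simp add: prod.distrib)
      also have "\<dots> \<le> c ^ (d + 1) * (\<Prod>y\<in>children x. g y)"
        using that c(1) by (intro mult_right_mono power_increasing card_children_le prod_nonneg) auto
      finally show ?thesis .
    qed
    show "msg k x \<eta> a \<le> c ^ (d + 1) * msg k x \<eta> a'"
    proof (cases k)
      case 0
      show ?thesis unfolding 0 msg.simps
        by (rule prod) (use a \<eta> c K_pos in \<open>auto simp: image_subset_iff less_imp_le\<close>)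
    next
      case (Suc j)
      have "(\<Sum>b\<in>Q. K a b * msg j y \<eta> b) \<le> c * (\<Sum>b\<in>Q. K a' b * msg j y \<eta> b)" for y
        using a c msg_pos[OF \<eta>] unfolding sum_distrib_left mult.assoc[symmetric]
        by (intro sum_mono mult_right_mono) (auto intro: less_imp_le)
      moreover have "0 \<le> (\<Sum>b\<in>Q. K a b * msg j y \<eta> b)" if "a \<in> Q" for a y
        using that K_pos msg_pos[OF \<eta>] by (intro sum_nonneg mult_nonneg_nonneg) (auto intro: less_imp_le)
      ultimately show ?thesis unfolding Suc msg.simps by (intro prod) (use a in auto)
    qed
  qed
qed

lemma ratio_pos: "range \<eta> \<subseteq> Q \<Longrightarrow> a \<in> Q \<Longrightarrow> ratio k x \<eta> a > 0"
  unfolding ratio_def using msg_pos q0 by (intro divide_pos_pos) auto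

lemma ratio_ref: "range \<eta> \<subseteq> Q \<Longrightarrow> ratio k x \<eta> q0 = 1"
  unfolding ratio_def using msg_pos[of \<eta> q0 k x] q0 by simp

lemma ratio_cong_below:
  assumes "\<And>v. v \<in> below x \<Longrightarrow> lev v \<le> lev x + Suc k \<Longrightarrow> \<eta> v = \<eta>' v"
  shows "ratio k x \<eta> a = ratio k x \<eta>' a"
  unfolding ratio_def using msg_cong_below[of x k \<eta> \<eta>'] assms by metis

lemma weight_conf_pos: "s \<in> conf (ball m) \<Longrightarrow> weight m s > 0"
  by (rule weight_pos) auto

lemma partial_sum_pos:
  assumes "range \<eta> \<subseteq> Q" "s \<in> conf (ball m)"
  shows "partial_sum (k + m) m \<eta> s > 0"
  unfolding partial_sum_eq using assms weight_conf_pos msg_pos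
  by (intro mult_pos_pos prod_pos) (auto simp: PiE_iff)

lemma conf_nonempty: "conf F \<noteq> {}"
  using q0 by (auto simp: PiE_eq_empty_iff)

lemma partition_sum_pos: "range \<eta> \<subseteq> Q \<Longrightarrow> partition_sum (k + m) \<eta> > 0"
  using partial_sum_pos conf_nonempty
  by (subst partition_sum_eq[of m]) (auto intro!: sum_pos)

lemma marginal_eq_ratio:
  assumes \<eta>: "range \<eta> \<subseteq> Q"
  shows "marginal (k + m) m \<eta> s = weight m s * (\<Prod>x\<in>sphere m. ratio k x \<eta> (s x)) /
    (\<Sum>s'\<in>conf (ball m). weight m s' * (\<Prod>x\<in>sphere m. ratio k x \<eta> (s' x)))"
proof -
  let ?c = "\<Prod>x\<in>sphere m. msg k x \<eta> q0"
  have c: "?c > 0" using msg_pos[OF \<eta>] q0 by (intro prod_pos) auto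
  have eq: "weight m s' * (\<Prod>x\<in>sphere m. ratio k x \<eta> (s' x)) = partial_sum (k + m) m \<eta> s' / ?c" for s'
    unfolding partial_sum_eq ratio_def by (simp add: prod_dividef)
  show ?thesis
    unfolding eq marginal_def sum_divide_distrib[symmetric] using c by (simp add: partition_sum_eq[of m] del: prod_zero_iff)
qed

lemma marginal_lower_bound:
  obtains c where "c > 0"
    "\<And>k \<eta> s. range \<eta> \<subseteq> Q \<Longrightarrow> s \<in> conf (ball m) \<Longrightarrow> c \<le> marginal (k + m) m \<eta> s"
proof -
  obtain C where C: "C \<ge> 1"
    "\<And>k x \<eta> a a'. range \<eta> \<subseteq> Q \<Longrightarrow> a \<in> Q \<Longrightarrow> a' \<in> Q \<Longrightarrow> msg k x \<eta> a \<le> C * msg k x \<eta> a'"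
    using msg_ratio_bound by blast
  define W where "W = (\<Sum>(s, s')\<in>conf (ball m) \<times> conf (ball m). weight m s' / weight m s)"
  define N where "N = real (card (conf (ball m)))"
  define D where "D = W * C ^ card (sphere m)"
  have W: "weight m s' \<le> W * weight m s" if "s \<in> conf (ball m)" "s' \<in> conf (ball m)" for s s'
  proof -
    have "weight m s' / weight m s \<le> W" unfolding W_def
      using member_le_sum[of "(s, s')" "conf (ball m) \<times> conf (ball m)" "\<lambda>(s, s'). weight m s' / weight m s"]
        that weight_conf_pos by (force simp: less_imp_le)
    then show ?thesis using weight_conf_pos[OF that(1)] by (simp add: pos_divide_le_eq)
  qed
  obtain s0 where s0: "s0 \<in> conf (ball m)" using conf_nonempty[of "ball m"] by blast
  have "W > 0" using W[OF s0 s0] weight_conf_pos[OF s0] by (metis not_le order_less_le_trans zero_less_mult_pos2)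
  then have D: "D > 0" using C(1) by (simp add: D_def)
  have N: "N > 0" using conf_nonempty[of "ball m"] by (simp add: N_def card_gt_0_iff)
  show ?thesis
  proof (rule that)
    show "1 / (N * D) > 0" using D N by simp
    fix k and \<eta> s :: "'v \<Rightarrow> 's" assume \<eta>: "range \<eta> \<subseteq> Q" and s: "s \<in> conf (ball m)"
    have le: "partial_sum (k + m) m \<eta> s' \<le> D * partial_sum (k + m) m \<eta> s" if s': "s' \<in> conf (ball m)" for s'
    proof -
      have "(\<Prod>x\<in>sphere m. msg k x \<eta> (s' x)) \<le> (\<Prod>x\<in>sphere m. C * msg k x \<eta> (s x))"
        using s s' msg_pos[OF \<eta>] C(2)[OF \<eta>] by (intro prod_mono) (auto simp: PiE_iff less_imp_le)
      also have "\<dots> = C ^ card (sphere m) * (\<Prod>x\<in>sphere m. msg k x \<eta> (s x))"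
        by (simp add: prod.distrib)
      finally have "weight m s' * (\<Prod>x\<in>sphere m. msg k x \<eta> (s' x)) \<le>
          (W * weight m s) * (C ^ card (sphere m) * (\<Prod>x\<in>sphere m. msg k x \<eta> (s x)))"
        using W[OF s s'] weight_conf_pos[OF s] \<open>W > 0\<close> s' msg_pos[OF \<eta>]
        by (intro mult_mono) (auto intro!: prod_nonneg simp: PiE_iff less_imp_le)
      then show ?thesis by (simp add: partial_sum_eq D_def mult_ac)
    qed
    have "partition_sum (k + m) \<eta> = (\<Sum>s'\<in>conf (ball m). partial_sum (k + m) m \<eta> s')"
      by (rule partition_sum_eq) simp
    also have "\<dots> \<le> (\<Sum>s'\<in>conf (ball m). D * partial_sum (k + m) m \<eta> s)"
      by (intro sum_mono le)
    also have "\<dots> = N * D * partial_sum (k + m) m \<eta> s" by (simp add: N_def)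
    finally show "1 / (N * D) \<le> marginal (k + m) m \<eta> s"
      using partition_sum_pos[OF \<eta>, of k m] D N unfolding marginal_def by (simp add: field_simps)
  qed
qed

lemma ratio_eq_marginal:
  fixes x
  assumes \<eta>: "range \<eta> \<subseteq> Q" and a: "a \<in> Q"
  defines "m \<equiv> lev x"
  shows "ratio k x \<eta> a = marginal (k + m) m \<eta> (flip_conf m x a) / marginal (k + m) m \<eta> (ref_conf m)
    * (weight m (ref_conf m) / weight m (flip_conf m x a))"
proof -
  have x: "x \<in> sphere m" by (simp add: m_def)
  have s: "ref_conf m \<in> conf (ball m)" "flip_conf m x a \<in> conf (ball m)" using a q0 by auto
  have pos: "partition_sum (k + m) \<eta> > 0" "weight m (ref_conf m) > 0" "weight m (flip_conf m x a) > 0"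
    using partition_sum_pos[OF \<eta>] weight_conf_pos s by auto
  let ?r = "\<Prod>y\<in>sphere m - {x}. msg k y \<eta> q0"
  have r: "?r > 0" using msg_pos[OF \<eta>] q0 by (intro prod_pos) auto
  have "(\<Prod>y\<in>sphere m. msg k y \<eta> (ref_conf m y)) = msg k x \<eta> q0 * ?r"
    "(\<Prod>y\<in>sphere m. msg k y \<eta> (flip_conf m x a y)) = msg k x \<eta> a * ?r"
    using x by (auto simp: prod.remove[OF finite_sphere x] intro!: prod.cong)
  then show ?thesis
    using pos r msg_pos[OF \<eta> q0, of k x] unfolding marginal_def ratio_def partial_sum_eq by (simp add: field_simps del: prod_zero_iff)
qed

lemma marginal_tendsto:
  assumes \<eta>: "range \<eta> \<subseteq> Q" and s: "s \<in> conf (ball m)"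
    and L: "\<And>x a. a \<in> Q \<Longrightarrow> (\<lambda>k. ratio k x \<eta> a) \<longlonglongrightarrow> L x a"
  shows "(\<lambda>k. marginal (k + m) m \<eta> s) \<longlonglongrightarrow> weight m s * (\<Prod>x\<in>sphere m. L x (s x)) /
    (\<Sum>s'\<in>conf (ball m). weight m s' * (\<Prod>x\<in>sphere m. L x (s' x)))"
  unfolding marginal_eq_ratio[OF \<eta>]
proof (intro tendsto_intros L)
  have nonneg: "L x a \<ge> 0" if "a \<in> Q" for x a
    using ratio_pos[OF \<eta> that] by (intro LIMSEQ_le_const[OF L[OF that]]) (auto intro: less_imp_le)
  have one: "L x q0 = 1" for x
    using L[OF q0, of x] by (simp add: ratio_ref[OF \<eta>] LIMSEQ_const_iff)
  have "0 < weight m (ref_conf m) * (\<Prod>x\<in>sphere m. L x (ref_conf m x))"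
    using q0 by (intro mult_pos_pos weight_conf_pos prod_pos) (auto simp: one)
  also have "\<dots> \<le> (\<Sum>s'\<in>conf (ball m). weight m s' * (\<Prod>x\<in>sphere m. L x (s' x)))"
  proof (rule member_le_sum)
    show "ref_conf m \<in> conf (ball m)" using q0 by auto
    fix s' assume "s' \<in> conf (ball m) - {ref_conf m}"
    then have s': "s' \<in> conf (ball m)" by blast
    show "0 \<le> weight m s' * (\<Prod>x\<in>sphere m. L x (s' x))"
      using nonneg weight_conf_pos[OF s'] s' by (intro mult_nonneg_nonneg prod_nonneg) (auto simp: PiE_iff)
  qed simp
  finally show "(\<Sum>s'\<in>conf (ball m). weight m s' * (\<Prod>x\<in>sphere m. L x (s' x))) \<noteq> 0" by simp
qed (use s in \<open>auto simp: PiE_iff\<close>)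

lemma ratio_tendsto:
  assumes \<eta>: "range \<eta> \<subseteq> Q" and a: "a \<in> Q" and m: "m = lev x"
    and p: "\<And>s. s \<in> conf (ball m) \<Longrightarrow> (\<lambda>k. marginal (k + m) m \<eta> s) \<longlonglongrightarrow> p s"
  shows "(\<lambda>k. ratio k x \<eta> a) \<longlonglongrightarrow>
    p (flip_conf m x a) / p (ref_conf m) * (weight m (ref_conf m) / weight m (flip_conf m x a))"
proof -
  have s: "ref_conf m \<in> conf (ball m)" "flip_conf m x a \<in> conf (ball m)" using a q0 by auto
  obtain c where c: "c > 0" "\<And>k. c \<le> marginal (k + m) m \<eta> (ref_conf m)"
    using marginal_lower_bound[of m] \<eta> s by metis
  have "c \<le> p (ref_conf m)" using c by (intro LIMSEQ_le_const[OF p[OF s(1)]]) auto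
  then have "p (ref_conf m) \<noteq> 0" using c by simp
  then show ?thesis
    unfolding ratio_eq_marginal[OF \<eta> a, of _ x] m[symmetric] by (intro tendsto_intros p s)
qed

definition agree :: "('v \<Rightarrow> 's) \<Rightarrow> ('v \<Rightarrow> 's) \<Rightarrow> 'v \<Rightarrow> bool" where
  "agree \<eta> \<eta>' x \<longleftrightarrow>
    (\<exists>L. \<forall>a\<in>Q. (\<lambda>k. ratio k x \<eta> a) \<longlonglongrightarrow> L a \<and> (\<lambda>k. ratio k x \<eta>' a) \<longlonglongrightarrow> L a)"

lemma ratio_Suc_tendsto:
  assumes \<eta>: "range \<eta> \<subseteq> Q" and a: "a \<in> Q"
    and L: "\<And>y b. y \<in> children x \<Longrightarrow> b \<in> Q \<Longrightarrow> (\<lambda>k. ratio k y \<eta> b) \<longlonglongrightarrow> L y b"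
  shows "(\<lambda>k. ratio k x \<eta> a) \<longlonglongrightarrow>
    (\<Prod>y\<in>children x. (\<Sum>b\<in>Q. K a b * L y b) / (\<Sum>b\<in>Q. K q0 b * L y b))"
proof (rule LIMSEQ_imp_Suc)
  have eq: "(\<Sum>b\<in>Q. K a' b * msg k y \<eta> b) = msg k y \<eta> q0 * (\<Sum>b\<in>Q. K a' b * ratio k y \<eta> b)" for a' k y
    using msg_pos[OF \<eta> q0, of k y] by (simp add: ratio_def sum_distrib_left mult.left_commute)
  have "ratio (Suc k) x \<eta> a =
      (\<Prod>y\<in>children x. (\<Sum>b\<in>Q. K a b * ratio k y \<eta> b) / (\<Sum>b\<in>Q. K q0 b * ratio k y \<eta> b))" for k
    unfolding ratio_def[of "Suc k"] msg.simps prod_dividef[symmetric] eq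
    using msg_pos[OF \<eta> q0, of k] by (intro prod.cong refl) (simp add: less_imp_neq[symmetric])
  moreover have "(\<Sum>b\<in>Q. K q0 b * L y b) \<noteq> 0" if y: "y \<in> children x" for y
  proof -
    have nonneg: "L y b \<ge> 0" if "b \<in> Q" for b
      using ratio_pos[OF \<eta> that] by (intro LIMSEQ_le_const[OF L[OF y that]]) (auto intro: less_imp_le)
    have "L y q0 = 1" using L[OF y q0] by (simp add: ratio_ref[OF \<eta>] LIMSEQ_const_iff)
    then have "0 < K q0 q0 * L y q0" using K_pos[OF q0 q0] by simp
    also have "\<dots> \<le> (\<Sum>b\<in>Q. K q0 b * L y b)"
      using finite_Q q0 K_pos nonneg by (intro member_le_sum) (auto simp: less_imp_le)
    finally show ?thesis by simp
  qed
  ultimately show "(\<lambda>k. ratio (Suc k) x \<eta> a) \<longlonglongrightarrow>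
      (\<Prod>y\<in>children x. (\<Sum>b\<in>Q. K a b * L y b) / (\<Sum>b\<in>Q. K q0 b * L y b))"
    by (simp only:) (intro tendsto_intros L; assumption)
qed

lemma agree_children:
  assumes "range \<eta> \<subseteq> Q" "range \<eta>' \<subseteq> Q" "\<And>y. y \<in> children x \<Longrightarrow> agree \<eta> \<eta>' y"
  shows "agree \<eta> \<eta>' x"
proof -
  from assms(3) have "\<forall>y\<in>children x. \<exists>L. \<forall>a\<in>Q.
      (\<lambda>k. ratio k y \<eta> a) \<longlonglongrightarrow> L a \<and> (\<lambda>k. ratio k y \<eta>' a) \<longlonglongrightarrow> L a"
    unfolding agree_def by blast
  from bchoice[OF this] obtain L where L: "\<forall>y\<in>children x. \<forall>a\<in>Q.
      (\<lambda>k. ratio k y \<eta> a) \<longlonglongrightarrow> L y a \<and> (\<lambda>k. ratio k y \<eta>' a) \<longlonglongrightarrow> L y a"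
    by blast
  show ?thesis
    unfolding agree_def
    by (rule exI[of _ "\<lambda>a. \<Prod>y\<in>children x. (\<Sum>b\<in>Q. K a b * L y b) / (\<Sum>b\<in>Q. K q0 b * L y b)"],
        intro ballI conjI ratio_Suc_tendsto assms) (use L in auto)
qed

lemma agree_iff_level:
  assumes \<eta>: "range \<eta> \<subseteq> Q" "range \<eta>' \<subseteq> Q"
  shows "(\<forall>x. agree \<eta> \<eta>' x) \<longleftrightarrow> (\<forall>x\<in>sphere m. \<forall>y\<in>insert x (below x). agree \<eta> \<eta>' y)"
proof
  assume *: "\<forall>x\<in>sphere m. \<forall>y\<in>insert x (below x). agree \<eta> \<eta>' y"
  have ge: "agree \<eta> \<eta>' y" if "m \<le> lev y" for y
  proof (cases "m = lev y")
    case True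
    then show ?thesis using * by auto
  next
    case False
    then have "y \<in> (\<Union>x\<in>sphere m. below x)" using that unfolding Union_below by simp
    then show ?thesis using * by blast
  qed
  have "agree \<eta> \<eta>' y" if "m - lev y = k" for k y
    using that
  proof (induction k arbitrary: y)
    case 0
    then show ?case using ge by simp
  next
    case (Suc k)
    have "agree \<eta> \<eta>' z" if "z \<in> children y" for z
      using Suc lev_child[OF that] by simp
    then show ?case by (rule agree_children[OF \<eta>])
  qed
  then show "\<forall>x. agree \<eta> \<eta>' x" by blast
qed blast

end

section \<open>Conditional independence of subtrees\<close>

locale tree_markov_field = tree_spin_system adj d root Q K q0 + prob_space M
  for adj :: "'v \<Rightarrow> 'v \<Rightarrow> bool" and d and root
    and Q :: "'s set" and K :: "'s \<Rightarrow> 's \<Rightarrow> real" and q0 and M :: "'w measure" +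
  fixes Y :: "'v \<Rightarrow> 'w \<Rightarrow> 's"
  assumes Y_in_Q: "\<And>v \<omega>. \<omega> \<in> space M \<Longrightarrow> Y v \<omega> \<in> Q"
    and Y_events: "\<And>v a. {\<omega> \<in> space M. Y v \<omega> = a} \<in> events"
    and prob_cylinder: "\<And>n t. t \<in> conf (ball n) \<Longrightarrow>
      prob {\<omega> \<in> space M. \<forall>v\<in>ball n. Y v \<omega> = t v} = weight n t / (\<Sum>t'\<in>conf (ball n). weight n t')"
begin

definition obs :: "'v set \<Rightarrow> 'w \<Rightarrow> 'v \<Rightarrow> 's" where
  "obs F \<omega> = restrict (\<lambda>v. Y v \<omega>) F"

definition depends_on :: "'v set \<Rightarrow> 'w set \<Rightarrow> bool" where
  "depends_on F A \<longleftrightarrow> A \<subseteq> space M \<and>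
    (\<forall>\<omega>\<in>A. \<forall>\<omega>'\<in>space M. (\<forall>v\<in>F. Y v \<omega> = Y v \<omega>') \<longrightarrow> \<omega>' \<in> A)"

definition local_events :: "'v set \<Rightarrow> 'w set set" where
  "local_events D = {A. \<exists>F. finite F \<and> F \<subseteq> D \<and> depends_on F A}"

abbreviation cylinder :: "nat \<Rightarrow> ('v \<Rightarrow> 's) \<Rightarrow> 'w set" where
  "cylinder n t \<equiv> {\<omega> \<in> space M. obs (ball n) \<omega> = t}"

definition Z :: "nat \<Rightarrow> real" where "Z n = (\<Sum>t\<in>conf (ball n). weight n t)"

lemma obs_in_conf: "\<omega> \<in> space M \<Longrightarrow> obs F \<omega> \<in> conf F"
  by (auto simp: obs_def Y_in_Q)

lemma restrict_obs: "F \<subseteq> F' \<Longrightarrow> restrict (obs F' \<omega>) F = obs F \<omega>"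
  by (auto simp: obs_def fun_eq_iff)

lemma obs_eq_iff: "obs F \<omega> = obs F \<omega>' \<longleftrightarrow> (\<forall>v\<in>F. Y v \<omega> = Y v \<omega>')"
  by (auto simp: obs_def fun_eq_iff)

lemma obs_measurable [measurable]:
  assumes "finite F"
  shows "{\<omega> \<in> space M. obs F \<omega> \<in> B} \<in> events"
proof -
  have single: "{\<omega> \<in> space M. obs F \<omega> = t} \<in> events" if t: "t \<in> conf F" for t
  proof -
    have "{\<omega> \<in> space M. obs F \<omega> = t} = {\<omega> \<in> space M. \<forall>v\<in>F. Y v \<omega> = t v}"
      using t by (auto simp: obs_def fun_eq_iff PiE_iff extensional_def)
    also have "\<dots> \<in> events" using assms Y_events by (intro sets.sets_Collect_finite_All) auto
    finally show ?thesis .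
  qed
  have "{\<omega> \<in> space M. obs F \<omega> \<in> B} = (\<Union>t\<in>B \<inter> conf F. {\<omega> \<in> space M. obs F \<omega> = t})"
    using obs_in_conf by auto
  also have "\<dots> \<in> events" using assms single by (intro sets.finite_UN) auto
  finally show ?thesis .
qed

lemma obs_eq_measurable: "finite F \<Longrightarrow> {\<omega> \<in> space M. obs F \<omega> = t} \<in> events"
  using obs_measurable[of F "{t}"] by simp

lemma depends_on_eq: "depends_on F A \<Longrightarrow> A = {\<omega> \<in> space M. obs F \<omega> \<in> obs F ` A}"
  unfolding depends_on_def by (auto simp: obs_eq_iff)

lemma depends_on_events: "finite F \<Longrightarrow> depends_on F A \<Longrightarrow> A \<in> events"
  using obs_measurable[of F "obs F ` A"] depends_on_eq[of F A] by simp

lemma depends_on_mono: "depends_on F A \<Longrightarrow> F \<subseteq> F' \<Longrightarrow> depends_on F' A"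
  unfolding depends_on_def by blast

lemma local_events_mono: "D \<subseteq> D' \<Longrightarrow> local_events D \<subseteq> local_events D'"
  unfolding local_events_def by blast

lemma local_events_sets: "local_events D \<subseteq> events"
  unfolding local_events_def using depends_on_events by blast

lemma algebra_local_events: "algebra (space M) (local_events D)"
  unfolding algebra_iff_Un
proof (intro conjI ballI)
  show "local_events D \<subseteq> Pow (space M)" by (auto simp: local_events_def depends_on_def)
  show "{} \<in> local_events D" by (auto simp: local_events_def depends_on_def)
  show "space M - A \<in> local_events D" if "A \<in> local_events D" for A
    using that unfolding local_events_def depends_on_def by (auto; metis)
  fix A B assume "A \<in> local_events D" "B \<in> local_events D"
  then obtain F F' where F: "finite F" "F \<subseteq> D" "depends_on F A" and F': "finite F'" "F' \<subseteq> D" "depends_on F' B"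
    unfolding local_events_def by blast
  have "depends_on (F \<union> F') A" "depends_on (F \<union> F') B"
    using F F' depends_on_mono by blast+
  then have "depends_on (F \<union> F') (A \<union> B)" unfolding depends_on_def by blast
  then show "A \<union> B \<in> local_events D" using F F' unfolding local_events_def by blast
qed

lemma Z_pos: "Z n > 0"
  unfolding Z_def using conf_nonempty weight_conf_pos by (intro sum_pos) auto

lemma prob_cylinder_eq:
  assumes "t \<in> conf (ball n)" shows "prob (cylinder n t) = weight n t / Z n"
proof -
  have "cylinder n t = {\<omega> \<in> space M. \<forall>v\<in>ball n. Y v \<omega> = t v}"
    using assms by (auto simp: obs_def fun_eq_iff PiE_iff extensional_def)
  then show ?thesis using prob_cylinder[OF assms] by (simp add: Z_def)
qed

lemma prob_cylinder_pos: "t \<in> conf (ball n) \<Longrightarrow> prob (cylinder n t) > 0"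
  by (simp add: prob_cylinder_eq weight_conf_pos Z_pos)

lemma obs_fun_eq_sum:
  assumes "finite F" "\<omega> \<in> space M"
  shows "(f (obs F \<omega>) :: real) = (\<Sum>t\<in>conf F. f t * indicator {\<omega> \<in> space M. obs F \<omega> = t} \<omega>)"
proof -
  have "(\<Sum>t\<in>conf F. f t * indicator {\<omega> \<in> space M. obs F \<omega> = t} \<omega>) = (\<Sum>t\<in>conf F. if t = obs F \<omega> then f t else 0)"
    using assms by (intro sum.cong) (auto simp: indicator_def)
  then show ?thesis using obs_in_conf[OF assms(2)] assms(1) by simp
qed

lemma borel_measurable_obs:
  assumes "finite F" shows "(\<lambda>\<omega>. f (obs F \<omega>) :: real) \<in> borel_measurable M"
  by (subst measurable_cong[OF obs_fun_eq_sum[OF assms]], assumption)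
    (intro borel_measurable_sum borel_measurable_times borel_measurable_indicator obs_eq_measurable assms borel_measurable_const)

lemma expectation_obs:
  "expectation (\<lambda>\<omega>. f (obs (ball n) \<omega>)) = (\<Sum>t\<in>conf (ball n). weight n t * f t) / Z n"
proof -
  have "expectation (\<lambda>\<omega>. f (obs (ball n) \<omega>)) =
      expectation (\<lambda>\<omega>. \<Sum>t\<in>conf (ball n). f t * indicator {\<omega> \<in> space M. obs (ball n) \<omega> = t} \<omega>)"
    by (intro Bochner_Integration.integral_cong refl obs_fun_eq_sum) auto
  also have "\<dots> = (\<Sum>t\<in>conf (ball n). f t * prob {\<omega> \<in> space M. obs (ball n) \<omega> = t})"
    using obs_eq_measurable[OF finite_ball]
    by (subst Bochner_Integration.integral_sum) (auto simp: emeasure_eq_measure intro!: sum.cong)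
  also have "\<dots> = (\<Sum>t\<in>conf (ball n). weight n t * f t) / Z n"
    unfolding sum_divide_distrib by (intro sum.cong) (auto simp: prob_cylinder_eq)
  finally show ?thesis .
qed

definition below_weight :: "'v \<Rightarrow> nat \<Rightarrow> 's \<Rightarrow> ('v \<Rightarrow> 's) \<Rightarrow> real" where
  "below_weight x n a t = (\<Prod>y\<in>below x \<inter> ball n. K (if parent y = x then a else t (parent y)) (t y))"

definition kernel :: "'v \<Rightarrow> nat \<Rightarrow> 's \<Rightarrow> ('v \<Rightarrow> 's) set \<Rightarrow> real" where
  "kernel x n a B = (\<Sum>t\<in>conf (below x \<inter> ball n). of_bool (t \<in> B) * below_weight x n a t) /
     (\<Sum>t\<in>conf (below x \<inter> ball n). below_weight x n a t)"

lemma parent_in_below: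
  assumes "y \<in> below x \<inter> ball n" "parent y \<noteq> x"
  shows "parent y \<in> below x \<inter> ball n"
proof -
  have "y \<noteq> root" using assms(1) by (auto simp: below_def)
  then show ?thesis using assms below_parent[of y x] lev_parent[of y] by auto
qed

lemma below_weight_pos: "a \<in> Q \<Longrightarrow> t \<in> conf (below x \<inter> ball n) \<Longrightarrow> below_weight x n a t > 0"
  unfolding below_weight_def using parent_in_below[of _ x n]
  by (intro prod_pos K_pos) (auto simp: PiE_iff)

lemma below_weight_sum_pos: "a \<in> Q \<Longrightarrow> (\<Sum>t\<in>conf (below x \<inter> ball n). below_weight x n a t) > 0"
  using below_weight_pos conf_nonempty by (intro sum_pos) auto

lemma prob_cylinder_below_aux:
  assumes "m \<le> n" "s \<in> conf (ball m)"
  shows "prob (cylinder m s \<inter> {\<omega> \<in> space M. \<forall>x\<in>sphere m. obs (below x \<inter> ball n) \<omega> \<in> B x}) =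
    weight m s / Z n * (\<Prod>x\<in>sphere m. \<Sum>t\<in>conf (below x \<inter> ball n). of_bool (t \<in> B x) * below_weight x n (s x) t)"
    (is "prob ?A = _")
proof -
  let ?F = "\<lambda>x. below x \<inter> ball n"
  let ?f = "\<lambda>r. of_bool (restrict r (ball m) = s \<and> (\<forall>x\<in>sphere m. restrict r (?F x) \<in> B x)) :: real"
  have sub: "ball m \<subseteq> ball n" "?F x \<subseteq> ball n" for x using assms(1) by auto
  have ev: "?A \<in> events"
  proof -
    have "?A = {\<omega> \<in> space M. obs (ball n) \<omega> \<in> {r. restrict r (ball m) = s \<and> (\<forall>x\<in>sphere m. restrict r (?F x) \<in> B x)}}"
      by (auto simp: restrict_obs[OF sub(1)] restrict_obs[OF sub(2)])
    then show ?thesis by (simp only:) (rule obs_measurable, simp)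
  qed
  have split: "(\<Sum>r\<in>conf (ball n). g r) =
      (\<Sum>s'\<in>conf (ball m). \<Sum>t\<in>conf (ball n - ball m). g (override_on t s' (ball m)))" for g :: "_ \<Rightarrow> real"
    using sum_PiE_Un_disjoint[where A = "ball m" and B = "ball n - ball m" and S = "\<lambda>_. Q" and F = g] sub by (simp add: Un_absorb1)
  have "prob ?A = expectation (indicator ?A)" using ev by simp
  also have "\<dots> = expectation (\<lambda>\<omega>. ?f (obs (ball n) \<omega>))"
    by (intro Bochner_Integration.integral_cong refl)
      (auto simp: indicator_def restrict_obs[OF sub(1)] restrict_obs[OF sub(2)])
  also have "\<dots> = (\<Sum>r\<in>conf (ball n). weight n r * ?f r) / Z n" by (rule expectation_obs)
  also have "(\<Sum>r\<in>conf (ball n). weight n r * ?f r) =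
    (\<Sum>s'\<in>conf (ball m). \<Sum>t\<in>conf (ball n - ball m). weight n (override_on t s' (ball m)) * ?f (override_on t s' (ball m)))"
    by (rule split)
  also have "\<dots> = (\<Sum>s'\<in>conf (ball m). if s' = s then (\<Sum>t\<in>conf (ball n - ball m).
      weight m s * (\<Prod>x\<in>sphere m. of_bool (restrict t (?F x) \<in> B x) * below_weight x n (s x) (restrict t (?F x)))) else 0)"
  proof (intro sum.cong refl)
    fix s' assume s': "s' \<in> conf (ball m)"
    have r1: "restrict (override_on t s' (ball m)) (ball m) = s'" for t
      using s' by (auto simp: fun_eq_iff override_on_def PiE_iff extensional_def)
    have r2: "restrict (override_on t s' (ball m)) (?F x) = restrict t (?F x)" if "x \<in> sphere m" for t x
    proof -
      have "v \<notin> ball m" if "v \<in> ?F x" for v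
        using that \<open>x \<in> sphere m\<close> lev_below[of v x] by simp
      then show ?thesis unfolding override_on_def by (intro restrict_ext) simp
    qed
    have w: "weight n (override_on t s' (ball m)) =
        weight m s' * (\<Prod>x\<in>sphere m. below_weight x n (s' x) (restrict t (?F x)))" for t
    proof -
      have "weight m (override_on t s' (ball m)) = weight m s'"
        by (rule weight_cong) (auto simp: override_on_def)
      moreover have "(\<Prod>y\<in>?F x. K (override_on t s' (ball m) (parent y)) (override_on t s' (ball m) y)) =
          below_weight x n (s' x) (restrict t (?F x))" if x: "x \<in> sphere m" for x
        unfolding below_weight_def
      proof (intro prod.cong refl arg_cong2[where f = K])
        fix y assume y: "y \<in> ?F x"
        show "override_on t s' (ball m) (parent y) = (if parent y = x then s' x else restrict t (?F x) (parent y))"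
          using parent_in_below[OF y] lev_below[of "parent y" x] x by (cases "parent y = x") (auto simp: override_on_def)
        show "override_on t s' (ball m) y = restrict t (?F x) y"
          using y x lev_below[of y x] by (auto simp: override_on_def)
      qed
      ultimately show ?thesis unfolding weight_below[OF assms(1)] by simp
    qed
    show "(\<Sum>t\<in>conf (ball n - ball m). weight n (override_on t s' (ball m)) * ?f (override_on t s' (ball m))) =
      (if s' = s then (\<Sum>t\<in>conf (ball n - ball m).
        weight m s * (\<Prod>x\<in>sphere m. of_bool (restrict t (?F x) \<in> B x) * below_weight x n (s x) (restrict t (?F x)))) else 0)"
    proof (cases "s' = s")
      case True
      have *: "?f (override_on t s' (ball m)) = (\<Prod>x\<in>sphere m. of_bool (restrict t (?F x) \<in> B x))" for t
      proof -
        have "(\<forall>x\<in>sphere m. restrict (override_on t s' (ball m)) (?F x) \<in> B x) \<longleftrightarrow>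
            (\<forall>x\<in>sphere m. restrict t (?F x) \<in> B x)"
          by (intro ball_cong refl) (simp only: r2)
        then have "?f (override_on t s' (ball m)) = of_bool (\<forall>x\<in>sphere m. restrict t (?F x) \<in> B x)"
          by (simp only: r1[unfolded True] True simp_thms)
        also have "\<dots> = (\<Prod>x\<in>sphere m. of_bool (restrict t (?F x) \<in> B x))"
          by (cases "\<forall>x\<in>sphere m. restrict t (?F x) \<in> B x") auto
        finally show ?thesis .
      qed
      show ?thesis unfolding * w if_P[OF True] prod.distrib by (simp only: True mult_ac)
    qed (simp add: r1)
  qed
  also have "\<dots> = weight m s * (\<Sum>t\<in>conf (\<Union>x\<in>sphere m. ?F x).
      \<Prod>x\<in>sphere m. of_bool (restrict t (?F x) \<in> B x) * below_weight x n (s x) (restrict t (?F x)))"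
    using assms(2) unfolding ball_diff_decomp by (simp add: sum_distrib_left)
  also have "\<dots> = weight m s * (\<Prod>x\<in>sphere m. \<Sum>t\<in>conf (?F x). of_bool (t \<in> B x) * below_weight x n (s x) t)"
    by (subst sum_PiE_UN_prod[OF finite_sphere disjoint_below]) simp
  finally show ?thesis by simp
qed

lemma prob_cylinder_below:
  assumes "m \<le> n" "s \<in> conf (ball m)"
  shows "prob (cylinder m s \<inter> {\<omega> \<in> space M. \<forall>x\<in>sphere m. obs (below x \<inter> ball n) \<omega> \<in> B x}) =
    prob (cylinder m s) * (\<Prod>x\<in>sphere m. kernel x n (s x) (B x))"
proof -
  let ?U = "\<Prod>x\<in>sphere m. \<Sum>t\<in>conf (below x \<inter> ball n). below_weight x n (s x) t"
  have "cylinder m s \<inter> {\<omega> \<in> space M. \<forall>x\<in>sphere m. obs (below x \<inter> ball n) \<omega> \<in> UNIV} = cylinder m s" by auto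
  then have c: "prob (cylinder m s) = weight m s / Z n * ?U"
    using prob_cylinder_below_aux[OF assms, of "\<lambda>_. UNIV"] by simp
  have "?U > 0" using assms(2) by (intro prod_pos below_weight_sum_pos) auto
  then show ?thesis
    unfolding prob_cylinder_below_aux[OF assms] c kernel_def prod_dividef by (simp del: prod_zero_iff)
qed

lemma kernel_nonneg: "a \<in> Q \<Longrightarrow> kernel x n a B \<ge> 0"
  unfolding kernel_def using below_weight_pos
  by (intro divide_nonneg_nonneg sum_nonneg) (auto intro: less_imp_le)

lemma kernel_compl: "a \<in> Q \<Longrightarrow> kernel x n a (- B) = 1 - kernel x n a B"
proof -
  assume a: "a \<in> Q"
  have "(\<Sum>t\<in>conf (below x \<inter> ball n). of_bool (t \<in> - B) * below_weight x n a t) =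
      (\<Sum>t\<in>conf (below x \<inter> ball n). below_weight x n a t)
      - (\<Sum>t\<in>conf (below x \<inter> ball n). of_bool (t \<in> B) * below_weight x n a t)"
    unfolding sum_subtractf[symmetric] by (intro sum.cong) auto
  then show ?thesis using below_weight_sum_pos[OF a, of x n] by (simp add: kernel_def diff_divide_distrib)
qed

lemma kernel_le_1: "a \<in> Q \<Longrightarrow> kernel x n a B \<le> 1"
  using kernel_compl[of a x n B] kernel_nonneg[of a x n "- B"] by simp

lemma kernel_UNIV: "a \<in> Q \<Longrightarrow> kernel x n a UNIV = 1"
  using below_weight_sum_pos[of a x n] by (simp add: kernel_def)

lemma prob_cylinder_below_single:
  assumes "m \<le> n" "s \<in> conf (ball m)" "x \<in> sphere m"
  shows "prob (cylinder m s \<inter> {\<omega> \<in> space M. obs (below x \<inter> ball n) \<omega> \<in> B}) =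
    prob (cylinder m s) * kernel x n (s x) B"
proof -
  let ?B = "\<lambda>x'. if x' = x then B else UNIV"
  have "{\<omega> \<in> space M. \<forall>x'\<in>sphere m. obs (below x' \<inter> ball n) \<omega> \<in> ?B x'} =
      {\<omega> \<in> space M. obs (below x \<inter> ball n) \<omega> \<in> B}" using assms(3) by auto
  moreover have "(\<Prod>x'\<in>sphere m. kernel x' n (s x') (?B x')) = kernel x n (s x) B"
  proof -
    have "(\<Prod>x'\<in>sphere m - {x}. kernel x' n (s x') (?B x')) = 1"
      using assms(2) by (intro prod.neutral) (auto simp: kernel_UNIV PiE_iff)
    then show ?thesis by (simp add: prod.remove[OF finite_sphere assms(3)])
  qed
  ultimately show ?thesis using prob_cylinder_below[OF assms(1,2), of ?B] by simp
qed

lemma kernel_ratio_bound: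
  obtains C where "C \<ge> 1" "\<And>x n a a' B. a \<in> Q \<Longrightarrow> a' \<in> Q \<Longrightarrow> kernel x n a B \<le> C * kernel x n a' B"
proof -
  obtain c where c: "c \<ge> 1" "\<And>a a' b. a \<in> Q \<Longrightarrow> a' \<in> Q \<Longrightarrow> b \<in> Q \<Longrightarrow> K a b \<le> c * K a' b"
    using K_ratio_bound by blast
  define C where "C = c ^ (d + 1)"
  have C: "C \<ge> 1" unfolding C_def using c(1) by (rule one_le_power)
  have w: "below_weight x n a t \<le> C * below_weight x n a' t"
    if Q: "a \<in> Q" "a' \<in> Q" and t: "t \<in> conf (below x \<inter> ball n)" for x n a a' t
  proof -
    let ?F = "below x \<inter> ball n"
    let ?k = "\<lambda>a y. K (if parent y = x then a else t (parent y)) (t y)"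
    have k: "?k a y \<le> (if y \<in> children x then c else 1) * ?k a' y" "?k a y > 0" "?k a' y > 0" if y: "y \<in> ?F" for y
    proof -
      have "y \<noteq> root" using y by (auto simp: below_def)
      then have "y \<in> children x \<longleftrightarrow> parent y = x" by (simp add: mem_children_iff)
      then show "?k a y \<le> (if y \<in> children x then c else 1) * ?k a' y" using c(2) Q t y by (auto simp: PiE_iff)
      show "?k a y > 0" "?k a' y > 0" using parent_in_below[OF y] Q t y by (auto intro!: K_pos simp: PiE_iff)
    qed
    have "below_weight x n a t \<le> (\<Prod>y\<in>?F. (if y \<in> children x then c else 1) * ?k a' y)"
      unfolding below_weight_def by (intro prod_mono conjI k less_imp_le)
    also have "\<dots> = c ^ card (?F \<inter> children x) * below_weight x n a' t"
      unfolding below_weight_def prod.distrib by (simp add: prod.If_cases)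
    also have "\<dots> \<le> C * below_weight x n a' t"
      unfolding C_def using below_weight_pos[OF Q(2) t] c(1) card_children_le[of x] card_mono[OF finite_children, of "?F \<inter> children x" x]
      by (intro mult_right_mono power_increasing) auto
    finally show ?thesis .
  qed
  show ?thesis
  proof (rule that)
    show "C * C \<ge> 1" using C mult_mono[of 1 C 1 C] by simp
    fix x n a a' B assume Q: "a \<in> Q" "a' \<in> Q"
    let ?N = "\<lambda>a. \<Sum>t\<in>conf (below x \<inter> ball n). of_bool (t \<in> B) * below_weight x n a t"
    let ?D = "\<lambda>a. \<Sum>t\<in>conf (below x \<inter> ball n). below_weight x n a t"
    have N: "?N a \<le> C * ?N a'"
      unfolding sum_distrib_left using w[OF Q] by (intro sum_mono) auto
    have D: "?D a' \<le> C * ?D a"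
      unfolding sum_distrib_left using w[OF Q(2,1)] by (intro sum_mono) auto
    have pos: "?D a > 0" "?D a' > 0" using below_weight_sum_pos Q by auto
    have "0 \<le> ?N a'" using below_weight_pos[OF Q(2)] by (intro sum_nonneg) (auto intro: less_imp_le)
    then have "?N a * ?D a' \<le> (C * ?N a') * (C * ?D a)"
      using N D pos C by (intro mult_mono) auto
    then show "kernel x n a B \<le> (C * C) * kernel x n a' B"
      unfolding kernel_def using pos by (simp add: field_simps)
  qed
qed

end

section \<open>The zero-one law for tree-indexed Markov fields\<close>

lemma prod_le_exp_minus_sum:
  fixes f :: "'i \<Rightarrow> real"
  assumes "\<And>i. i \<in> I \<Longrightarrow> 0 \<le> f i" "\<And>i. i \<in> I \<Longrightarrow> f i \<le> 1" "finite I"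
  shows "(\<Prod>i\<in>I. f i) \<le> exp (- (\<Sum>i\<in>I. 1 - f i))"
proof -
  have "(\<Prod>i\<in>I. f i) \<le> (\<Prod>i\<in>I. exp (f i - 1))"
    using assms by (intro prod_mono conjI) (auto intro: order_trans[OF _ exp_ge_add_one_self])
  also have "\<dots> = exp (- (\<Sum>i\<in>I. 1 - f i))"
    using assms by (simp add: exp_sum[symmetric] sum_negf[symmetric])
  finally show ?thesis .
qed

lemma exp_gt_imp_le:
  fixes \<epsilon> z :: real
  assumes "1 - 2 * \<epsilon> \<le> exp (- z)" "0 < \<epsilon>" "\<epsilon> \<le> 1/4"
  shows "z \<le> 4 * \<epsilon>"
proof (rule ccontr)
  assume "\<not> ?thesis"
  then have "exp (- z) < exp (- (4 * \<epsilon>))" by simp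
  also have "\<dots> \<le> inverse (1 + 4 * \<epsilon>)"
    unfolding exp_minus using assms exp_ge_add_one_self[of "4 * \<epsilon>"] by (intro le_imp_inverse_le) auto
  also have "\<dots> \<le> 1 - 2 * \<epsilon>"
  proof -
    have "0 \<le> \<epsilon> * (1 - 4 * \<epsilon>)" using assms by (intro mult_nonneg_nonneg) auto
    then have "1 \<le> (1 - 2 * \<epsilon>) * (1 + 4 * \<epsilon>)" by (simp add: algebra_simps)
    then show ?thesis using assms by (simp add: inverse_eq_divide divide_le_eq)
  qed
  finally show False using assms(1) by simp
qed

context tree_markov_field
begin

lemma cylinder_events: "cylinder m s \<in> events"
  by (rule obs_eq_measurable) simp

lemma prob_eq_sum_cylinders:
  assumes "A \<in> events"
  shows "prob A = (\<Sum>s\<in>conf (ball m). prob (A \<inter> cylinder m s))"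
proof -
  have "A = (\<Union>s\<in>conf (ball m). A \<inter> cylinder m s)"
    using obs_in_conf sets.sets_into_space[OF assms] by auto
  then have "prob A = prob (\<Union>s\<in>conf (ball m). A \<inter> cylinder m s)" by simp
  also have "\<dots> = (\<Sum>s\<in>conf (ball m). prob (A \<inter> cylinder m s))"
    using assms cylinder_events
    by (intro finite_measure_finite_Union) (auto simp: disjoint_family_on_def)
  finally show ?thesis .
qed

lemma likely_given_some_cylinder:
  assumes E: "E \<in> sigma_sets (space M) (local_events UNIV)" and "prob E > 0" and \<epsilon>: "0 < \<epsilon>" "\<epsilon> < 1"
  obtains m s where "s \<in> conf (ball m)" "prob (E \<inter> cylinder m s) \<ge> (1 - \<epsilon>) * prob (cylinder m s)"
proof -
  define \<delta> where "\<delta> = \<epsilon> * prob E / 2"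
  have "\<delta> > 0" using assms by (simp add: \<delta>_def)
  then obtain A where A: "A \<in> local_events UNIV" "prob ((E - A) \<union> (A - E)) < \<delta>"
    using approximation_by_algebra[OF algebra_local_events local_events_sets E] by blast
  then obtain F where F: "finite F" "depends_on F A" unfolding local_events_def by blast
  then obtain m where "F \<subseteq> ball m" using finite_subset_ball by blast
  then have dep: "depends_on (ball m) A" using F depends_on_mono by blast
  have ev [measurable]: "A \<in> events" "E \<in> events"
    using A E local_events_sets sets.sigma_sets_subset[OF local_events_sets] by auto
  have "prob E \<le> prob A + prob ((E - A) \<union> (A - E))"
    by (rule order_trans[OF finite_measure_mono measure_Un_le]) auto
  then have PA: "prob A > prob E - \<delta>" using A(2) by simp
  have diff: "prob (A - E) < \<delta>"
    using A(2) by (rule order_le_less_trans[rotated]) (auto intro!: finite_measure_mono)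
  have "\<exists>s\<in>conf (ball m). prob (E \<inter> cylinder m s) \<ge> (1 - \<epsilon>) * prob (cylinder m s)"
  proof (rule ccontr)
    assume "\<not> ?thesis"
    then have less: "prob (E \<inter> cylinder m s) < (1 - \<epsilon>) * prob (cylinder m s)" if "s \<in> conf (ball m)" for s
      using that by force
    have "prob (A \<inter> E) = (\<Sum>s\<in>conf (ball m). prob ((A \<inter> E) \<inter> cylinder m s))"
      by (rule prob_eq_sum_cylinders) auto
    also have "\<dots> \<le> (\<Sum>s\<in>conf (ball m). (1 - \<epsilon>) * prob (A \<inter> cylinder m s))"
    proof (rule sum_mono)
      fix s assume s: "s \<in> conf (ball m)"
      show "prob ((A \<inter> E) \<inter> cylinder m s) \<le> (1 - \<epsilon>) * prob (A \<inter> cylinder m s)"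
      proof (cases "A \<inter> cylinder m s = {}")
        case True
        then have "(A \<inter> E) \<inter> cylinder m s = {}" by blast
        then show ?thesis using True \<epsilon> by simp
      next
        case False
        then obtain \<omega> where \<omega>: "\<omega> \<in> A" "obs (ball m) \<omega> = s" by blast
        have "\<omega>' \<in> A" if "\<omega>' \<in> cylinder m s" for \<omega>'
        proof -
          have "\<forall>v\<in>ball m. Y v \<omega> = Y v \<omega>'" using that \<omega>(2) by (simp flip: obs_eq_iff)
          then show ?thesis using dep \<omega>(1) that unfolding depends_on_def by blast
        qed
        then have "A \<inter> cylinder m s = cylinder m s" "(A \<inter> E) \<inter> cylinder m s = E \<inter> cylinder m s"
          by blast+
        then show ?thesis using less[OF s] by simp
      qed
    qed
    also have "\<dots> = (1 - \<epsilon>) * prob A"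
      unfolding sum_distrib_left[symmetric] by (simp add: prob_eq_sum_cylinders[OF ev(1), of m])
    finally have "\<epsilon> * prob A \<le> prob A - prob (A \<inter> E)" by (simp add: algebra_simps)
    also have "\<dots> = prob (A - E)" by (subst finite_measure_Diff') auto
    finally have "\<epsilon> * prob A < \<delta>" using diff by simp
    moreover have "\<epsilon> * (prob E - \<delta>) \<le> \<epsilon> * prob A" using PA \<epsilon> by (intro mult_left_mono) auto
    moreover have "\<delta> \<le> \<epsilon> * (prob E - \<delta>)"
    proof -
      have "\<delta> \<le> prob E / 2" using \<epsilon> assms(2) by (simp add: \<delta>_def)
      then have "\<epsilon> * (prob E / 2) \<le> \<epsilon> * (prob E - \<delta>)" using \<epsilon> by (intro mult_left_mono) auto
      then show ?thesis by (simp add: \<delta>_def)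
    qed
    ultimately show False by linarith
  qed
  then show ?thesis using that by blast
qed

lemma cylinder_comparison:
  obtains C where "C \<ge> 0"
    "\<And>m E \<epsilon> s s'. (\<And>x. x \<in> sphere m \<Longrightarrow> E x \<in> sigma_sets (space M) (local_events (below x))) \<Longrightarrow>
      0 < \<epsilon> \<Longrightarrow> \<epsilon> \<le> 1/4 \<Longrightarrow> s \<in> conf (ball m) \<Longrightarrow> s' \<in> conf (ball m) \<Longrightarrow>
      prob ((\<Inter>x\<in>sphere m. E x) \<inter> cylinder m s) \<ge> (1 - \<epsilon>) * prob (cylinder m s) \<Longrightarrow>
      prob (cylinder m s' - (\<Inter>x\<in>sphere m. E x)) \<le> C * \<epsilon> * prob (cylinder m s')"
proof -
  obtain C where C: "C \<ge> 1" "\<And>x n a a' B. a \<in> Q \<Longrightarrow> a' \<in> Q \<Longrightarrow> kernel x n a B \<le> C * kernel x n a' B"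
    using kernel_ratio_bound by blast
  show ?thesis
  proof (rule that)
    show "4 * C + 1 \<ge> 0" using C by simp
    fix m \<epsilon> s s' and E :: "'v \<Rightarrow> 'w set"
    assume E: "\<And>x. x \<in> sphere m \<Longrightarrow> E x \<in> sigma_sets (space M) (local_events (below x))"
      and \<epsilon>: "0 < \<epsilon>" "\<epsilon> \<le> 1/4" and s: "s \<in> conf (ball m)" and s': "s' \<in> conf (ball m)"
      and likely: "prob ((\<Inter>x\<in>sphere m. E x) \<inter> cylinder m s) \<ge> (1 - \<epsilon>) * prob (cylinder m s)"
    let ?c = "real (card (sphere m))"
    define \<delta> where "\<delta> = \<epsilon> * min (prob (cylinder m s)) (prob (cylinder m s')) / (?c + 1)"
    have pos: "prob (cylinder m s) > 0" "prob (cylinder m s') > 0"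
      using prob_cylinder_pos s s' by blast+
    then have \<delta>: "\<delta> > 0" using \<epsilon> by (simp add: \<delta>_def)
    have "?c * \<delta> \<le> (?c + 1) * \<delta>" using \<delta> by simp
    also have "\<dots> = \<epsilon> * min (prob (cylinder m s)) (prob (cylinder m s'))"
    proof -
      have "?c + 1 \<noteq> 0" by linarith
      then show ?thesis unfolding \<delta>_def by simp
    qed
    finally have c\<delta>': "?c * \<delta> \<le> \<epsilon> * min (prob (cylinder m s)) (prob (cylinder m s'))" .
    have c\<delta>: "?c * \<delta> \<le> \<epsilon> * prob (cylinder m s)" "?c * \<delta> \<le> \<epsilon> * prob (cylinder m s')"
      using c\<delta>' \<epsilon>(1) by (auto intro: order_trans mult_left_mono)
    have "\<exists>A\<in>local_events (below x). prob ((E x - A) \<union> (A - E x)) < \<delta>" if "x \<in> sphere m" for x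
      using approximation_by_algebra[OF algebra_local_events local_events_sets E[OF that] \<delta>] .
    then obtain A where A: "\<And>x. x \<in> sphere m \<Longrightarrow> A x \<in> local_events (below x)"
      "\<And>x. x \<in> sphere m \<Longrightarrow> prob ((E x - A x) \<union> (A x - E x)) < \<delta>" by metis
    have "\<exists>F. finite F \<and> F \<subseteq> below x \<and> depends_on F (A x)" if "x \<in> sphere m" for x
      using A(1)[OF that] unfolding local_events_def by blast
    then obtain F where F: "\<And>x. x \<in> sphere m \<Longrightarrow> finite (F x) \<and> F x \<subseteq> below x \<and> depends_on (F x) (A x)"
      by metis
    obtain n' where n': "(\<Union>x\<in>sphere m. F x) \<subseteq> ball n'"
      using finite_subset_ball[of "\<Union>x\<in>sphere m. F x"] F by auto
    define n where "n = max m n'"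
    have n: "m \<le> n" "ball n' \<subseteq> ball n" by (auto simp: n_def)
    define B where "B x = obs (below x \<inter> ball n) ` A x" for x
    have A_eq: "A x = {\<omega> \<in> space M. obs (below x \<inter> ball n) \<omega> \<in> B x}" if "x \<in> sphere m" for x
    proof -
      have "F x \<subseteq> below x \<inter> ball n" using F[OF that] n' n that by blast
      then show ?thesis unfolding B_def using F[OF that] depends_on_mono depends_on_eq by blast
    qed
    have A_ev: "A x \<in> events" and E_ev: "E x \<in> events" if "x \<in> sphere m" for x
      using A(1)[OF that] E[OF that] local_events_sets sets.sigma_sets_subset[OF local_events_sets] by blast+
    have AE: "prob (A x - E x) \<le> \<delta>" "prob (E x - A x) \<le> \<delta>" if "x \<in> sphere m" for x
      using A(2)[OF that] A_ev[OF that] E_ev[OF that]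
      by (auto intro!: order_trans[OF finite_measure_mono less_imp_le[OF A(2)[OF that]]])
    have sQ: "s x \<in> Q" "s' x \<in> Q" if "x \<in> sphere m" for x
      using that s s' by (auto simp: PiE_iff)
    let ?k = "\<lambda>x. kernel x n (s x) (B x)"
    note [measurable] = A_ev E_ev cylinder_events
    have UN: "(\<Union>x\<in>sphere m. f x) \<in> events" "prob (\<Union>x\<in>sphere m. f x) \<le> (\<Sum>x\<in>sphere m. prob (f x))"
      if "\<And>x. x \<in> sphere m \<Longrightarrow> f x \<in> events" for f
      using that by (auto intro!: measure_UNION_le sets.finite_UN)
    have EA: "(\<Union>x\<in>sphere m. E x - A x) \<in> events" "prob (\<Union>x\<in>sphere m. E x - A x) \<le> (\<Sum>x\<in>sphere m. \<delta>)"
      using UN(1)[of "\<lambda>x. E x - A x"] A_ev E_ev AE(2)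
      by (auto intro!: order_trans[OF UN(2)[of "\<lambda>x. E x - A x"]] sum_mono simp del: sum_constant)
    have AE': "(\<Union>x\<in>sphere m. A x - E x) \<in> events" "prob (\<Union>x\<in>sphere m. A x - E x) \<le> (\<Sum>x\<in>sphere m. \<delta>)"
      using UN(1)[of "\<lambda>x. A x - E x"] A_ev E_ev AE(1)
      by (auto intro!: order_trans[OF UN(2)[of "\<lambda>x. A x - E x"]] sum_mono simp del: sum_constant)
    have SA: "(\<Union>x\<in>sphere m. cylinder m s' - A x) \<in> events"
      "prob (\<Union>x\<in>sphere m. cylinder m s' - A x) \<le> (\<Sum>x\<in>sphere m. prob (cylinder m s' - A x))"
      using UN[of "\<lambda>x. cylinder m s' - A x"] A_ev cylinder_events by (simp_all add: sets.Diff)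
    have eq: "cylinder m s \<inter> {\<omega> \<in> space M. \<forall>x\<in>sphere m. obs (below x \<inter> ball n) \<omega> \<in> B x}
        = cylinder m s \<inter> (space M - (\<Union>x\<in>sphere m. space M - A x))"
      using A_eq by auto
    have ev: "cylinder m s \<inter> {\<omega> \<in> space M. \<forall>x\<in>sphere m. obs (below x \<inter> ball n) \<omega> \<in> B x} \<in> events"
      unfolding eq using A_ev cylinder_events by (intro sets.Int sets.Diff sets.finite_UN) auto
    have "(1 - \<epsilon>) * prob (cylinder m s) \<le> prob ((\<Inter>x\<in>sphere m. E x) \<inter> cylinder m s)" by (rule likely)
    also have "\<dots> \<le> prob ((cylinder m s \<inter> {\<omega> \<in> space M. \<forall>x\<in>sphere m. obs (below x \<inter> ball n) \<omega> \<in> B x})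
        \<union> (\<Union>x\<in>sphere m. E x - A x))"
    proof (rule finite_measure_mono)
      show "(\<Inter>x\<in>sphere m. E x) \<inter> cylinder m s \<subseteq>
          cylinder m s \<inter> {\<omega> \<in> space M. \<forall>x\<in>sphere m. obs (below x \<inter> ball n) \<omega> \<in> B x} \<union> (\<Union>x\<in>sphere m. E x - A x)"
        unfolding eq by blast
    qed (intro sets.Un ev EA)
    also have "\<dots> \<le> prob (cylinder m s \<inter> {\<omega> \<in> space M. \<forall>x\<in>sphere m. obs (below x \<inter> ball n) \<omega> \<in> B x})
        + prob (\<Union>x\<in>sphere m. E x - A x)"
      by (intro measure_Un_le ev EA)
    also note EA(2)
    also have "prob (cylinder m s \<inter> {\<omega> \<in> space M. \<forall>x\<in>sphere m. obs (below x \<inter> ball n) \<omega> \<in> B x})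
        = prob (cylinder m s) * (\<Prod>x\<in>sphere m. ?k x)"
      by (rule prob_cylinder_below[OF n(1) s])
    finally have "(1 - \<epsilon>) * prob (cylinder m s) \<le> prob (cylinder m s) * (\<Prod>x\<in>sphere m. ?k x) + \<epsilon> * prob (cylinder m s)"
      using c\<delta>(1) by simp
    then have "prob (cylinder m s) * (1 - 2 * \<epsilon>) \<le> prob (cylinder m s) * (\<Prod>x\<in>sphere m. ?k x)"
      by (simp add: algebra_simps)
    then have "1 - 2 * \<epsilon> \<le> (\<Prod>x\<in>sphere m. ?k x)" using pos(1) by simp
    also have "\<dots> \<le> exp (- (\<Sum>x\<in>sphere m. 1 - ?k x))"
      using sQ by (intro prod_le_exp_minus_sum kernel_nonneg kernel_le_1) auto
    finally have sum4: "(\<Sum>x\<in>sphere m. 1 - ?k x) \<le> 4 * \<epsilon>" using \<epsilon> by (rule exp_gt_imp_le)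
    have cA: "prob (cylinder m s' - A x) \<le> C * (1 - ?k x) * prob (cylinder m s')" if x: "x \<in> sphere m" for x
    proof -
      have "cylinder m s' - A x = cylinder m s' \<inter> {\<omega> \<in> space M. obs (below x \<inter> ball n) \<omega> \<in> - B x}"
        using A_eq[OF x] by auto
      then have "prob (cylinder m s' - A x) = prob (cylinder m s') * kernel x n (s' x) (- B x)"
        using prob_cylinder_below_single[OF n(1) s' x, of "- B x"] by (simp only:)
      also have "\<dots> \<le> prob (cylinder m s') * (C * kernel x n (s x) (- B x))"
        using C(2) sQ[OF x] by (intro mult_left_mono) auto
      finally show ?thesis using kernel_compl[OF sQ(1)[OF x]] by (simp add: mult_ac)
    qed
    have "prob (cylinder m s' - (\<Inter>x\<in>sphere m. E x)) \<le>
        prob ((\<Union>x\<in>sphere m. cylinder m s' - A x) \<union> (\<Union>x\<in>sphere m. A x - E x))"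
      by (intro finite_measure_mono sets.Un SA AE') blast
    also have "\<dots> \<le> prob (\<Union>x\<in>sphere m. cylinder m s' - A x) + prob (\<Union>x\<in>sphere m. A x - E x)"
      by (intro measure_Un_le SA AE')
    also have "\<dots> \<le> (\<Sum>x\<in>sphere m. C * (1 - ?k x) * prob (cylinder m s')) + (\<Sum>x\<in>sphere m. \<delta>)"
      by (intro add_mono AE' order_trans[OF SA(2)] sum_mono cA)
    also have "(\<Sum>x\<in>sphere m. C * (1 - ?k x) * prob (cylinder m s')) =
        C * (\<Sum>x\<in>sphere m. 1 - ?k x) * prob (cylinder m s')"
      by (simp add: sum_distrib_left sum_distrib_right)
    also have "\<dots> \<le> C * (4 * \<epsilon>) * prob (cylinder m s')"
      using sum4 C(1) by (intro mult_right_mono mult_left_mono) auto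
    also have "(\<Sum>x\<in>sphere m. \<delta>) \<le> \<epsilon> * prob (cylinder m s')" using c\<delta>(2) by simp
    finally show "prob (cylinder m s' - (\<Inter>x\<in>sphere m. E x)) \<le> (4 * C + 1) * \<epsilon> * prob (cylinder m s')"
      by (simp add: algebra_simps)
  qed
qed

theorem zero_one_law:
  assumes E_sets: "\<And>x. E x \<in> sigma_sets (space M) (local_events (below x))"
    and A: "\<And>m. A = space M \<inter> (\<Inter>x\<in>sphere m. E x)"
  shows "A \<in> events \<and> prob A \<in> {0, 1}"
proof -
  have "E root \<subseteq> space M"
    using E_sets[of root] sets.sigma_sets_subset[OF local_events_sets] sets.sets_into_space by blast
  then have AE: "A = E root" using A[of 0] by auto
  have ev: "A \<in> events"
    using E_sets[of root] sets.sigma_sets_subset[OF local_events_sets] unfolding AE by blast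
  have A_sigma: "A \<in> sigma_sets (space M) (local_events UNIV)"
    using E_sets[of root] sigma_sets_mono'[OF local_events_mono[OF subset_UNIV]] unfolding AE by blast
  obtain C where C: "C \<ge> 0"
    "\<And>m E \<epsilon> s s'. (\<And>x. x \<in> sphere m \<Longrightarrow> E x \<in> sigma_sets (space M) (local_events (below x))) \<Longrightarrow>
      0 < \<epsilon> \<Longrightarrow> \<epsilon> \<le> 1/4 \<Longrightarrow> s \<in> conf (ball m) \<Longrightarrow> s' \<in> conf (ball m) \<Longrightarrow>
      prob ((\<Inter>x\<in>sphere m. E x) \<inter> cylinder m s) \<ge> (1 - \<epsilon>) * prob (cylinder m s) \<Longrightarrow>
      prob (cylinder m s' - (\<Inter>x\<in>sphere m. E x)) \<le> C * \<epsilon> * prob (cylinder m s')"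
    using cylinder_comparison by blast
  have "prob A = 1" if "prob A > 0"
  proof -
    have bound: "prob (space M - A) \<le> C * \<epsilon>" if \<epsilon>: "0 < \<epsilon>" "\<epsilon> \<le> 1/4" for \<epsilon>
    proof -
      have "\<epsilon> < 1" using \<epsilon> by simp
      obtain m s where s: "s \<in> conf (ball m)" "prob (A \<inter> cylinder m s) \<ge> (1 - \<epsilon>) * prob (cylinder m s)"
        using likely_given_some_cylinder[OF A_sigma \<open>prob A > 0\<close> \<epsilon>(1) \<open>\<epsilon> < 1\<close>] by blast
      have "prob (space M - A) = (\<Sum>s'\<in>conf (ball m). prob ((space M - A) \<inter> cylinder m s'))"
        using ev by (intro prob_eq_sum_cylinders) auto
      also have "\<dots> \<le> (\<Sum>s'\<in>conf (ball m). C * \<epsilon> * prob (cylinder m s'))"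
      proof (rule sum_mono)
        fix s' assume s': "s' \<in> conf (ball m)"
        have "(space M - A) \<inter> cylinder m s' = cylinder m s' - A" by auto
        moreover have "cylinder m s' - (\<Inter>x\<in>sphere m. E x) = cylinder m s' - A"
          "(\<Inter>x\<in>sphere m. E x) \<inter> cylinder m s = A \<inter> cylinder m s"
          using A[of m] by auto
        ultimately show "prob ((space M - A) \<inter> cylinder m s') \<le> C * \<epsilon> * prob (cylinder m s')"
          using C(2)[of m E \<epsilon> s s'] E_sets \<epsilon> s s' by simp
      qed
      also have "\<dots> = C * \<epsilon> * (\<Sum>s'\<in>conf (ball m). prob (space M \<inter> cylinder m s'))"
        by (simp add: sum_distrib_left Int_absorb1 Collect_restrict)
      also have "\<dots> = C * \<epsilon>"
        by (subst prob_eq_sum_cylinders[symmetric]) (auto simp: prob_space)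
      finally show ?thesis .
    qed
    have "prob (space M - A) \<le> 0 + e" if "e > 0" for e
    proof -
      have "C * min (1/4) (e / (C + 1)) \<le> C * (e / (C + 1))" using C(1) by (intro mult_left_mono) auto
      also have "\<dots> \<le> e" using C(1) that by (simp add: field_simps)
      finally have "C * min (1/4) (e / (C + 1)) \<le> e" .
      moreover have "0 < min (1/4) (e / (C + 1))" using C(1) that by simp
      moreover have "min (1/4) (e / (C + 1)) \<le> 1/4" by (rule min.cobounded1)
      ultimately show ?thesis using bound[of "min (1/4) (e / (C + 1))"] by linarith
    qed
    then have "prob (space M - A) \<le> 0" by (rule field_le_epsilon)
    then show ?thesis using prob_compl[OF ev] prob_le_1[of A] by simp
  qed
  then show ?thesis using ev measure_nonneg[of M A] by (cases "prob A = 0") auto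
qed

end

section \<open>Almost sure convergence of finite-volume marginals\<close>

context tree_spin_system
begin

lemma partial_sum_cong:
  assumes "\<And>v. v \<in> sphere (Suc n) \<Longrightarrow> \<eta> v = \<eta>' v"
  shows "partial_sum n m \<eta> s = partial_sum n m \<eta>' s"
  unfolding partial_sum_def using assms
  by (intro sum.cong weight_cong refl) (auto simp: override_on_def le_Suc_eq)

lemma partition_sum_cong:
  assumes "\<And>v. v \<in> sphere (Suc n) \<Longrightarrow> \<eta> v = \<eta>' v"
  shows "partition_sum n \<eta> = partition_sum n \<eta>'"
  unfolding partition_sum_def using assms
  by (intro sum.cong weight_cong refl) (auto simp: override_on_def le_Suc_eq)

lemma marginal_cong:
  assumes "\<And>v. v \<in> sphere (Suc n) \<Longrightarrow> \<eta> v = \<eta>' v"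
  shows "marginal n m \<eta> s = marginal n m \<eta>' s"
  unfolding marginal_def using partial_sum_cong[OF assms] partition_sum_cong[OF assms] by simp

lemma partition_sum_restrict:
  assumes "m \<le> n" "s \<in> conf (ball m)"
  shows "(\<Sum>\<sigma>\<in>conf (ball n). of_bool (restrict \<sigma> (ball m) = s) * weight (Suc n) (override_on \<eta> \<sigma> (ball n)))
    = partial_sum n m \<eta> s"
proof -
  let ?g = "\<lambda>\<sigma>. of_bool (restrict \<sigma> (ball m) = s) * weight (Suc n) (override_on \<eta> \<sigma> (ball n))"
  have r: "restrict (override_on t s' (ball m)) (ball m) = s'" if "s' \<in> conf (ball m)" for s' t
    using that by (auto simp: fun_eq_iff override_on_def PiE_iff extensional_def)
  have "ball n = ball m \<union> (ball n - ball m)" using assms(1) by auto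
  then have "(\<Sum>\<sigma>\<in>conf (ball n). ?g \<sigma>) = (\<Sum>\<sigma>\<in>conf (ball m \<union> (ball n - ball m)). ?g \<sigma>)" by simp
  also have "\<dots> = (\<Sum>s'\<in>conf (ball m). \<Sum>t\<in>conf (ball n - ball m). ?g (override_on t s' (ball m)))"
    by (rule sum_PiE_Un_disjoint[where F = ?g]) auto
  also have "\<dots> = (\<Sum>s'\<in>conf (ball m). if s' = s then partial_sum n m \<eta> s else 0)"
    unfolding partial_sum_def by (intro sum.cong refl) (simp add: r)
  also have "\<dots> = partial_sum n m \<eta> s" using assms(2) by simp
  finally show ?thesis .
qed

text \<open>The consistency (DLR) identity: \<open>marginal n m t s\<close> is the conditional probability of the
  configuration \<open>s\<close> on \<open>ball m\<close> given the spins outside \<open>ball n\<close>.\<close>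

lemma marginal_conditional:
  fixes f :: "('v \<Rightarrow> 's) \<Rightarrow> real"
  assumes "m \<le> n" "n < N" "s \<in> conf (ball m)"
    and f: "\<And>t t'. (\<And>v. v \<in> ball N - ball n \<Longrightarrow> t v = t' v) \<Longrightarrow> f t = f t'"
  shows "(\<Sum>t\<in>conf (ball N). weight N t * ((marginal n m t s - of_bool (restrict t (ball m) = s)) * f t)) = 0"
proof -
  let ?g = "\<lambda>t. weight N t * ((marginal n m t s - of_bool (restrict t (ball m) = s)) * f t)"
  have "ball N = ball n \<union> (ball N - ball n)" using assms(2) by auto
  then have "(\<Sum>t\<in>conf (ball N). ?g t) = (\<Sum>t\<in>conf (ball n \<union> (ball N - ball n)). ?g t)" by simp
  also have "\<dots> = (\<Sum>\<sigma>\<in>conf (ball n). \<Sum>\<tau>\<in>conf (ball N - ball n). ?g (override_on \<tau> \<sigma> (ball n)))"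
    by (rule sum_PiE_Un_disjoint[where F = ?g]) auto
  also have "\<dots> = (\<Sum>\<tau>\<in>conf (ball N - ball n). \<Sum>\<sigma>\<in>conf (ball n). ?g (override_on \<tau> \<sigma> (ball n)))"
    by (rule sum.swap)
  also have "\<dots> = (\<Sum>\<tau>\<in>conf (ball N - ball n). 0)"
  proof (rule sum.cong[OF refl])
    fix \<tau> assume \<tau>: "\<tau> \<in> conf (ball N - ball n)"
    define R where "R = (\<Prod>y\<in>ball N - ball (Suc n). K (\<tau> (parent y)) (\<tau> y))"
    have "partition_sum n \<tau> > 0"
      unfolding partition_sum_def using conf_nonempty \<tau> assms(2)
      by (intro sum_pos weight_pos) (auto simp: override_on_def PiE_iff)
    then have pm: "partition_sum n \<tau> * marginal n m \<tau> s = partial_sum n m \<tau> s"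
      by (simp add: marginal_def)
    have "?g (override_on \<tau> \<sigma> (ball n)) = R * f \<tau> *
        (weight (Suc n) (override_on \<tau> \<sigma> (ball n)) * marginal n m \<tau> s
        - of_bool (restrict \<sigma> (ball m) = s) * weight (Suc n) (override_on \<tau> \<sigma> (ball n)))" for \<sigma>
    proof -
      have "(\<Prod>y\<in>ball N - ball (Suc n). K (override_on \<tau> \<sigma> (ball n) (parent y)) (override_on \<tau> \<sigma> (ball n) y)) = R"
        unfolding R_def
      proof (intro prod.cong refl)
        fix y assume y: "y \<in> ball N - ball (Suc n)"
        then have "parent y \<notin> ball n" using lev_parent[of y] by (cases "y = root") auto
        then show "K (override_on \<tau> \<sigma> (ball n) (parent y)) (override_on \<tau> \<sigma> (ball n) y) = K (\<tau> (parent y)) (\<tau> y)"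
          using y by (simp add: override_on_def)
      qed
      then have "weight N (override_on \<tau> \<sigma> (ball n)) = weight (Suc n) (override_on \<tau> \<sigma> (ball n)) * R"
        using weight_diff[of "Suc n" N] assms(2) by simp
      moreover have "marginal n m (override_on \<tau> \<sigma> (ball n)) s = marginal n m \<tau> s"
        by (rule marginal_cong) (simp add: override_on_def)
      moreover have "f (override_on \<tau> \<sigma> (ball n)) = f \<tau>"
        by (rule f) (simp add: override_on_def)
      moreover have "restrict (override_on \<tau> \<sigma> (ball n)) (ball m) = restrict \<sigma> (ball m)"
        using assms(1) by (auto simp: fun_eq_iff override_on_def)
      ultimately show ?thesis by (simp add: algebra_simps)
    qed
    then have "(\<Sum>\<sigma>\<in>conf (ball n). ?g (override_on \<tau> \<sigma> (ball n))) = R * f \<tau> *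
        (partition_sum n \<tau> * marginal n m \<tau> s - partial_sum n m \<tau> s)"
      unfolding partition_sum_restrict[OF assms(1,3), symmetric] partition_sum_def
      by (simp only: sum_distrib_left[symmetric] sum_distrib_right sum_subtractf)
    then show "(\<Sum>\<sigma>\<in>conf (ball n). ?g (override_on \<tau> \<sigma> (ball n))) = 0" using pm by simp
  qed
  finally show ?thesis by simp
qed

lemma marginal_bounds:
  assumes "range \<eta> \<subseteq> Q" "s \<in> conf (ball m)"
  shows "0 \<le> marginal (k + m) m \<eta> s" "marginal (k + m) m \<eta> s \<le> 1"
proof -
  have "partial_sum (k + m) m \<eta> s \<le> partition_sum (k + m) \<eta>"
    unfolding partition_sum_eq[of m "k + m", OF le_add2]
    by (rule member_le_sum[OF assms(2)]) (use partial_sum_pos[OF assms(1)] in \<open>auto intro: less_imp_le\<close>)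
  then show "0 \<le> marginal (k + m) m \<eta> s" "marginal (k + m) m \<eta> s \<le> 1"
    unfolding marginal_def using partial_sum_pos[OF assms, of k] partition_sum_pos[OF assms(1), of k m] by auto
qed

end

context tree_markov_field
begin

lemma marginal_obs:
  "sphere (Suc n) \<subseteq> F \<Longrightarrow> marginal n m (obs F \<omega>) s = marginal n m (\<lambda>v. Y v \<omega>) s"
  by (rule marginal_cong) (auto simp: obs_def)

lemma AE_marginal_convergent:
  assumes s: "s \<in> conf (ball m)"
  shows "AE \<omega> in M. convergent (\<lambda>k. marginal (k + m) m (\<lambda>v. Y v \<omega>) s)"
proof (rule reverse_martingale_AE_convergent)
  let ?X = "\<lambda>k \<omega>. marginal (k + m) m (\<lambda>v. Y v \<omega>) s"
  show "?X k \<in> borel_measurable M" for k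
    using borel_measurable_obs[of "sphere (Suc (k + m))" "\<lambda>t. marginal (k + m) m t s"]
    by (simp add: marginal_obs)
  show "\<bar>?X k \<omega>\<bar> \<le> 1" if "\<omega> \<in> space M" for k \<omega>
  proof -
    have "range (\<lambda>v. Y v \<omega>) \<subseteq> Q" using Y_in_Q[OF that] by auto
    from marginal_bounds[OF this s, of k] show ?thesis by simp
  qed
  fix k n N :: nat and g :: "(nat \<Rightarrow> real) \<Rightarrow> real"
  assume kn: "k \<le> n" "n \<le> N"
  let ?N = "Suc (N + m)"
  let ?h = "\<lambda>t. g (\<lambda>j\<in>{n..N}. marginal (j + m) m t s)"
  let ?d = "\<lambda>j t. marginal (j + m) m t s - of_bool (restrict t (ball m) = s)"
  have zero: "(\<Sum>t\<in>conf (ball ?N). weight ?N t * (?d j t * ?h t)) = 0" if j: "j \<le> n" for j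
  proof (rule marginal_conditional)
    fix t t' :: "'v \<Rightarrow> 's" assume eq: "\<And>v. v \<in> ball ?N - ball (j + m) \<Longrightarrow> t v = t' v"
    have "marginal (i + m) m t s = marginal (i + m) m t' s" if "i \<in> {n..N}" for i
      using that j by (intro marginal_cong eq) auto
    then show "?h t = ?h t'" by (intro arg_cong[where f = g] restrict_ext) auto
  qed (use s j kn in auto)
  have "expectation (\<lambda>\<omega>. (?X k \<omega> - ?X n \<omega>) * g (\<lambda>j\<in>{n..N}. ?X j \<omega>)) =
      expectation (\<lambda>\<omega>. (\<lambda>t. (?d k t - ?d n t) * ?h t) (obs (ball ?N) \<omega>))"
  proof (rule Bochner_Integration.integral_cong[OF refl])
    fix \<omega>
    have X: "?X j \<omega> = marginal (j + m) m (obs (ball ?N) \<omega>) s" if "j \<le> N" for j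
      using that by (intro marginal_obs[symmetric]) auto
    have "(\<lambda>j\<in>{n..N}. ?X j \<omega>) = (\<lambda>j\<in>{n..N}. marginal (j + m) m (obs (ball ?N) \<omega>) s)"
      by (intro restrict_ext X) auto
    then show "(?X k \<omega> - ?X n \<omega>) * g (\<lambda>j\<in>{n..N}. ?X j \<omega>) = (\<lambda>t. (?d k t - ?d n t) * ?h t) (obs (ball ?N) \<omega>)"
      using X[of k] X[of n] kn by simp
  qed
  also have "\<dots> = (\<Sum>t\<in>conf (ball ?N). weight ?N t * ((?d k t - ?d n t) * ?h t)) / Z ?N"
    by (rule expectation_obs)
  also have "(\<Sum>t\<in>conf (ball ?N). weight ?N t * ((?d k t - ?d n t) * ?h t)) =
      (\<Sum>t\<in>conf (ball ?N). weight ?N t * (?d k t * ?h t)) - (\<Sum>t\<in>conf (ball ?N). weight ?N t * (?d n t * ?h t))"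
    unfolding sum_subtractf[symmetric] by (intro sum.cong refl) (simp only: left_diff_distrib right_diff_distrib)
  also have "\<dots> = 0" using zero kn by simp
  also have "0 / Z ?N = 0" by simp
  finally show "expectation (\<lambda>\<omega>. (?X k \<omega> - ?X n \<omega>) * g (\<lambda>j\<in>{n..N}. ?X j \<omega>)) = 0" .
qed

lemma AE_all_marginals_convergent:
  "AE \<omega> in M. \<forall>m. \<forall>s\<in>conf (ball m). convergent (\<lambda>k. marginal (k + m) m (\<lambda>v. Y v \<omega>) s)"
  unfolding AE_all_countable
  by (intro allI AE_finite_allI AE_marginal_convergent) auto

lemma borel_measurable_local:
  fixes f :: "'w \<Rightarrow> real"
  assumes "finite F" "F \<subseteq> D"
    and f: "\<And>\<omega> \<omega>'. \<omega> \<in> space M \<Longrightarrow> \<omega>' \<in> space M \<Longrightarrow> (\<And>v. v \<in> F \<Longrightarrow> Y v \<omega> = Y v \<omega>') \<Longrightarrow> f \<omega> = f \<omega>'"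
  shows "f \<in> borel_measurable (sigma (space M) (local_events D))"
proof (rule measurableI)
  have sub: "local_events D \<subseteq> Pow (space M)" by (auto simp: local_events_def depends_on_def)
  fix S :: "real set"
  have "depends_on F (f -` S \<inter> space M)"
    unfolding depends_on_def
  proof (intro conjI ballI impI)
    fix \<omega> \<omega>' assume \<omega>: "\<omega> \<in> f -` S \<inter> space M" "\<omega>' \<in> space M" "\<forall>v\<in>F. Y v \<omega> = Y v \<omega>'"
    then have "f \<omega> = f \<omega>'" by (intro f) auto
    then show "\<omega>' \<in> f -` S \<inter> space M" using \<omega> by simp
  qed simp
  then have "f -` S \<inter> space M \<in> local_events D" using assms(1,2) by (auto simp: local_events_def)
  then show "f -` S \<inter> space (sigma (space M) (local_events D)) \<in> sets (sigma (space M) (local_events D))"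
    using sub by auto
qed simp

end

section \<open>Limit states of the Potts model\<close>

lemma projective_family_count_space_nat_limit:
  fixes P :: "'i set \<Rightarrow> ('i \<Rightarrow> nat) measure" and Q :: "nat set"
  assumes "projective_family UNIV P (\<lambda>_. count_space Q)"
  obtains \<nu> where "prob_space \<nu>" "sets \<nu> = sets (PiM UNIV (\<lambda>_. count_space Q))"
    "\<And>J X. finite J \<Longrightarrow> X \<in> sets (PiM J (\<lambda>_. count_space Q)) \<Longrightarrow>
      emeasure \<nu> (prod_emb UNIV (\<lambda>_. count_space Q) J X) = emeasure (P J) X"
proof -
  let ?C = "\<lambda>J. PiM J (\<lambda>_. count_space Q) :: ('i \<Rightarrow> nat) measure"
  let ?B = "\<lambda>J. PiM J (\<lambda>_. borel) :: ('i \<Rightarrow> real) measure"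
  interpret R: projective_family UNIV P "\<lambda>_. count_space Q" by fact
  obtain q0 where q0: "q0 \<in> Q" using R.not_empty_M[of undefined] by auto
  define e where "e J \<omega> = (\<lambda>i\<in>J. real (\<omega> i))" for J :: "'i set" and \<omega>
  define P' where "P' J = distr (P J) (?B J) (e J)" for J
  have em: "e J \<in> measurable (?C J) (?B J)" for J
    unfolding e_def by (intro measurable_restrict measurable_compose[OF measurable_component_singleton]) auto
  have em' [measurable]: "e J \<in> measurable (P J) (?B J)" if "finite J" for J
    using em measurable_cong_sets[OF R.sets_P[OF that] refl] by auto
  interpret L: polish_projective UNIV P'
  proof (intro polish_projective.intro projective_family.intro)
    fix J H :: "'i set" assume JH: "J \<subseteq> H" "finite H"
    then have "finite J" by (rule finite_subset)
    have "P' J = distr (distr (P H) (?C J) (\<lambda>f. restrict f J)) (?B J) (e J)"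
      unfolding P'_def by (subst R.P[OF JH]) auto
    also have "\<dots> = distr (P H) (?B J) (e J \<circ> (\<lambda>f. restrict f J))"
    proof (rule distr_distr[OF em])
      show "(\<lambda>f. restrict f J) \<in> measurable (P H) (?C J)"
        using measurable_restrict_subset[OF JH(1)] measurable_cong_sets[OF R.sets_P[OF JH(2)] refl] by auto
    qed
    also have "\<dots> = distr (P H) (?B J) ((\<lambda>f. restrict f J) \<circ> e H)"
      using JH(1) by (intro distr_cong refl) (auto simp: e_def fun_eq_iff restrict_def)
    also have "\<dots> = distr (P' H) (?B J) (\<lambda>f. restrict f J)"
      unfolding P'_def using JH by (intro distr_distr[symmetric] measurable_restrict_subset em')
    finally show "P' J = distr (P' H) (?B J) (\<lambda>f. restrict f J)" .
  next
    fix J :: "'i set" assume "finite J"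
    then show "prob_space (P' J)"
      unfolding P'_def using R.prob_space_P[of J] by (intro prob_space.prob_space_distr em') auto
  qed
  define g where "g r = (if r \<in> real ` Q then nat \<lfloor>r\<rfloor> else q0)" for r :: real
  have g_real: "g (real n) = n" if "n \<in> Q" for n using that by (simp add: g_def)
  have g_meas: "g \<in> borel \<rightarrow>\<^sub>M count_space Q"
  proof (subst measurable_count_space_eq2_countable, intro conjI ballI)
    show "g \<in> space borel \<rightarrow> Q" using q0 by (auto simp: g_def)
    fix a assume "a \<in> Q"
    then have "g -` {a} \<inter> space borel = (if a = q0 then {real a} \<union> (UNIV - real ` Q) else {real a})"
      using q0 by (auto simp: g_def split: if_splits)
    moreover have "real ` Q \<in> sets borel"
      by (rule sets.countable) (auto intro: countable_subset[OF subset_UNIV])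
    ultimately show "g -` {a} \<inter> space borel \<in> sets borel" by auto
  qed
  have g_comp: "(\<lambda>\<omega>. g (\<omega> i)) \<in> ?B J \<rightarrow>\<^sub>M count_space Q" if "i \<in> J" for i J
    by (rule measurable_compose[OF _ g_meas]) (use that in \<open>rule measurable_component_singleton\<close>)
  define G where "G \<omega> = (\<lambda>i. g (\<omega> i))" for \<omega> :: "'i \<Rightarrow> real"
  have Gm: "G \<in> measurable (?B UNIV) (?C UNIV)"
    unfolding G_def
    by (rule measurable_PiM_single') (use g_comp measurable_space[OF g_meas] in auto)
  have Gm' [measurable]: "G \<in> measurable L.lim (?C UNIV)"
    using Gm measurable_cong_sets[OF L.sets_lim refl] by auto
  define \<nu> where "\<nu> = distr L.lim (?C UNIV) G"
  show ?thesis
  proof (rule that)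
    show "prob_space \<nu>" unfolding \<nu>_def by (rule L.P.prob_space_distr[OF Gm'])
    show "sets \<nu> = sets (?C UNIV)" by (simp add: \<nu>_def)
    fix J :: "'i set" and X assume J: "finite J" and X: "X \<in> sets (?C J)"
    let ?X = "prod_emb UNIV (\<lambda>_. count_space Q) J X"
    define h where "h \<omega> = (\<lambda>i\<in>J. g (\<omega> i))" for \<omega> :: "'i \<Rightarrow> real"
    have hm: "h \<in> measurable (?B J) (?C J)"
      unfolding h_def by (intro measurable_restrict g_comp)
    define X' where "X' = h -` X \<inter> space (?B J)"
    have X': "X' \<in> sets (?B J)" unfolding X'_def by (rule measurable_sets[OF hm X])
    have "emeasure \<nu> ?X = emeasure L.lim (G -` ?X \<inter> space L.lim)"
      unfolding \<nu>_def by (rule emeasure_distr[OF Gm']) (intro sets_PiM_I_finite measurable_prod_emb X, auto)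
    also have "G -` ?X \<inter> space L.lim = prod_emb UNIV (\<lambda>_. borel) J X'"
    proof -
      have "restrict (G \<omega>) J = h (restrict \<omega> J)" for \<omega> by (auto simp: G_def h_def fun_eq_iff)
      moreover have "G \<omega> i \<in> Q" for \<omega> i using measurable_space[OF g_meas] by (auto simp: G_def)
      ultimately show ?thesis by (auto simp: prod_emb_def X'_def space_PiM PiE_iff)
    qed
    also have "emeasure L.lim \<dots> = emeasure (P' J) X'"
      by (rule L.emeasure_lim_emb) (use J X' in auto)
    also have "\<dots> = emeasure (P J) (e J -` X' \<inter> space (P J))"
      unfolding P'_def by (rule emeasure_distr[OF em'[OF J] X'])
    also have "e J -` X' \<inter> space (P J) = X"
    proof -
      have "h (e J \<omega>) = \<omega>" "e J \<omega> \<in> space (?B J)" if "\<omega> \<in> space (?C J)" for \<omega>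
        using that by (auto simp: h_def e_def fun_eq_iff space_PiM PiE_iff extensional_def g_real)
      then show ?thesis
        using sets.sets_into_space[OF X] R.space_P[OF J] by (auto simp: X'_def)
    qed
    finally show "emeasure \<nu> ?X = emeasure (P J) X" .
  qed
qed

lemma measure_normalized_measure:
  assumes "finite S" "\<And>a. a \<in> S \<Longrightarrow> 0 \<le> w a" "X \<subseteq> S"
  shows "measure (normalized_measure S w) X = (\<Sum>a\<in>X. w a) / (\<Sum>a\<in>S. w a)"
proof -
  have nonneg: "0 \<le> w a / sum w S" if "a \<in> S" for a
    using assms(2) that by (intro divide_nonneg_nonneg sum_nonneg) auto
  have "emeasure (normalized_measure S w) X = (\<Sum>a\<in>X. ennreal (w a / sum w S))"
    unfolding normalized_measure_def using assms by (intro emeasure_point_measure_finite) auto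
  also have "\<dots> = ennreal (\<Sum>a\<in>X. w a / sum w S)"
    using assms(3) nonneg by (intro sum_ennreal) auto
  finally show ?thesis
    unfolding measure_def using assms(3) nonneg by (simp add: sum_divide_distrib subset_iff sum_nonneg)
qed

locale potts_tree = rooted_cayley_tree adj d root
  for adj :: "'v \<Rightarrow> 'v \<Rightarrow> bool" and d and root +
  fixes q :: nat and \<beta> :: real
  assumes q_pos: "1 \<le> q"
begin

declare One_nat_def [simp del]

sublocale tree_spin_system adj d root "{1..q}" "\<lambda>a b. exp (\<beta> * of_bool (a = b))" 1
  by unfold_locales (use q_pos in auto)

definition finite_volume :: "nat \<Rightarrow> ('v \<Rightarrow> nat) \<Rightarrow> 'v set \<Rightarrow> ('v \<Rightarrow> nat) set \<Rightarrow> real" where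
  "finite_volume n \<eta> F B = measure (potts_boundary adj q \<beta> \<eta> (ball n)) {\<sigma> \<in> conf (ball n). restrict \<sigma> F \<in> B}"

lemma exp_inner_sum: "exp (\<beta> * inner_sum adj (ball n) \<sigma>) = weight n \<sigma>"
proof -
  have "inner_sum adj (ball n) \<sigma> = (\<Sum>y\<in>ball n - {root}. of_bool (\<sigma> (parent y) = \<sigma> y))"
  proof -
    have inj: "inj_on (\<lambda>y. {parent y, y}) (ball n - {root})"
      by (rule inj_on_subset[OF inj_on_inner_edge]) auto
    show ?thesis unfolding inner_sum_def inner_edges_ball sum.reindex[OF inj] o_def
      by (intro sum.cong refl arg_cong[where f = of_bool]) auto
  qed
  then show ?thesis by (simp only: weight_def sum_distrib_left exp_sum finite_Diff finite_ball)
qed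

lemma exp_boundary_sum:
  "exp (\<beta> * inner_sum adj (ball n) \<sigma> + \<beta> * boundary_sum adj (ball n) \<eta> \<sigma>) = weight (Suc n) (override_on \<eta> \<sigma> (ball n))"
proof -
  have "boundary_sum adj (ball n) \<eta> \<sigma> = (\<Sum>y\<in>sphere (Suc n). of_bool (\<sigma> (parent y) = \<eta> y))"
  proof -
    have inj: "inj_on (\<lambda>y. (parent y, y)) (sphere (Suc n))" by (rule inj_onI) auto
    show ?thesis unfolding boundary_sum_def boundary_edges_ball sum.reindex[OF inj] o_def by simp
  qed
  then have "exp (\<beta> * boundary_sum adj (ball n) \<eta> \<sigma>) = (\<Prod>y\<in>sphere (Suc n). exp (\<beta> * of_bool (\<sigma> (parent y) = \<eta> y)))"
    by (simp only: sum_distrib_left exp_sum finite_sphere)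
  also have "\<dots> = (\<Prod>y\<in>sphere (Suc n). exp (\<beta> * of_bool (override_on \<eta> \<sigma> (ball n) (parent y) = override_on \<eta> \<sigma> (ball n) y)))"
  proof (rule prod.cong[OF refl])
    fix y assume "y \<in> sphere (Suc n)"
    then show "exp (\<beta> * of_bool (\<sigma> (parent y) = \<eta> y)) =
        exp (\<beta> * of_bool (override_on \<eta> \<sigma> (ball n) (parent y) = override_on \<eta> \<sigma> (ball n) y))"
      using lev_parent[of y] by (cases "y = root") (auto simp: override_on_def)
  qed
  finally show ?thesis
    unfolding exp_add exp_inner_sum weight_Suc
    by (metis (no_types, lifting) override_on_apply_in weight_cong)
qed

lemma finite_volume_eq:
  assumes "F \<subseteq> ball m" "m \<le> n"
  shows "finite_volume n \<eta> F B = (\<Sum>s\<in>conf (ball m). of_bool (restrict s F \<in> B) * marginal n m \<eta> s)"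
proof -
  let ?w = "\<lambda>\<sigma>. weight (Suc n) (override_on \<eta> \<sigma> (ball n))"
  have pos: "?w \<sigma> \<ge> 0" for \<sigma>
    unfolding weight_def by (intro prod_nonneg) auto
  have "finite_volume n \<eta> F B = (\<Sum>\<sigma>\<in>{\<sigma> \<in> conf (ball n). restrict \<sigma> F \<in> B}. ?w \<sigma>) / partition_sum n \<eta>"
    unfolding finite_volume_def potts_boundary_def exp_boundary_sum partition_sum_def
    by (rule measure_normalized_measure) (use pos in auto)
  also have "(\<Sum>\<sigma>\<in>{\<sigma> \<in> conf (ball n). restrict \<sigma> F \<in> B}. ?w \<sigma>) =
      (\<Sum>\<sigma>\<in>conf (ball n). of_bool (restrict \<sigma> F \<in> B) * ?w \<sigma>)"
    by (intro sum.mono_neutral_cong_left) auto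
  also have "\<dots> = (\<Sum>\<sigma>\<in>conf (ball n). \<Sum>s\<in>conf (ball m).
      of_bool (restrict s F \<in> B) * (of_bool (restrict \<sigma> (ball m) = s) * ?w \<sigma>))"
  proof (intro sum.cong refl)
    fix \<sigma> assume "\<sigma> \<in> conf (ball n)"
    then have "restrict \<sigma> (ball m) \<in> conf (ball m)" using assms(2) by (auto simp: PiE_iff)
    then have "of_bool (restrict \<sigma> F \<in> B) * ?w \<sigma> =
        (\<Sum>s\<in>conf (ball m). if s = restrict \<sigma> (ball m) then of_bool (restrict s F \<in> B) * ?w \<sigma> else 0)"
      by (simp add: Int_absorb1[OF assms(1)])
    also have "\<dots> = (\<Sum>s\<in>conf (ball m). of_bool (restrict s F \<in> B) * (of_bool (restrict \<sigma> (ball m) = s) * ?w \<sigma>))"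
      by (intro sum.cong refl) auto
    finally show "of_bool (restrict \<sigma> F \<in> B) * ?w \<sigma> = \<dots>" .
  qed
  also have "\<dots> = (\<Sum>s\<in>conf (ball m). of_bool (restrict s F \<in> B) * partial_sum n m \<eta> s)"
    by (subst sum.swap) (intro sum.cong refl,
      simp only: sum_distrib_left[symmetric] partition_sum_restrict[OF assms(2)])
  finally show ?thesis by (simp only: marginal_def sum_divide_distrib times_divide_eq_right)
qed

lemma finite_volume_marginal:
  assumes "m \<le> n" "s \<in> conf (ball m)"
  shows "finite_volume n \<eta> (ball m) {s} = marginal n m \<eta> s"
proof -
  have "finite_volume n \<eta> (ball m) {s} = (\<Sum>t\<in>conf (ball m). of_bool (restrict t (ball m) \<in> {s}) * marginal n m \<eta> t)"
    by (rule finite_volume_eq) (use assms in auto)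
  also have "\<dots> = (\<Sum>t\<in>conf (ball m). if t = s then marginal n m \<eta> t else 0)"
    by (intro sum.cong) (auto simp: PiE_restrict)
  finally show ?thesis using assms(2) by simp
qed

lemma is_limit_state_iff:
  "is_limit_state adj root q \<beta> \<eta> \<nu> \<longleftrightarrow> prob_space \<nu> \<and> sets \<nu> = sets (config_space q) \<and>
    (\<forall>F B. finite F \<longrightarrow> B \<subseteq> conf F \<longrightarrow>
      (\<lambda>n. finite_volume n \<eta> F B) \<longlonglongrightarrow> measure \<nu> {\<sigma> \<in> space \<nu>. restrict \<sigma> F \<in> B})"
  unfolding is_limit_state_def finite_volume_def ..

lemma is_limit_stateD:
  assumes "is_limit_state adj root q \<beta> \<eta> \<nu>"
  shows "prob_space \<nu>" "sets \<nu> = sets (config_space q)"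
    "finite F \<Longrightarrow> B \<subseteq> conf F \<Longrightarrow>
      (\<lambda>n. finite_volume n \<eta> F B) \<longlonglongrightarrow> measure \<nu> {\<sigma> \<in> space \<nu>. restrict \<sigma> F \<in> B}"
  using assms unfolding is_limit_state_iff by blast+

lemma finite_volume_tendsto:
  assumes "F \<subseteq> ball m" and p: "\<And>s. s \<in> conf (ball m) \<Longrightarrow> (\<lambda>k. marginal (k + m) m \<eta> s) \<longlonglongrightarrow> p s"
  shows "(\<lambda>n. finite_volume n \<eta> F B) \<longlonglongrightarrow> (\<Sum>s\<in>conf (ball m). of_bool (restrict s F \<in> B) * p s)"
proof (rule LIMSEQ_offset[where k = m])
  show "(\<lambda>k. finite_volume (k + m) \<eta> F B) \<longlonglongrightarrow> (\<Sum>s\<in>conf (ball m). of_bool (restrict s F \<in> B) * p s)"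
    unfolding finite_volume_eq[OF assms(1) le_add2] by (intro tendsto_intros p)
qed

lemma marginal_tendsto_limit_state:
  assumes "is_limit_state adj root q \<beta> \<eta> \<nu>" "s \<in> conf (ball m)"
  shows "(\<lambda>k. marginal (k + m) m \<eta> s) \<longlonglongrightarrow> measure \<nu> {\<sigma> \<in> space \<nu>. restrict \<sigma> (ball m) \<in> {s}}"
proof -
  have "(\<lambda>n. finite_volume n \<eta> (ball m) {s}) \<longlonglongrightarrow> measure \<nu> {\<sigma> \<in> space \<nu>. restrict \<sigma> (ball m) \<in> {s}}"
    by (rule is_limit_stateD(3)[OF assms(1)]) (use assms(2) in auto)
  then have "(\<lambda>k. finite_volume (k + m) \<eta> (ball m) {s}) \<longlonglongrightarrow> measure \<nu> {\<sigma> \<in> space \<nu>. restrict \<sigma> (ball m) \<in> {s}}"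
    by (rule LIMSEQ_ignore_initial_segment)
  then show ?thesis using finite_volume_marginal[OF le_add2 assms(2)] by simp
qed

lemma is_limit_state_transfer:
  assumes \<nu>: "is_limit_state adj root q \<beta> \<eta> \<nu>"
    and p: "\<And>m s. s \<in> conf (ball m) \<Longrightarrow> (\<lambda>k. marginal (k + m) m \<eta> s) \<longlonglongrightarrow> p m s"
      "\<And>m s. s \<in> conf (ball m) \<Longrightarrow> (\<lambda>k. marginal (k + m) m \<eta>' s) \<longlonglongrightarrow> p m s"
  shows "is_limit_state adj root q \<beta> \<eta>' \<nu>"
  unfolding is_limit_state_iff
proof (intro conjI allI impI)
  fix F :: "'v set" and B assume F: "finite F" "B \<subseteq> conf F"
  obtain m where m: "F \<subseteq> ball m" using finite_subset_ball[OF F(1)] by blast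
  have "(\<lambda>n. finite_volume n \<eta> F B) \<longlonglongrightarrow> measure \<nu> {\<sigma> \<in> space \<nu>. restrict \<sigma> F \<in> B}"
    by (rule is_limit_stateD(3)[OF \<nu> F])
  then show "(\<lambda>n. finite_volume n \<eta>' F B) \<longlonglongrightarrow> measure \<nu> {\<sigma> \<in> space \<nu>. restrict \<sigma> F \<in> B}"
    using LIMSEQ_unique[OF _ finite_volume_tendsto[OF m p(1), where B = B]]
      finite_volume_tendsto[OF m p(2), where B = B] by simp
qed (rule is_limit_stateD[OF \<nu>])+

lemma is_limit_state_unique:
  assumes "is_limit_state adj root q \<beta> \<eta> \<nu>" "is_limit_state adj root q \<beta> \<eta> \<nu>'"
  shows "\<nu> = \<nu>'"
proof (rule measure_eqI_PiM_infinite[where I = UNIV and M = "\<lambda>_. count_space {1..q}"])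
  show sets: "sets \<nu> = sets (config_space q)" "sets \<nu>' = sets (config_space q)"
    using assms by (blast dest: is_limit_stateD)+
  interpret \<nu>: prob_space \<nu> by (rule is_limit_stateD[OF assms(1)])
  interpret \<nu>': prob_space \<nu>' by (rule is_limit_stateD[OF assms(2)])
  show "finite_measure \<nu>" by unfold_locales
  fix A :: "'v \<Rightarrow> nat set" and J :: "'v set" assume J: "finite J" "\<And>i. i \<in> J \<Longrightarrow> A i \<in> sets (count_space {1..q})"
  have sp: "space \<nu> = space (config_space q)" "space \<nu>' = space (config_space q)"
    using sets sets_eq_imp_space_eq by blast+
  have "PiE J A \<subseteq> conf J" using J(2) by (intro PiE_mono) auto
  then have "measure \<nu> {\<sigma> \<in> space \<nu>. restrict \<sigma> J \<in> PiE J A} = measure \<nu>' {\<sigma> \<in> space \<nu>'. restrict \<sigma> J \<in> PiE J A}"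
    using LIMSEQ_unique[OF is_limit_stateD(3)[OF assms(1) J(1)] is_limit_stateD(3)[OF assms(2) J(1)]] by blast
  moreover have "prod_emb UNIV (\<lambda>_. count_space {1..q}) J (PiE J A) = {\<sigma> \<in> space (config_space q). restrict \<sigma> J \<in> PiE J A}"
    by (auto simp: prod_emb_def space_PiM)
  ultimately show "emeasure \<nu> (prod_emb UNIV (\<lambda>_. count_space {1..q}) J (PiE J A)) =
      emeasure \<nu>' (prod_emb UNIV (\<lambda>_. count_space {1..q}) J (PiE J A))"
    by (simp add: \<nu>.emeasure_eq_measure \<nu>'.emeasure_eq_measure sp)
qed

lemma limit_state_exists_of_marginals:
  assumes \<eta>: "range \<eta> \<subseteq> {1..q}"
    and p: "\<And>m s. s \<in> conf (ball m) \<Longrightarrow> (\<lambda>k. marginal (k + m) m \<eta> s) \<longlonglongrightarrow> p m s"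
  shows "limit_state_exists adj root q \<beta> \<eta>"
proof -
  have p_nonneg: "p m s \<ge> 0" if "s \<in> conf (ball m)" for m s
    using marginal_bounds(1)[OF \<eta> that] by (intro LIMSEQ_le_const[OF p[OF that]]) auto
  have p_sum: "(\<Sum>s\<in>conf (ball m). p m s) = 1" for m
  proof -
    have "(\<Sum>s\<in>conf (ball m). marginal (k + m) m \<eta> s) = 1" for k
      using partition_sum_pos[OF \<eta>, of k m]
      unfolding marginal_def sum_divide_distrib[symmetric] partition_sum_eq[of m "k + m", OF le_add2, symmetric] by simp
    moreover have "(\<lambda>k. \<Sum>s\<in>conf (ball m). marginal (k + m) m \<eta> s) \<longlonglongrightarrow> (\<Sum>s\<in>conf (ball m). p m s)"
      by (intro tendsto_sum p)
    ultimately show ?thesis by (simp add: LIMSEQ_const_iff)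
  qed
  define L where "L F B = lim (\<lambda>n. finite_volume n \<eta> F B)" for F B
  have L: "L F B = (\<Sum>s\<in>conf (ball m). of_bool (restrict s F \<in> B) * p m s)" if "F \<subseteq> ball m" for F B m
    unfolding L_def by (rule limI) (rule finite_volume_tendsto[OF that p])
  have L_tendsto: "(\<lambda>n. finite_volume n \<eta> F B) \<longlonglongrightarrow> L F B" if F: "finite F" for F B
  proof -
    obtain m where m: "F \<subseteq> ball m" using finite_subset_ball[OF F] by blast
    show ?thesis unfolding L[OF m] by (rule finite_volume_tendsto[OF m p])
  qed
  have L_nonneg: "L F B \<ge> 0" if F: "finite F" for F B
  proof -
    obtain m where m: "F \<subseteq> ball m" using finite_subset_ball[OF F] by blast
    show ?thesis unfolding L[OF m] using p_nonneg by (intro sum_nonneg) auto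
  qed
  have L_sum: "(\<Sum>t\<in>B. L F {t}) = L F B" if F: "finite F" "B \<subseteq> conf F" for F B
  proof -
    obtain m where m: "F \<subseteq> ball m" using finite_subset_ball[OF F(1)] by blast
    have fin: "finite B" using F finite_conf finite_subset by blast
    have "(\<Sum>t\<in>B. L F {t}) = (\<Sum>s\<in>conf (ball m). \<Sum>t\<in>B. of_bool (restrict s F \<in> {t}) * p m s)"
      unfolding L[OF m] by (rule sum.swap)
    also have "\<dots> = (\<Sum>s\<in>conf (ball m). of_bool (restrict s F \<in> B) * p m s)"
    proof (intro sum.cong refl)
      fix s
      have "(\<Sum>t\<in>B. of_bool (restrict s F \<in> {t}) * p m s) = (\<Sum>t\<in>B. if t = restrict s F then p m s else 0)"
        by (intro sum.cong) auto
      then show "(\<Sum>t\<in>B. of_bool (restrict s F \<in> {t}) * p m s) = of_bool (restrict s F \<in> B) * p m s"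
        using fin by simp
    qed
    finally show ?thesis unfolding L[OF m] .
  qed
  define P where "P F = point_measure (conf F) (\<lambda>t. ennreal (L F {t}))" for F
  let ?C = "\<lambda>F. PiM F (\<lambda>_. count_space {1..q}) :: ('v \<Rightarrow> nat) measure"
  have C: "?C F = count_space (conf F)" if "finite F" for F
    by (rule count_space_PiM_finite) (use that in auto)
  have sets_P: "sets (P F) = Pow (conf F)" "space (P F) = conf F" for F
    by (simp_all add: P_def sets_point_measure space_point_measure)
  have emeasure_P: "emeasure (P F) B = ennreal (L F B)" if F: "finite F" "B \<subseteq> conf F" for F B
  proof -
    have "emeasure (P F) B = (\<Sum>t\<in>B. ennreal (L F {t}))"
      unfolding P_def using F by (intro emeasure_point_measure_finite) auto
    also have "\<dots> = ennreal (\<Sum>t\<in>B. L F {t})" using L_nonneg F by (intro sum_ennreal) auto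
    finally show ?thesis unfolding L_sum[OF F] .
  qed
  have "projective_family UNIV P (\<lambda>_. count_space {1..q})"
  proof (rule projective_family.intro)
    fix J H :: "'v set" assume JH: "J \<subseteq> H" "finite H"
    then have "finite J" by (rule finite_subset)
    have meas: "(\<lambda>f. restrict f J) \<in> measurable (P H) (?C J)"
      using JH unfolding C[OF \<open>finite J\<close>] measurable_def by (auto simp: sets_P PiE_iff)
    show "P J = distr (P H) (?C J) (\<lambda>f. restrict f J)"
    proof (rule measure_eqI)
      show "sets (P J) = sets (distr (P H) (?C J) (\<lambda>f. restrict f J))"
        by (simp add: sets_P C[OF \<open>finite J\<close>])
      fix B assume "B \<in> sets (P J)"
      then have B: "B \<subseteq> conf J" by (simp add: sets_P)
      obtain m where m: "H \<subseteq> ball m" using finite_subset_ball[OF JH(2)] by blast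
      have "emeasure (distr (P H) (?C J) (\<lambda>f. restrict f J)) B = emeasure (P H) ((\<lambda>f. restrict f J) -` B \<inter> space (P H))"
        by (rule emeasure_distr[OF meas]) (use B in \<open>simp add: C[OF \<open>finite J\<close>]\<close>)
      also have "\<dots> = ennreal (L H ((\<lambda>f. restrict f J) -` B \<inter> space (P H)))"
        by (rule emeasure_P[OF JH(2)]) (auto simp: sets_P)
      also have "L H ((\<lambda>f. restrict f J) -` B \<inter> space (P H)) = L J B"
        unfolding L[OF m] L[OF order_trans[OF JH(1) m]]
      proof (intro sum.cong refl)
        fix s assume s: "s \<in> conf (ball m)"
        have "restrict s H \<in> conf H" using s m by (auto simp: PiE_iff)
        moreover have "restrict (restrict s H) J = restrict s J" using JH(1) by (auto simp: fun_eq_iff)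
        ultimately show "of_bool (restrict s H \<in> (\<lambda>f. restrict f J) -` B \<inter> space (P H)) * p m s =
            of_bool (restrict s J \<in> B) * p m s" by (simp add: sets_P)
      qed
      also have "ennreal (L J B) = emeasure (P J) B" by (rule emeasure_P[OF \<open>finite J\<close> B, symmetric])
      finally show "emeasure (P J) B = emeasure (distr (P H) (?C J) (\<lambda>f. restrict f J)) B" by (rule sym)
    qed
  next
    fix J :: "'v set" assume J: "finite J"
    obtain m where m: "J \<subseteq> ball m" using finite_subset_ball[OF J] by blast
    have "L J (conf J) = (\<Sum>s\<in>conf (ball m). p m s)"
      unfolding L[OF m] using m by (intro sum.cong refl) (auto simp: PiE_iff)
    then have "emeasure (P J) (space (P J)) = 1" using emeasure_P[OF J] p_sum by (simp add: sets_P)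
    then show "prob_space (P J)" by (rule prob_spaceI)
  qed
  then obtain \<nu> where \<nu>: "prob_space \<nu>" "sets \<nu> = sets (config_space q)"
    "\<And>J X. finite J \<Longrightarrow> X \<in> sets (?C J) \<Longrightarrow>
      emeasure \<nu> (prod_emb UNIV (\<lambda>_. count_space {1..q}) J X) = emeasure (P J) X"
    using projective_family_count_space_nat_limit by blast
  have "is_limit_state adj root q \<beta> \<eta> \<nu>"
    unfolding is_limit_state_iff
  proof (intro conjI allI impI \<nu>)
    fix F :: "'v set" and B assume F: "finite F" "B \<subseteq> conf F"
    have "{\<sigma> \<in> space \<nu>. restrict \<sigma> F \<in> B} = prod_emb UNIV (\<lambda>_. count_space {1..q}) F B"
      using sets_eq_imp_space_eq[OF \<nu>(2)] by (auto simp: prod_emb_def space_PiM)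
    then have "emeasure \<nu> {\<sigma> \<in> space \<nu>. restrict \<sigma> F \<in> B} = ennreal (L F B)"
      using \<nu>(3)[OF F(1), of B] F emeasure_P[OF F] by (simp add: C)
    then have "measure \<nu> {\<sigma> \<in> space \<nu>. restrict \<sigma> F \<in> B} = L F B"
      using L_nonneg[OF F(1)] by (simp add: measure_def)
    then show "(\<lambda>n. finite_volume n \<eta> F B) \<longlonglongrightarrow> measure \<nu> {\<sigma> \<in> space \<nu>. restrict \<sigma> F \<in> B}"
      using L_tendsto[OF F(1)] by simp
  qed
  then show ?thesis unfolding limit_state_exists_def by blast
qed

lemma same_limit_iff_agree:
  assumes \<eta>: "range \<eta> \<subseteq> {1..q}" "range \<eta>' \<subseteq> {1..q}"
  shows "limit_state_exists adj root q \<beta> \<eta> \<and> limit_state_exists adj root q \<beta> \<eta>' \<and>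
      limit_state adj root q \<beta> \<eta> = limit_state adj root q \<beta> \<eta>' \<longleftrightarrow> (\<forall>x. agree \<eta> \<eta>' x)"
proof
  assume *: "limit_state_exists adj root q \<beta> \<eta> \<and> limit_state_exists adj root q \<beta> \<eta>' \<and>
      limit_state adj root q \<beta> \<eta> = limit_state adj root q \<beta> \<eta>'"
  have lim: "is_limit_state adj root q \<beta> \<zeta> (limit_state adj root q \<beta> \<zeta>)" if "limit_state_exists adj root q \<beta> \<zeta>" for \<zeta>
    using that is_limit_state_unique unfolding limit_state_exists_def limit_state_def by (metis theI)
  define \<nu> where "\<nu> = limit_state adj root q \<beta> \<eta>"
  have \<nu>: "is_limit_state adj root q \<beta> \<eta> \<nu>" "is_limit_state adj root q \<beta> \<eta>' \<nu>"
    using lim[of \<eta>] lim[of \<eta>'] * by (auto simp: \<nu>_def)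
  show "\<forall>x. agree \<eta> \<eta>' x"
  proof
    fix x
    define p where "p s = measure \<nu> {\<sigma> \<in> space \<nu>. restrict \<sigma> (ball (lev x)) \<in> {s}}" for s
    show "agree \<eta> \<eta>' x" unfolding agree_def
    proof (intro exI ballI conjI)
      fix a assume a: "a \<in> {1..q}"
      show "(\<lambda>k. ratio k x \<eta> a) \<longlonglongrightarrow> (\<lambda>a. p (flip_conf (lev x) x a) / p (ref_conf (lev x)) *
          (weight (lev x) (ref_conf (lev x)) / weight (lev x) (flip_conf (lev x) x a))) a"
        by (rule ratio_tendsto[OF \<eta>(1) a refl]) (unfold p_def, rule marginal_tendsto_limit_state[OF \<nu>(1)])
      show "(\<lambda>k. ratio k x \<eta>' a) \<longlonglongrightarrow> (\<lambda>a. p (flip_conf (lev x) x a) / p (ref_conf (lev x)) *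
          (weight (lev x) (ref_conf (lev x)) / weight (lev x) (flip_conf (lev x) x a))) a"
        by (rule ratio_tendsto[OF \<eta>(2) a refl]) (unfold p_def, rule marginal_tendsto_limit_state[OF \<nu>(2)])
    qed
  qed
next
  assume "\<forall>x. agree \<eta> \<eta>' x"
  then obtain L where L: "\<And>x a. a \<in> {1..q} \<Longrightarrow> (\<lambda>k. ratio k x \<eta> a) \<longlonglongrightarrow> L x a"
    "\<And>x a. a \<in> {1..q} \<Longrightarrow> (\<lambda>k. ratio k x \<eta>' a) \<longlonglongrightarrow> L x a"
    unfolding agree_def by metis
  define p where "p m s = weight m s * (\<Prod>x\<in>sphere m. L x (s x)) /
    (\<Sum>s'\<in>conf (ball m). weight m s' * (\<Prod>x\<in>sphere m. L x (s' x)))" for m s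
  have p: "(\<lambda>k. marginal (k + m) m \<eta> s) \<longlonglongrightarrow> p m s" "(\<lambda>k. marginal (k + m) m \<eta>' s) \<longlonglongrightarrow> p m s"
    if "s \<in> conf (ball m)" for m s
    unfolding p_def by (rule marginal_tendsto[OF \<eta>(1) that L(1)], assumption)
      (rule marginal_tendsto[OF \<eta>(2) that L(2)], assumption)
  have "is_limit_state adj root q \<beta> \<eta> = is_limit_state adj root q \<beta> \<eta>'"
    using is_limit_state_transfer[of \<eta> _ p \<eta>'] is_limit_state_transfer[of \<eta>' _ p \<eta>] p by blast
  then show "limit_state_exists adj root q \<beta> \<eta> \<and> limit_state_exists adj root q \<beta> \<eta>' \<and>
      limit_state adj root q \<beta> \<eta> = limit_state adj root q \<beta> \<eta>'"
    using limit_state_exists_of_marginals[OF \<eta>(1) p(1)] limit_state_exists_of_marginals[OF \<eta>(2) p(2)]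
    unfolding limit_state_def by simp
qed

end

section \<open>Pairs of independent boundary conditions\<close>

lemma (in tree_spin_system) agree_iff_lim:
  "agree \<eta> \<eta>' x \<longleftrightarrow> (\<forall>a\<in>Q. Cauchy (\<lambda>k. ratio k x \<eta> a) \<and> Cauchy (\<lambda>k. ratio k x \<eta>' a) \<and>
    lim (\<lambda>k. ratio k x \<eta> a) = lim (\<lambda>k. ratio k x \<eta>' a))"
proof
  assume "agree \<eta> \<eta>' x"
  then show "\<forall>a\<in>Q. Cauchy (\<lambda>k. ratio k x \<eta> a) \<and> Cauchy (\<lambda>k. ratio k x \<eta>' a) \<and>
    lim (\<lambda>k. ratio k x \<eta> a) = lim (\<lambda>k. ratio k x \<eta>' a)"
    unfolding agree_def by (metis LIMSEQ_imp_Cauchy limI)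
next
  assume *: "\<forall>a\<in>Q. Cauchy (\<lambda>k. ratio k x \<eta> a) \<and> Cauchy (\<lambda>k. ratio k x \<eta>' a) \<and>
    lim (\<lambda>k. ratio k x \<eta> a) = lim (\<lambda>k. ratio k x \<eta>' a)"
  show "agree \<eta> \<eta>' x"
    unfolding agree_def
  proof (intro exI[of _ "\<lambda>a. lim (\<lambda>k. ratio k x \<eta> a)"] ballI)
    fix a assume "a \<in> Q"
    then have "convergent (\<lambda>k. ratio k x \<eta> a)" "convergent (\<lambda>k. ratio k x \<eta>' a)"
      "lim (\<lambda>k. ratio k x \<eta> a) = lim (\<lambda>k. ratio k x \<eta>' a)"
      using * Cauchy_convergent by auto
    then show "(\<lambda>k. ratio k x \<eta> a) \<longlonglongrightarrow> lim (\<lambda>k. ratio k x \<eta> a) \<and>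
        (\<lambda>k. ratio k x \<eta>' a) \<longlonglongrightarrow> lim (\<lambda>k. ratio k x \<eta> a)"
      by (simp add: convergent_LIMSEQ_iff)
  qed
qed

context potts_tree
begin

lemma free_state_space:
  assumes "is_free_state adj q \<beta> \<mu>" "\<sigma> \<in> space \<mu>"
  shows "range \<sigma> \<subseteq> {1..q}"
proof -
  have "space \<mu> = space (config_space q)"
    using assms(1) by (intro sets_eq_imp_space_eq) (simp add: is_free_state_def)
  then show ?thesis using assms(2) by (auto simp: space_PiM)
qed

lemma free_state_cylinder:
  assumes \<mu>: "is_free_state adj q \<beta> \<mu>" and t: "t \<in> conf (ball n)"
  shows "measure \<mu> {\<sigma> \<in> space \<mu>. \<forall>v\<in>ball n. \<sigma> v = t v} = weight n t / (\<Sum>t'\<in>conf (ball n). weight n t')"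
proof -
  have sp: "space (potts_free adj q \<beta> (ball n)) = conf (ball n)"
    by (simp add: potts_free_def normalized_measure_def space_point_measure)
  have single: "{\<sigma> \<in> conf (ball n). \<forall>u\<in>ball n. \<sigma> u = t u} = {t}"
    using t by (auto intro: PiE_ext)
  have "measure \<mu> {\<sigma> \<in> space \<mu>. \<forall>v\<in>ball n. \<sigma> v = t v} =
      measure (potts_free adj q \<beta> (ball n)) {\<sigma> \<in> space (potts_free adj q \<beta> (ball n)). \<forall>u\<in>ball n. \<sigma> u = t u}"
    using \<mu> t connected_in_ball[of n] finite_ball[of n] unfolding is_free_state_def by blast
  also have "\<dots> = measure (potts_free adj q \<beta> (ball n)) {t}" unfolding sp single ..
  also have "\<dots> = (\<Sum>t'\<in>{t}. weight n t') / (\<Sum>t'\<in>conf (ball n). weight n t')"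
    unfolding potts_free_def exp_inner_sum
    by (rule measure_normalized_measure) (use t weight_conf_pos in \<open>auto intro: less_imp_le\<close>)
  finally show ?thesis by simp
qed

lemma free_state_spin_sets:
  assumes "is_free_state adj q \<beta> \<mu>"
  shows "{\<sigma> \<in> space \<mu>. \<sigma> v = a} \<in> sets \<mu>"
proof -
  have sets: "sets \<mu> = sets (config_space q)" using assms by (simp add: is_free_state_def)
  then have sp: "space \<mu> = space (config_space q)" by (rule sets_eq_imp_space_eq)
  have "{\<sigma> \<in> space (config_space q). \<sigma> v = a} = (\<lambda>\<sigma>. \<sigma> v) -` ({a} \<inter> {1..q}) \<inter> space (config_space q)"
    by (auto simp: space_PiM)
  also have "\<dots> \<in> sets (config_space q)"
    by (rule measurable_sets[OF measurable_component_singleton]) auto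
  finally show ?thesis by (simp add: sets sp)
qed

lemma free_state_markov:
  assumes "is_free_state adj q \<beta> \<mu>"
  shows "tree_markov_field adj d root {1..q} (\<lambda>a b. exp (\<beta> * of_bool (a = b))) 1 \<mu> (\<lambda>v \<sigma>. \<sigma> v)"
proof (intro tree_markov_field.intro tree_markov_field_axioms.intro)
  show "tree_spin_system adj d {1..q} (\<lambda>a b. exp (\<beta> * of_bool (a = b))) 1" by unfold_locales
  show "prob_space \<mu>" using assms by (simp add: is_free_state_def)
  show "\<sigma> v \<in> {1..q}" if "\<sigma> \<in> space \<mu>" for v \<sigma>
    by (rule subsetD[OF free_state_space[OF assms that] rangeI])
qed (use free_state_spin_sets[OF assms] free_state_cylinder[OF assms] in auto)

lemma free_state_AE_limit_state_exists:
  assumes \<mu>: "is_free_state adj q \<beta> \<mu>"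
  shows "AE \<eta> in \<mu>. limit_state_exists adj root q \<beta> \<eta>"
proof -
  interpret F: tree_markov_field adj d root "{1..q}" "\<lambda>a b. exp (\<beta> * of_bool (a = b))" 1 \<mu> "\<lambda>v \<sigma>. \<sigma> v"
    by (rule free_state_markov[OF \<mu>])
  have "AE \<eta> in \<mu>. \<forall>m. \<forall>s\<in>conf (ball m). convergent (\<lambda>k. marginal (k + m) m \<eta> s)"
    using F.AE_all_marginals_convergent by simp
  then show ?thesis
  proof (rule AE_mp, intro AE_I2 impI)
    fix \<eta> assume \<eta>: "\<eta> \<in> space \<mu>" "\<forall>m. \<forall>s\<in>conf (ball m). convergent (\<lambda>k. marginal (k + m) m \<eta> s)"
    then have "(\<lambda>k. marginal (k + m) m \<eta> s) \<longlonglongrightarrow> lim (\<lambda>k. marginal (k + m) m \<eta> s)" if "s \<in> conf (ball m)" for m s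
      using that by (simp add: convergent_LIMSEQ_iff)
    then show "limit_state_exists adj root q \<beta> \<eta>"
      by (rule limit_state_exists_of_marginals[OF free_state_space[OF \<mu> \<eta>(1)]])
  qed
qed

abbreviation pair_kernel :: "nat \<times> nat \<Rightarrow> nat \<times> nat \<Rightarrow> real" where
  "pair_kernel a b \<equiv> exp (\<beta> * of_bool (fst a = fst b)) * exp (\<beta> * of_bool (snd a = snd b))"

lemma free_state_pair_markov:
  assumes \<mu>: "is_free_state adj q \<beta> \<mu>"
  shows "tree_markov_field adj d root ({1..q} \<times> {1..q}) pair_kernel (1, 1) (\<mu> \<Otimes>\<^sub>M \<mu>) (\<lambda>v \<omega>. (fst \<omega> v, snd \<omega> v))"
proof -
  interpret \<mu>: prob_space \<mu> using \<mu> by (simp add: is_free_state_def)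
  interpret \<mu>2: pair_prob_space \<mu> \<mu> ..
  interpret two: tree_spin_system adj d root "{1..q} \<times> {1..q}" pair_kernel "(1, 1)"
    by unfold_locales (use q_pos in auto)
  have rect: "measure (\<mu> \<Otimes>\<^sub>M \<mu>) (A \<times> B) = measure \<mu> A * measure \<mu> B" if "A \<in> sets \<mu>" "B \<in> sets \<mu>" for A B
    using that by (simp add: measure_def \<mu>.emeasure_pair_measure_Times enn2real_mult)
  have weight: "two.weight n t = weight n (\<lambda>v. fst (t v)) * weight n (\<lambda>v. snd (t v))" for n t
    by (simp add: two.weight_def weight_def prod.distrib)
  have wcong: "weight n (restrict f (ball n)) = weight n f" for n f
    by (rule weight_cong) simp
  have total: "(\<Sum>t\<in>two.conf (ball n). two.weight n t) =
      (\<Sum>s\<in>conf (ball n). weight n s) * (\<Sum>s\<in>conf (ball n). weight n s)" for n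
    unfolding sum_product sum.cartesian_product weight
    by (rule sum.reindex_bij_witness[where
        j = "\<lambda>t. (\<lambda>v\<in>ball n. fst (t v), \<lambda>v\<in>ball n. snd (t v))" and
        i = "\<lambda>(s, s'). \<lambda>v\<in>ball n. (s v, s' v)"])
      (auto simp: wcong fun_eq_iff PiE_iff extensional_def mem_Times_iff split: if_splits)
  show ?thesis
  proof (intro tree_markov_field.intro tree_markov_field_axioms.intro)
    show "tree_spin_system adj d ({1..q} \<times> {1..q}) pair_kernel (1, 1)" by unfold_locales
    show "prob_space (\<mu> \<Otimes>\<^sub>M \<mu>)" by unfold_locales
    show "(fst \<omega> v, snd \<omega> v) \<in> {1..q} \<times> {1..q}" if "\<omega> \<in> space (\<mu> \<Otimes>\<^sub>M \<mu>)" for \<omega> v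
      using that free_state_space[OF \<mu>] by (auto simp: space_pair_measure image_subset_iff)
    show "{\<omega> \<in> space (\<mu> \<Otimes>\<^sub>M \<mu>). (fst \<omega> v, snd \<omega> v) = a} \<in> sets (\<mu> \<Otimes>\<^sub>M \<mu>)" for v a
    proof -
      have "{\<omega> \<in> space (\<mu> \<Otimes>\<^sub>M \<mu>). (fst \<omega> v, snd \<omega> v) = a} =
          {\<sigma> \<in> space \<mu>. \<sigma> v = fst a} \<times> {\<sigma> \<in> space \<mu>. \<sigma> v = snd a}"
        by (auto simp: space_pair_measure)
      then show ?thesis using free_state_spin_sets[OF \<mu>] by simp
    qed
    fix n t assume t: "t \<in> two.conf (ball n)"
    let ?C = "\<lambda>s. {\<sigma> \<in> space \<mu>. \<forall>v\<in>ball n. \<sigma> v = s v}"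
    have C: "?C s \<in> sets \<mu>" for s
      using free_state_spin_sets[OF \<mu>] by (intro sets.sets_Collect_finite_All) auto
    have "{\<omega> \<in> space (\<mu> \<Otimes>\<^sub>M \<mu>). \<forall>v\<in>ball n. (fst \<omega> v, snd \<omega> v) = t v} =
        ?C (\<lambda>v\<in>ball n. fst (t v)) \<times> ?C (\<lambda>v\<in>ball n. snd (t v))"
      by (auto simp: space_pair_measure prod_eq_iff)
    then show "measure (\<mu> \<Otimes>\<^sub>M \<mu>) {\<omega> \<in> space (\<mu> \<Otimes>\<^sub>M \<mu>). \<forall>v\<in>ball n. (fst \<omega> v, snd \<omega> v) = t v} =
        two.weight n t / (\<Sum>t'\<in>two.conf (ball n). two.weight n t')"
    proof -
      have "(\<lambda>v\<in>ball n. fst (t v)) \<in> conf (ball n)" "(\<lambda>v\<in>ball n. snd (t v)) \<in> conf (ball n)"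
        using t by (auto simp: PiE_iff mem_Times_iff)
      then show ?thesis
        unfolding \<open>_ = ?C (\<lambda>v\<in>ball n. fst (t v)) \<times> _\<close> rect[OF C C] total
        by (simp only: free_state_cylinder[OF \<mu>] weight wcong times_divide_times_eq)
    qed
  qed
qed

theorem free_state_zero_one:
  assumes \<mu>: "is_free_state adj q \<beta> \<mu>"
  shows "same_limit_event adj root q \<beta> \<in> sets (\<mu> \<Otimes>\<^sub>M \<mu>) \<and>
    measure (\<mu> \<Otimes>\<^sub>M \<mu>) (same_limit_event adj root q \<beta>) \<in> {0, 1}"
proof -
  interpret two: tree_markov_field adj d root "{1..q} \<times> {1..q}" pair_kernel "(1, 1)" "\<mu> \<Otimes>\<^sub>M \<mu>"
    "\<lambda>v \<omega>. (fst \<omega> v, snd \<omega> v)"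
    by (rule free_state_pair_markov[OF \<mu>])
  let ?N = "\<mu> \<Otimes>\<^sub>M \<mu>"
  have range: "range (fst \<omega>) \<subseteq> {1..q}" "range (snd \<omega>) \<subseteq> {1..q}" if "\<omega> \<in> space ?N" for \<omega>
    using that by (auto simp: space_pair_measure intro!: free_state_space[OF \<mu>] simp del: image_subset_iff)
  have "sets \<mu> = sets (config_space q)" using \<mu> by (simp add: is_free_state_def)
  then have "space \<mu> = space (config_space q)" by (rule sets_eq_imp_space_eq)
  then have sp: "space ?N = space (config_space q \<Otimes>\<^sub>M config_space q)"
    by (simp add: space_pair_measure)
  have event: "same_limit_event adj root q \<beta> = {\<omega> \<in> space ?N. \<forall>x. agree (fst \<omega>) (snd \<omega>) x}"
    unfolding same_limit_event_def sp[symmetric]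
  proof (rule set_eqI)
    fix \<omega> :: "('v \<Rightarrow> nat) \<times> ('v \<Rightarrow> nat)"
    show "\<omega> \<in> {(\<eta>1, \<eta>2) \<in> space ?N. limit_state_exists adj root q \<beta> \<eta>1 \<and> limit_state_exists adj root q \<beta> \<eta>2 \<and>
        limit_state adj root q \<beta> \<eta>1 = limit_state adj root q \<beta> \<eta>2} \<longleftrightarrow>
      \<omega> \<in> {\<omega> \<in> space ?N. \<forall>x. agree (fst \<omega>) (snd \<omega>) x}"
    proof (cases "\<omega> \<in> space ?N")
      case True
      then show ?thesis using same_limit_iff_agree[OF range[OF True]] by (simp add: case_prod_beta)
    qed auto
  qed
  define E where "E x = {\<omega> \<in> space ?N. \<forall>y\<in>insert x (below x). agree (fst \<omega>) (snd \<omega>) y}" for x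
  have E_sets: "E x \<in> sigma_sets (space ?N) (two.local_events (below x))" for x
  proof -
    let ?S = "sigma (space ?N) (two.local_events (below x))"
    have S: "sets ?S = sigma_sets (space ?N) (two.local_events (below x))" "space ?S = space ?N"
    proof -
      have "two.local_events (below x) \<subseteq> Pow (space ?N)"
        by (auto simp: two.local_events_def two.depends_on_def)
      then show "sets ?S = sigma_sets (space ?N) (two.local_events (below x))" "space ?S = space ?N"
        by (rule sets_measure_of, rule space_measure_of)
    qed
    have meas: "(\<lambda>\<omega>. ratio k y (fst \<omega>) a) \<in> borel_measurable ?S \<and> (\<lambda>\<omega>. ratio k y (snd \<omega>) a) \<in> borel_measurable ?S"
      if y: "y \<in> insert x (below x)" for k y a
    proof -
      let ?F = "below y \<inter> ball (lev y + Suc k)"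
      have sub: "?F \<subseteq> below x" using y below_trans[of y x] by auto
      have "ratio k y (fst \<omega>) a = ratio k y (fst \<omega>') a \<and> ratio k y (snd \<omega>) a = ratio k y (snd \<omega>') a"
        if "\<And>v. v \<in> ?F \<Longrightarrow> (fst \<omega> v, snd \<omega> v) = (fst \<omega>' v, snd \<omega>' v)" for \<omega> \<omega>' :: "('v \<Rightarrow> nat) \<times> ('v \<Rightarrow> nat)"
        using that by (intro conjI ratio_cong_below) auto
      then show ?thesis
        by (intro conjI two.borel_measurable_local[OF _ sub]) (simp, blast, simp, blast)
    qed
    have "{\<omega> \<in> space ?S. agree (fst \<omega>) (snd \<omega>) y} \<in> sets ?S" if y: "y \<in> insert x (below x)" for y
      unfolding agree_iff_lim
    proof (intro sets.sets_Collect_finite_All' sets.sets_Collect_conj)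
      fix a
      note m = meas[OF y, THEN conjunct1] meas[OF y, THEN conjunct2]
      show "{\<omega> \<in> space ?S. Cauchy (\<lambda>k. ratio k y (fst \<omega>) a)} \<in> sets ?S"
        "{\<omega> \<in> space ?S. Cauchy (\<lambda>k. ratio k y (snd \<omega>) a)} \<in> sets ?S"
        by (rule sets_Collect_Cauchy, rule m)+
      show "{\<omega> \<in> space ?S. lim (\<lambda>k. ratio k y (fst \<omega>) a) = lim (\<lambda>k. ratio k y (snd \<omega>) a)} \<in> sets ?S"
        by (intro borel_measurable_eq borel_measurable_lim_metric m)
    qed (use q_pos in auto)
    then have "(\<Inter>y\<in>insert x (below x). {\<omega> \<in> space ?S. agree (fst \<omega>) (snd \<omega>) y}) \<in> sets ?S"
      by (intro sets.countable_INT' countable_subset[OF subset_UNIV countable_vertices]) blast+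
    moreover have "(\<Inter>y\<in>insert x (below x). {\<omega> \<in> space ?S. agree (fst \<omega>) (snd \<omega>) y}) = E x"
      unfolding E_def S by blast
    ultimately show ?thesis unfolding S by simp
  qed
  have "same_limit_event adj root q \<beta> = space ?N \<inter> (\<Inter>x\<in>sphere m. E x)" for m
    unfolding event E_def using agree_iff_level[OF range, of _ _ m] by blast
  from two.zero_one_law[OF E_sets this] show ?thesis .
qed

end

theorem proposition3:
  fixes adj :: "'v \<Rightarrow> 'v \<Rightarrow> bool" and x0 :: 'v and d q :: nat and \<beta> :: real
    and \<mu> :: "('v \<Rightarrow> nat) measure"
  assumes "d \<ge> 2" and "q \<ge> 2" and "\<beta> \<ge> 0"
    and "cayley_tree adj d"
    and "is_free_state adj q \<beta> \<mu>"
  shows "(AE \<eta> in \<mu>. limit_state_exists adj x0 q \<beta> \<eta>) \<and>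
    same_limit_event adj x0 q \<beta> \<in> sets (\<mu> \<Otimes>\<^sub>M \<mu>) \<and>
    measure (\<mu> \<Otimes>\<^sub>M \<mu>) (same_limit_event adj x0 q \<beta>) \<in> {0, 1}"
proof -
  interpret cayley_tree adj d by fact
  interpret potts_tree adj d x0 q \<beta>
    by unfold_locales (use assms(2) in simp)
  show ?thesis
    using free_state_AE_limit_state_exists free_state_zero_one assms(5) by blast
qed

end
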